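(* Consider a G/G/1+G queue (single server, first-come-first-served, abandonment while waiting) with i.i.d. inter-arrival times $t_n$ with distribution function $A$, i.i.d. service times $s_n$ with distribution function $B$ and i.i.d. patience times $y_n$ with distribution function $G$, the three sequences being independent. Assume: (i) there are $\bar y,\bar s\in\mathbb{R}_+$ with $G(\bar y)=B(\bar s)=1$ and $\bar y+\bar s\le1$; (ii) there are $g_1,a_1,a_2\in\mathbb{R}_+$ with $G'(x)\le g_1$, $A'(x)\le a_1$, $|A''(x)|\le a_2$ for all $x\in\Omega=[0,1]$; (iii) $\mathbb{P}[s_n-t_{n+1}<0]>0$. Let the virtual waiting times follow the Markov chain on $\Omega$ $$w_{n+1}=\begin{cases}[w_n+s_n-t_{n+1}]_+,& y_n>w_n,\\ [w_n-t_{n+1}]_+,&\text{otherwise,}\end{cases}$$ whose Markov kernel is $\bar\kappa(x,u)=\bar G(u)D(x-u)+G(u)A^*(u-x)$ for $x,u\in\Omega$, where $\bar G=1-G$, $D$ is the distribution function of $s_n-t_{n+1}$, and $A^*(x):=1-A(x-)$. For $r\in\mathbb{N}$ let $J^{(r)}=2^r+1$, $$c^{(r)}_i:=\frac{i-1}{2^r}\ (i=1,\dots,J^{(r)}),\qquad q^{(r)}_{ij}:=\bar\kappa(c^{(r)}_j,c^{(r)}_i)-\bar\kappa(c^{(r)}_{j-1},c^{(r)}_i)\ (i,j=1,\dots,J^{(r)}),$$ with $c^{(r)}_0:=-\infty$ and $\bar\kappa(-\infty,\cdot):=0$. Then $\bar\kappa$ satisfies Uniformly Bounded Variation, C\`adl\`ag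 and Countable Jump Discontinuities, and Unique Stationary Distribution, and the sequence of finite-state Markov chains with states $\{c^{(r)}_i\}$ and transition matrices $\{q^{(r)}_{ij}\}$ satisfies Proper Truncation with respect to $\bar\kappa$.
   Context: $[x]_+=\max\{x,0\}$. $\Omega=[0,1]$, $\mathcal{B}$ its Borel $\sigma$-algebra. $\mathbf{D}$ is the set of (right-continuous) distribution functions of probability measures on $(\Omega,\mathcal{B})$, viewed as functions on $\mathbb{R}$ that vanish for $x<0$ and are constant on $[1,\infty)$. $\mathbf{X}=\mathrm{span}(\mathbf{D})$, and $\bar{\mathbf{X}}$ is its closure under the supremum norm $\|\cdot\|_\infty$. For $f\in\mathbf{X}$, $\int_\Omega g\,df$ is the integral against the signed measure with distribution function $f$ (including a possible atom at $0$); for $f\in\bar{\mathbf{X}}\setminus\mathbf{X}$, $\int_\Omega\bar\kappa(x,u)\,df(u)$ means $\lim_k\int_\Omega\bar\kappa(x,u)\,df_k(u)$ for any $(f_k)\subseteq\mathbf{X}$ converging to $f$ in $\|\cdot\|_\infty$ (well defined under Uniformly Bounded Variation). A stationary distribution of $\bar\kappa$ is $p\in\mathbf{D}$ with $p(x)=\int_\Omega\bar\kappa(x,u)\,dp(u)$ for all $x\in\Omega$. $V_u(\cdot)$ denotes total variation over $\Omega$ in the variable $u$. Put $c^{(r)}_{J^{(r)}+1}:=+\infty$, $\bar\omega^{(r)}_i(x):=\sum_{j=1}^{J^{(r)}}\mathbf{1}\{c^{(r)}_j\le x\}q^{(r)}_{ij}$ and $\bar\kappa^{(r)}(x,u):=\sum_{i=1}^{J^{(r)}}\bar\omega^{(r)}_i(x)\mathbf{1}\{u\in(c^{(r)}_{i-1},c^{(r)}_i]\}$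 for $x,u\in\Omega$. Let $\zeta_{\bar\kappa}(x_1,x_2):=|\bar\kappa(x_2,1)-\bar\kappa(x_1,1)|$ and $v_{\bar\kappa}(x_1,x_2):=V_u(\bar\kappa(x_2,u)-\bar\kappa(x_1,u))$. Conditions. Uniformly Bounded Variation: $\sup_{x\in\Omega}V_u(\bar\kappa(x,u))<\infty$. C\`adl\`ag and Countable Jump Discontinuities: for every $\epsilon>0$ there are knots $0=s_1<\dots<s_{N_\epsilon}=1$ such that, with $E_i=[s_i,s_{i+1})$ for $i<N_\epsilon$ and $E_{N_\epsilon}=\{1\}$, one has $\zeta_{\bar\kappa}(x_1,x_2)<\epsilon$ and $v_{\bar\kappa}(x_1,x_2)<\epsilon$ for all $x_1,x_2\in E_i$ and all $i$. Unique Stationary Distribution: the stationary distribution $p$ of $\bar\kappa$ is unique and the set of solutions $f\in\bar{\mathbf{X}}$ of $f(x)=\int_\Omega\bar\kappa(x,u)\,df(u)$ ($x\in\Omega$) is $\{\alpha p\}_{\alpha\in\mathbb{R}}$. Proper Truncation: (i) there are $\epsilon^{(r)}\in\mathbb{R}_+$ with $\lim_{r\to\infty}\epsilon^{(r)}=0$ such that for all $r$, all $i=1,\dots,J^{(r)}$ and all $x_1,x_2\in[c^{(r)}_i,c^{(r)}_{i+1})\cap\Omega$, $\zeta_{\bar\kappa}(x_1,x_2)<\epsilon^{(r)}$ and $v_{\bar\kappa}(x_1,x_2)<\epsilon^{(r)}$; (ii) $\{c^{(r_1)}_i\}_{i}\subseteq\{c^{(r_2)}_i\}_{i}$ for all $r_1<r_2$;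 (iii) $q^{(r)}_{ij}=\bar\kappa(c^{(r)}_j,c^{(r)}_i)-\bar\kappa(c^{(r)}_{j-1},c^{(r)}_i)$ for all $i,j$ and $r$; (iv) $\lim_{r\to\infty}\bar\kappa^{(r)}(x,u)=\bar\kappa(x,u)$ for all $x,u\in\Omega$. *)

theory Defs
  imports "HOL-Probability.Probability"
begin

abbreviation Omega :: "real set" where
  "Omega \<equiv> {0..1}"

section \<open>Distribution functions on the unit interval and their span\<close>

definition dist_funs :: "(real \<Rightarrow> real) set" where
  "dist_funs = {cdf M | M. real_distribution M \<and> measure M Omega = 1}"

definition span_dist :: "(real \<Rightarrow> real) set" where
  "span_dist = {\<lambda>x. \<Sum>F\<in>T. a F * F x | T a. finite T \<and> T \<subseteq> dist_funs}"

definition closure_span_dist :: "(real \<Rightarrow> real) set" where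
  "closure_span_dist =
     {f. \<exists>fk. (\<forall>k. fk k \<in> span_dist) \<and> uniform_limit UNIV fk f sequentially}"

section \<open>Integration against signed measures and uniform limits\<close>

text \<open>The signed measure \<open>M - N\<close>, given by two finite Borel measures concentrated on
  \<^term>\<open>Omega\<close>, has distribution function \<open>f\<close>.\<close>

definition has_signed_df :: "real measure \<Rightarrow> real measure \<Rightarrow> (real \<Rightarrow> real) \<Rightarrow> bool" where
  "has_signed_df M N f \<longleftrightarrow>
     finite_borel_measure M \<and> measure M (- Omega) = 0 \<and>
     finite_borel_measure N \<and> measure N (- Omega) = 0 \<and>
     f = (\<lambda>x. cdf M x - cdf N x)"

definition signed_integral :: "(real \<Rightarrow> real) \<Rightarrow> (real \<Rightarrow> real) \<Rightarrow> real" where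
  "signed_integral g f =
     (THE I. \<forall>M N. has_signed_df M N f \<longrightarrow>
        I = (LINT u:Omega|M. g u) - (LINT u:Omega|N. g u))"

definition integral_df :: "(real \<Rightarrow> real) \<Rightarrow> (real \<Rightarrow> real) \<Rightarrow> real" where
  "integral_df g f =
     (if f \<in> span_dist then signed_integral g f
      else THE I. \<forall>fk. (\<forall>k. fk k \<in> span_dist) \<and> uniform_limit UNIV fk f sequentially
             \<longrightarrow> (\<lambda>k. signed_integral g (fk k)) \<longlonglongrightarrow> I)"

text \<open>The value of \<^const>\<open>signed_integral\<close> does not depend on the chosen measures.\<close>

lemma signed_df_measure_eq:
  assumes "has_signed_df M N f" "has_signed_df M' N' f" and A: "A \<in> sets borel"
  shows "measure M A + measure N' A = measure M' A + measure N A"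
proof -
  interpret M: finite_borel_measure M using assms by (simp add: has_signed_df_def)
  interpret N: finite_borel_measure N using assms by (simp add: has_signed_df_def)
  interpret M': finite_borel_measure M' using assms by (simp add: has_signed_df_def)
  interpret N': finite_borel_measure N' using assms by (simp add: has_signed_df_def)
  note bs = M.M_is_borel N.M_is_borel M'.M_is_borel N'.M_is_borel
  note sp = M.borel_UNIV N.borel_UNIV M'.borel_UNIV N'.borel_UNIV
  have cdf: "cdf M x + cdf N' x = cdf M' x + cdf N x" for x
    using assms(1,2) unfolding has_signed_df_def by (auto simp: fun_eq_iff algebra_simps)
  have top: "measure M UNIV + measure N' UNIV = measure M' UNIV + measure N UNIV"
  proof (rule tendsto_unique[OF trivial_limit_at_top_linorder])
    show "((\<lambda>x. cdf M x + cdf N' x) \<longlongrightarrow> measure M UNIV + measure N' UNIV) at_top"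
      using M.cdf_lim_at_top N'.cdf_lim_at_top by (auto simp: sp intro: tendsto_add)
    show "((\<lambda>x. cdf M x + cdf N' x) \<longlongrightarrow> measure M' UNIV + measure N UNIV) at_top"
      unfolding cdf using M'.cdf_lim_at_top N.cdf_lim_at_top by (auto simp: sp intro: tendsto_add)
  qed
  have gen: "sets (borel::real measure) = sigma_sets UNIV (range (\<lambda>a::real. {..a}))"
    by (subst borel_eq_atMost) (simp add: sets_measure_of image_subset_iff)
  have "Int_stable (range (\<lambda>a::real. {..a}))"
    by (auto simp: Int_stable_def)
  moreover have "range (\<lambda>a::real. {..a}) \<subseteq> Pow UNIV" by simp
  moreover have "A \<in> sigma_sets UNIV (range (\<lambda>a::real. {..a}))"
    using A gen by simp
  ultimately show ?thesis
  proof (induction rule: sigma_sets_induct_disjoint)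
    case (basic A)
    then show ?case using cdf by (auto simp: cdf_def)
  next
    case empty
    then show ?case by simp
  next
    case (compl A)
    then have "A \<in> sets borel" by (simp add: gen)
    then show ?case
      using compl.IH top M.finite_measure_compl[of A] N.finite_measure_compl[of A]
        M'.finite_measure_compl[of A] N'.finite_measure_compl[of A]
      by (simp add: bs sp)
  next
    case (union A)
    then have m: "range A \<subseteq> sets borel" by (simp add: gen)
    have "(\<lambda>i. measure M (A i) + measure N' (A i)) sums
        (measure M (\<Union>i. A i) + measure N' (\<Union>i. A i))"
      using M.finite_measure_UNION[of A] N'.finite_measure_UNION[of A] m union(1)
      by (auto simp: bs intro: sums_add)
    moreover have "(\<lambda>i. measure M' (A i) + measure N (A i)) sums
        (measure M' (\<Union>i. A i) + measure N (\<Union>i. A i))"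
      using M'.finite_measure_UNION[of A] N.finite_measure_UNION[of A] m union(1)
      by (auto simp: bs intro: sums_add)
    ultimately show ?case using union.IH by (simp add: sums_unique2)
  qed
qed

lemma signed_df_nn_integral_eq:
  fixes g :: "real \<Rightarrow> ennreal"
  assumes df: "has_signed_df M N f" "has_signed_df M' N' f" and g: "g \<in> borel_measurable borel"
  shows "(\<integral>\<^sup>+u. g u \<partial>M) + (\<integral>\<^sup>+u. g u \<partial>N') = (\<integral>\<^sup>+u. g u \<partial>M') + (\<integral>\<^sup>+u. g u \<partial>N)"
proof -
  interpret M: finite_borel_measure M using assms by (simp add: has_signed_df_def)
  interpret N: finite_borel_measure N using assms by (simp add: has_signed_df_def)
  interpret M': finite_borel_measure M' using assms by (simp add: has_signed_df_def)
  interpret N': finite_borel_measure N' using assms by (simp add: has_signed_df_def)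
  note bs [measurable_cong] = M.M_is_borel N.M_is_borel M'.M_is_borel N'.M_is_borel
  from g show ?thesis
  proof (induction rule: borel_measurable_induct)
    case (cong f g)
    then have "f = g" by auto
    then show ?case using cong by simp
  next
    case (set A)
    then show ?case using signed_df_measure_eq[OF df set]
      by (simp add: bs M.emeasure_eq_measure N.emeasure_eq_measure M'.emeasure_eq_measure
          N'.emeasure_eq_measure flip: ennreal_plus)
  next
    case (mult u c)
    note [measurable] = mult(1,2)
    show ?case using mult.IH
      by (simp add: nn_integral_cmult flip: distrib_left)
  next
    case (add u v)
    note [measurable] = add(1,2,3,4)
    have "(\<integral>\<^sup>+x. v x + u x \<partial>M) + (\<integral>\<^sup>+x. v x + u x \<partial>N')
      = ((\<integral>\<^sup>+x. v x \<partial>M) + (\<integral>\<^sup>+x. v x \<partial>N')) + ((\<integral>\<^sup>+x. u x \<partial>M) + (\<integral>\<^sup>+x. u x \<partial>N'))"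
      by (simp add: nn_integral_add ac_simps)
    also have "\<dots> = ((\<integral>\<^sup>+x. v x \<partial>M') + (\<integral>\<^sup>+x. v x \<partial>N)) + ((\<integral>\<^sup>+x. u x \<partial>M') + (\<integral>\<^sup>+x. u x \<partial>N))"
      by (simp only: add.IH)
    also have "\<dots> = (\<integral>\<^sup>+x. v x + u x \<partial>M') + (\<integral>\<^sup>+x. v x + u x \<partial>N)"
      by (simp add: nn_integral_add ac_simps)
    finally show ?case .
  next
    case (seq U)
    have [measurable]: "U i \<in> borel_measurable borel" for i using seq by simp
    have sup: "(\<integral>\<^sup>+x. (SUP i. U i) x \<partial>K) = (SUP i. \<integral>\<^sup>+x. U i x \<partial>K)"
      if [measurable_cong]: "sets K = sets borel" for K
      unfolding SUP_apply by (rule nn_integral_monotone_convergence_SUP[OF seq(3)]) simp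
    have inc: "incseq (\<lambda>i. \<integral>\<^sup>+x. U i x \<partial>K)" for K
      using seq(3) by (auto simp: incseq_def le_fun_def intro!: nn_integral_mono)
    show ?case
      unfolding bs[THEN sup] using seq.IH
      by (simp only: inc flip: ennreal_SUP_add)
  qed
qed

lemma signed_integral_eq:
  assumes df: "has_signed_df M N f"
    and g: "set_borel_measurable borel Omega g" and C: "\<And>u. u \<in> Omega \<Longrightarrow> \<bar>g u\<bar> \<le> C"
  shows "signed_integral g f = (LINT u:Omega|M. g u) - (LINT u:Omega|N. g u)"
proof -
  define h where "h u = indicator Omega u * g u" for u
  have hm: "h \<in> borel_measurable borel"
    using g unfolding set_borel_measurable_def h_def by simp
  have hb: "\<bar>h u\<bar> \<le> \<bar>C\<bar>" for u
    using C[of u] by (auto simp: h_def indicator_def)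
  have h_eq: "(LINT u:Omega|K. g u) = (LINT u|K. h u)" for K
    by (simp add: set_lebesgue_integral_def h_def)
  have int: "integrable K h" "integrable K (\<lambda>u. h u + \<bar>C\<bar>)"
    "(\<integral>\<^sup>+u. ennreal (h u + \<bar>C\<bar>) \<partial>K) = ennreal ((LINT u|K. h u) + \<bar>C\<bar> * measure K UNIV)"
    "0 \<le> (LINT u|K. h u) + \<bar>C\<bar> * measure K UNIV"
    if K: "finite_borel_measure K" for K
  proof -
    interpret K: finite_borel_measure K by (rule K)
    have m: "h \<in> borel_measurable K"
      using hm by (simp add: measurable_cong_sets[OF K.M_is_borel refl])
    show i: "integrable K h"
      by (rule K.integrable_const_bound[of _ "\<bar>C\<bar>"]) (auto simp: hb m)
    then show i': "integrable K (\<lambda>u. h u + \<bar>C\<bar>)" by simp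
    have nn: "0 \<le> h u + \<bar>C\<bar>" for u using hb[of u] by linarith
    have e: "(LINT u|K. h u + \<bar>C\<bar>) = (LINT u|K. h u) + \<bar>C\<bar> * measure K UNIV"
      using i by (simp add: K.borel_UNIV)
    show "(\<integral>\<^sup>+u. ennreal (h u + \<bar>C\<bar>) \<partial>K) = ennreal ((LINT u|K. h u) + \<bar>C\<bar> * measure K UNIV)"
      using nn_integral_eq_integral[OF i'] nn e by simp
    show "0 \<le> (LINT u|K. h u) + \<bar>C\<bar> * measure K UNIV"
      unfolding e[symmetric] using nn by (intro integral_nonneg_AE) auto
  qed
  have eq: "(LINT u|M. h u) - (LINT u|N. h u) = (LINT u|M'. h u) - (LINT u|N'. h u)"
    if df': "has_signed_df M' N' f" for M' N'
  proof -
    have fb: "finite_borel_measure M" "finite_borel_measure N"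
      "finite_borel_measure M'" "finite_borel_measure N'"
      using df df' by (auto simp: has_signed_df_def)
    have "(\<lambda>u. ennreal (h u + \<bar>C\<bar>)) \<in> borel_measurable borel"
      using hm by measurable
    from signed_df_nn_integral_eq[OF df df' this]
    have "(LINT u|M. h u) + \<bar>C\<bar> * measure M UNIV + ((LINT u|N'. h u) + \<bar>C\<bar> * measure N' UNIV)
      = (LINT u|M'. h u) + \<bar>C\<bar> * measure M' UNIV + ((LINT u|N. h u) + \<bar>C\<bar> * measure N UNIV)"
      using fb[THEN int(4)] by (simp add: fb[THEN int(3)] flip: ennreal_plus)
    moreover have "\<bar>C\<bar> * (measure M UNIV + measure N' UNIV)
      = \<bar>C\<bar> * (measure M' UNIV + measure N UNIV)"
      using signed_df_measure_eq[OF df df', of UNIV] by simp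
    ultimately show ?thesis by (simp add: distrib_left)
  qed
  show ?thesis
    unfolding signed_integral_def h_eq
  proof (rule the_equality)
    show "\<forall>M' N'. has_signed_df M' N' f \<longrightarrow>
        (LINT u|M. h u) - (LINT u|N. h u) = (LINT u|M'. h u) - (LINT u|N'. h u)"
      by (intro allI impI eq)
  qed (use df in blast)
qed

section \<open>Stationary distributions\<close>

text \<open>Throughout, a kernel \<open>\<kappa> x u\<close> is the probability of a transition from \<open>u\<close> into \<open>[0, x]\<close>.\<close>

definition solves_stationarity :: "(real \<Rightarrow> real \<Rightarrow> real) \<Rightarrow> (real \<Rightarrow> real) \<Rightarrow> bool" where
  "solves_stationarity \<kappa> f \<longleftrightarrow> (\<forall>x\<in>Omega. f x = integral_df (\<lambda>u. \<kappa> x u) f)"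

definition stationary_dist :: "(real \<Rightarrow> real \<Rightarrow> real) \<Rightarrow> (real \<Rightarrow> real) \<Rightarrow> bool" where
  "stationary_dist \<kappa> p \<longleftrightarrow> p \<in> dist_funs \<and> solves_stationarity \<kappa> p"

section \<open>Conditions on a kernel\<close>

definition total_variation :: "(real \<Rightarrow> real) \<Rightarrow> ereal" where
  "total_variation f =
     (SUP (n, p) \<in> {(n, p). mono_on {..n::nat} p \<and> p ` {..n} \<subseteq> Omega}.
        ereal (\<Sum>i<n. \<bar>f (p (Suc i)) - f (p i)\<bar>))"

definition zeta :: "(real \<Rightarrow> real \<Rightarrow> real) \<Rightarrow> real \<Rightarrow> real \<Rightarrow> real" where
  "zeta \<kappa> x1 x2 = \<bar>\<kappa> x2 1 - \<kappa> x1 1\<bar>"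

definition vdist :: "(real \<Rightarrow> real \<Rightarrow> real) \<Rightarrow> real \<Rightarrow> real \<Rightarrow> ereal" where
  "vdist \<kappa> x1 x2 = total_variation (\<lambda>u. \<kappa> x2 u - \<kappa> x1 u)"

definition uniformly_bounded_variation :: "(real \<Rightarrow> real \<Rightarrow> real) \<Rightarrow> bool" where
  "uniformly_bounded_variation \<kappa> \<longleftrightarrow> (SUP x\<in>Omega. total_variation (\<lambda>u. \<kappa> x u)) < \<infinity>"

definition cadlag_countable_jumps :: "(real \<Rightarrow> real \<Rightarrow> real) \<Rightarrow> bool" where
  "cadlag_countable_jumps \<kappa> \<longleftrightarrow>
     (\<forall>\<epsilon>>0. \<exists>(N::nat) s. 1 \<le> N \<and> s 1 = 0 \<and> s N = 1 \<and> strict_mono_on {1..N} s \<and>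
        (\<forall>i\<in>{1..N}. let E = (if i < N then {s i..<s (Suc i)} else {1}) in
           \<forall>x1\<in>E. \<forall>x2\<in>E. zeta \<kappa> x1 x2 < \<epsilon> \<and> vdist \<kappa> x1 x2 < ereal \<epsilon>))"

definition unique_stationary_distribution :: "(real \<Rightarrow> real \<Rightarrow> real) \<Rightarrow> bool" where
  "unique_stationary_distribution \<kappa> \<longleftrightarrow>
     (\<exists>p. {p'. stationary_dist \<kappa> p'} = {p} \<and>
        {f \<in> closure_span_dist. solves_stationarity \<kappa> f} = {\<lambda>x. \<alpha> * p x | \<alpha>. True})"

section \<open>Finite-state truncations\<close>

text \<open>States and transition matrices are indexed by \<open>1, \<dots>, J\<close>; \<open>knot\<close> adds the conventions
  \<open>c\<^sub>0 = -\<infinity>\<close> and \<open>c\<^bsub>J+1\<^esub> = +\<infinity>\<close>, and \<open>kernel_ext\<close> the convention \<open>\<kappa>(-\<infinity>, \<cdot>) = 0\<close>.\<close>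

definition knot :: "nat \<Rightarrow> (nat \<Rightarrow> real) \<Rightarrow> nat \<Rightarrow> ereal" where
  "knot J c i = (if i = 0 then -\<infinity> else if i \<le> J then ereal (c i) else \<infinity>)"

definition kernel_ext :: "(real \<Rightarrow> real \<Rightarrow> real) \<Rightarrow> ereal \<Rightarrow> real \<Rightarrow> real" where
  "kernel_ext \<kappa> x u = (if x = -\<infinity> then 0 else \<kappa> (real_of_ereal x) u)"

definition finite_markov_chain :: "nat \<Rightarrow> (nat \<Rightarrow> real) \<Rightarrow> (nat \<Rightarrow> nat \<Rightarrow> real) \<Rightarrow> bool" where
  "finite_markov_chain J c q \<longleftrightarrow>
     strict_mono_on {1..J} c \<and> c ` {1..J} \<subseteq> Omega \<and>
     (\<forall>i\<in>{1..J}. (\<forall>j\<in>{1..J}. 0 \<le> q i j) \<and> (\<Sum>j=1..J. q i j) = 1)"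

definition trunc_row ::
  "nat \<Rightarrow> (nat \<Rightarrow> real) \<Rightarrow> (nat \<Rightarrow> nat \<Rightarrow> real) \<Rightarrow> nat \<Rightarrow> real \<Rightarrow> real" where
  "trunc_row J c q i x = (\<Sum>j=1..J. of_bool (c j \<le> x) * q i j)"

definition trunc_kernel ::
  "nat \<Rightarrow> (nat \<Rightarrow> real) \<Rightarrow> (nat \<Rightarrow> nat \<Rightarrow> real) \<Rightarrow> real \<Rightarrow> real \<Rightarrow> real" where
  "trunc_kernel J c q x u =
     (\<Sum>i=1..J. trunc_row J c q i x * of_bool (knot J c (i - 1) < ereal u \<and> ereal u \<le> knot J c i))"

definition proper_truncation ::
  "(real \<Rightarrow> real \<Rightarrow> real) \<Rightarrow> (nat \<Rightarrow> nat) \<Rightarrow> (nat \<Rightarrow> nat \<Rightarrow> real) \<Rightarrow>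
   (nat \<Rightarrow> nat \<Rightarrow> nat \<Rightarrow> real) \<Rightarrow> bool" where
  "proper_truncation \<kappa> J c q \<longleftrightarrow>
     (\<exists>\<epsilon>. (\<forall>r. 0 \<le> \<epsilon> r) \<and> \<epsilon> \<longlonglongrightarrow> 0 \<and>
        (\<forall>r. \<forall>i\<in>{1..J r}.
           let E = {x \<in> Omega. knot (J r) (c r) i \<le> ereal x \<and> ereal x < knot (J r) (c r) (Suc i)} in
           \<forall>x1\<in>E. \<forall>x2\<in>E. zeta \<kappa> x1 x2 < \<epsilon> r \<and> vdist \<kappa> x1 x2 < ereal (\<epsilon> r))) \<and>
     (\<forall>r1 r2. r1 < r2 \<longrightarrow> c r1 ` {1..J r1} \<subseteq> c r2 ` {1..J r2}) \<and>
     (\<forall>r. \<forall>i\<in>{1..J r}. \<forall>j\<in>{1..J r}.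
        q r i j = kernel_ext \<kappa> (knot (J r) (c r) j) (c r i)
                  - kernel_ext \<kappa> (knot (J r) (c r) (j - 1)) (c r i)) \<and>
     (\<forall>x\<in>Omega. \<forall>u\<in>Omega. (\<lambda>r. trunc_kernel (J r) (c r) (q r) x u) \<longlonglongrightarrow> \<kappa> x u)"

definition dyadic_size :: "nat \<Rightarrow> nat" where
  "dyadic_size r = 2 ^ r + 1"

definition dyadic_state :: "nat \<Rightarrow> nat \<Rightarrow> real" where
  "dyadic_state r i = (real i - 1) / 2 ^ r"

definition dyadic_matrix :: "(real \<Rightarrow> real \<Rightarrow> real) \<Rightarrow> nat \<Rightarrow> nat \<Rightarrow> nat \<Rightarrow> real" where
  "dyadic_matrix \<kappa> r i j =
     kernel_ext \<kappa> (knot (dyadic_size r) (dyadic_state r) j) (dyadic_state r i)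
     - kernel_ext \<kappa> (knot (dyadic_size r) (dyadic_state r) (j - 1)) (dyadic_state r i)"

section \<open>The G/G/1+G queue\<close>

text \<open>One step of the virtual waiting time: from waiting time \<open>w\<close>, with service time \<open>s\<close> and
  patience time \<open>y\<close> of the arriving customer and \<open>t\<close> the time to the next arrival.\<close>

definition wait_step :: "real \<Rightarrow> real \<Rightarrow> real \<Rightarrow> real \<Rightarrow> real" where
  "wait_step w s t y = (if y > w then max (w + s - t) 0 else max (w - t) 0)"

definition left_tail :: "(real \<Rightarrow> real) \<Rightarrow> real \<Rightarrow> real" where
  "left_tail A x = 1 - Lim (at_left x) A"

definition queue_kernel ::
  "(real \<Rightarrow> real) \<Rightarrow> (real \<Rightarrow> real) \<Rightarrow> (real \<Rightarrow> real) \<Rightarrow> real \<Rightarrow> real \<Rightarrow> real" where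
  "queue_kernel G D A x u = (1 - G u) * D (x - u) + G u * left_tail A (u - x)"

end

theory Submission
  imports Defs
begin

text \<open>Write \<open>P g u\<close> for the expectation of \<open>g\<close> at the next waiting time from \<open>u\<close>. By negative
  drift the chain reaches \<open>0\<close> from everywhere within a fixed number of steps with probability
  bounded below, so the oscillation of \<open>P\<^sup>n g\<close> decays geometrically. Pairing
  \<open>P\<^sup>n (indicator {..x})\<close> with a signed stationary measure \<open>f\<close> gives \<open>f x = f 1 * p x\<close>,
  where \<open>p x\<close> is the limiting constant; that \<open>p\<close> is a uniform limit of the laws started at \<open>0\<close>.

  A solution in the closure of the span is again a signed measure: the kernel is Lipschitz in \<open>x\<close>
  for the variation norm in \<open>u\<close>, and the integral of \<open>g\<close> against \<open>f\<close> is at most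
  \<open>sup \<bar>f\<bar>\<close> times \<open>\<bar>g 1\<bar>\<close> plus the variation of \<open>g\<close>, so solutions are Lipschitz on the unit interval.

  For the variation in \<open>u\<close>, the bound on \<open>A''\<close> makes \<open>A z - A (z - d)\<close> an increasing
  function up to a linear term with slope proportional to \<open>d\<close>, in spite of the jump of \<open>A'\<close>
  at \<open>0\<close>, and this property is preserved when averaging over the service time.\<close>

section \<open>Distribution functions of finite measures on the unit interval\<close>

text \<open>A solution in the closure has its integral only as a limit, controlled here for
  continuous integrands of bounded variation, while the contraction argument needs indicators and
  their iterates, which are merely bounded and measurable. Hence regularity of solutions comes
  first, and uniqueness is argued for signed measures.

  \<open>ybar + sbar \<le> 1\<close> enters twice: it keeps waiting times in the unit interval, and
  it keeps the arguments of \<open>A\<close> in the formula for \<open>D\<close> at most 1, where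
  the derivative bounds hold. \<open>D\<close> is not assumed differentiable; its regularity is that
  of \<open>A\<close> after averaging.\<close>

definition increasing_df :: "(real \<Rightarrow> real) \<Rightarrow> bool" where
  "increasing_df U \<longleftrightarrow>
     mono U \<and> (\<forall>x. continuous (at_right x) U) \<and> (\<forall>x<0. U x = 0) \<and> (\<forall>x\<ge>1. U x = U 1)"

lemma increasing_dfD:
  assumes "increasing_df U"
  shows "x \<le> y \<Longrightarrow> U x \<le> U y" "continuous (at_right x) U" "x < 0 \<Longrightarrow> U x = 0" "1 \<le> x \<Longrightarrow> U x = U 1"
  using assms unfolding increasing_df_def mono_def by blast+

lemma increasing_df_nonneg: "increasing_df U \<Longrightarrow> 0 \<le> U x"
  using increasing_dfD(1)[of U "min x (-1)" x] increasing_dfD(3)[of U "min x (-1)"] by simp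

lemma increasing_df_le_top: "increasing_df U \<Longrightarrow> U x \<le> U 1"
  using increasing_dfD(1)[of U x 1] increasing_dfD(4)[of U x] by (cases "x \<le> 1") auto

lemma increasing_df_cdf:
  assumes "finite_borel_measure K" "measure K (- Omega) = 0"
  shows "increasing_df (cdf K)"
proof -
  interpret K: finite_borel_measure K by fact
  have sets: "A \<in> sets K" if "A \<in> sets borel" for A using that K.M_is_borel by simp
  have z: "cdf K x = 0" if "x < 0" for x
  proof -
    have "measure K {..x} \<le> measure K (- Omega)"
      using that by (intro K.finite_measure_mono sets) auto
    then show ?thesis using assms(2) measure_nonneg[of K "{..x}"] by (simp add: cdf_def)
  qed
  have o: "cdf K x = cdf K 1" if "1 \<le> x" for x
  proof -
    have "measure K {..x} = measure K ({..1} \<union> {1<..x})"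
      using that by (intro arg_cong[where f="measure K"]) auto
    also have "\<dots> = measure K {..1} + measure K {1<..x}"
      by (intro K.finite_measure_Union sets) auto
    also have "measure K {1<..x} \<le> measure K (- Omega)"
      by (intro K.finite_measure_mono sets) auto
    finally show ?thesis
      using assms(2) that K.cdf_nondecreasing[of 1 x] by (simp add: cdf_def)
  qed
  show ?thesis
    unfolding increasing_df_def mono_def
    using K.cdf_nondecreasing K.cdf_is_right_cont z o by blast
qed

text \<open>The Lebesgue-Stieltjes measure of \<open>U\<close> works: its mass on the negative axis
  is the left limit of \<open>U\<close> at 0, hence 0, and its total mass \<open>U 1\<close> is
  already carried by \<open>{..1}\<close>.\<close>

lemma increasing_df_imp_measure:
  assumes "increasing_df U"
  obtains K where "finite_borel_measure K" "measure K (- Omega) = 0" "cdf K = U"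
proof -
  have m: "\<And>x y. x \<le> y \<Longrightarrow> U x \<le> U y" and r: "\<And>a. continuous (at_right a) U"
    and z: "\<And>x. x < 0 \<Longrightarrow> U x = 0" and o: "\<And>x. 1 \<le> x \<Longrightarrow> U x = U 1"
    by (fact increasing_dfD[OF assms])+
  have bot: "(U \<longlongrightarrow> 0) at_bot"
    by (rule tendsto_eventually) (auto simp: eventually_at_bot_dense intro!: exI[of _ 0] z)
  have top: "(U \<longlongrightarrow> U 1) at_top"
    by (rule tendsto_eventually, rule eventually_mono[OF eventually_ge_at_top[of 1]]) (rule o)
  let ?K = "interval_measure U"
  have fb: "finite_borel_measure ?K"
    using finite_borel_measure_interval_measure[OF m r bot top] increasing_df_nonneg[OF assms] by auto
  interpret K: finite_borel_measure ?K by fact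
  have cdf: "cdf ?K = U" by (rule cdf_interval_measure[OF m r bot])
  have sets: "A \<in> sets ?K" if "A \<in> sets borel" for A using that by simp
  have "measure ?K UNIV = U 1"
    using interval_measure_UNIV[OF m r bot top] increasing_df_nonneg[OF assms, of 1]
    by (simp add: measure_def)
  moreover have "measure ?K {..<0} = 0"
  proof -
    have "(cdf ?K \<longlongrightarrow> measure ?K {..<0}) (at_left 0)" by (rule K.cdf_at_left)
    moreover have "(cdf ?K \<longlongrightarrow> 0) (at_left 0)"
      unfolding cdf by (rule tendsto_eventually) (auto simp: eventually_at_left_field intro!: exI[of _ "-1"] z)
    ultimately show ?thesis by (meson tendsto_unique trivial_limit_at_left_real)
  qed
  moreover have "measure ?K {..1} = U 1" using cdf unfolding cdf_def by metis
  moreover have "measure ?K {..1} = measure ?K ({..<0} \<union> Omega)"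
    by (intro arg_cong[where f="measure ?K"]) auto
  moreover have "measure ?K ({..<0} \<union> Omega) = measure ?K {..<0} + measure ?K Omega"
    by (intro K.finite_measure_Union sets) auto
  moreover have "measure ?K (- Omega) = measure ?K UNIV - measure ?K Omega"
    using K.finite_measure_compl[of Omega] by (simp add: Compl_eq_Diff_UNIV)
  ultimately have "measure ?K (- Omega) = 0" by simp
  then show ?thesis by (rule that[OF fb _ cdf])
qed

text \<open>Trades the measure for conditions on the function alone, which are easier to carry
  through limits. The total mass is read off at 1 because the function is constant from there
  on.\<close>

lemma dist_funs_iff: "F \<in> dist_funs \<longleftrightarrow> increasing_df F \<and> F 1 = 1"
proof
  assume "F \<in> dist_funs"
  then obtain K where F: "F = cdf K" and K: "real_distribution K" "measure K Omega = 1"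
    by (auto simp: dist_funs_def)
  interpret K: real_distribution K by fact
  have "measure K (- Omega) = 0"
    using K.finite_measure_compl[of Omega] K K.prob_space by (simp add: Compl_eq_Diff_UNIV)
  then have i: "increasing_df (cdf K)"
    by (rule increasing_df_cdf[OF K.finite_borel_measure_M])
  have "measure K Omega \<le> cdf K 1"
    unfolding cdf_def by (intro K.finite_measure_mono) auto
  then show "increasing_df F \<and> F 1 = 1"
    using i K.cdf_bounded_prob[of 1] F K(2) by auto
next
  assume "increasing_df F \<and> F 1 = 1"
  then obtain K where K: "finite_borel_measure K" "measure K (- Omega) = 0" "cdf K = F"
    and i: "increasing_df F" "F 1 = 1"
    using increasing_df_imp_measure by blast
  interpret K: finite_borel_measure K by fact
  have "(cdf K \<longlongrightarrow> F 1) at_top"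
    unfolding K(3)
    by (rule tendsto_eventually, rule eventually_mono[OF eventually_ge_at_top[of 1]])
      (rule increasing_dfD(4)[OF i(1)])
  then have "measure K (space K) = 1"
    unfolding i(2) using K.cdf_lim_at_top tendsto_unique trivial_limit_at_top_linorder by blast
  then have "prob_space K"
    by (intro prob_spaceI) (simp add: K.emeasure_eq_measure)
  then interpret K': prob_space K .
  have "real_distribution K" by standard (auto simp: K.M_is_borel)
  moreover have "measure K Omega = 1"
    using K.finite_measure_compl[of Omega] K(2) K'.prob_space
    by (simp add: Compl_eq_Diff_UNIV K.M_is_borel K.borel_UNIV)
  ultimately show "F \<in> dist_funs" using K(3) by (auto simp: dist_funs_def)
qed

lemma increasing_df_sum:
  assumes "finite T" and F: "\<And>i. i \<in> T \<Longrightarrow> increasing_df (F i)" and c: "\<And>i. i \<in> T \<Longrightarrow> 0 \<le> c i"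
  shows "increasing_df (\<lambda>x. \<Sum>i\<in>T. c i * F i x)"
proof -
  have m: "F i x \<le> F i y" if "i \<in> T" "x \<le> y" for i x y
    by (rule increasing_dfD(1)[OF F]) (use that in auto)
  have r: "continuous (at_right x) (F i)" if "i \<in> T" for i x
    by (rule increasing_dfD(2)[OF F]) (use that in auto)
  have z: "F i x = 0" if "i \<in> T" "x < 0" for i x
    by (rule increasing_dfD(3)[OF F]) (use that in auto)
  have o: "F i x = F i 1" if "i \<in> T" "1 \<le> x" for i x
    by (rule increasing_dfD(4)[OF F]) (use that in auto)
  show ?thesis unfolding increasing_df_def
  proof (intro conjI allI impI)
    show "mono (\<lambda>x. \<Sum>i\<in>T. c i * F i x)"
      by (intro monoI sum_mono mult_left_mono m c)
    show "continuous (at_right x) (\<lambda>x. \<Sum>i\<in>T. c i * F i x)" for x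
      by (intro continuous_sum continuous_mult continuous_const r)
    show "(\<Sum>i\<in>T. c i * F i x) = 0" if "x < 0" for x
      using z that by (intro sum.neutral) auto
    show "(\<Sum>i\<in>T. c i * F i x) = (\<Sum>i\<in>T. c i * F i 1)" if "1 \<le> x" for x
      by (rule sum.cong) (use o[OF _ that] in auto)
  qed
qed

lemma has_signed_df_increasing_diff:
  assumes "increasing_df U" "increasing_df V"
  obtains K L where "has_signed_df K L (\<lambda>x. U x - V x)"
proof -
  obtain K where K: "finite_borel_measure K" "measure K (- Omega) = 0" "cdf K = U"
    by (rule increasing_df_imp_measure[OF assms(1)])
  obtain L where L: "finite_borel_measure L" "measure L (- Omega) = 0" "cdf L = V"
    by (rule increasing_df_imp_measure[OF assms(2)])
  show ?thesis
    by (rule that[of K L]) (simp add: has_signed_df_def K L)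
qed

section \<open>The span of the distribution functions\<close>

lemma span_dist_cmult:
  assumes "f \<in> span_dist" shows "(\<lambda>x. c * f x) \<in> span_dist"
proof -
  obtain T a where "finite T" "T \<subseteq> dist_funs" "f = (\<lambda>x. \<Sum>F\<in>T. a F * F x)"
    using assms by (auto simp: span_dist_def)
  then show ?thesis unfolding span_dist_def
    by (auto simp: sum_distrib_left mult.assoc intro!: exI[of _ T] exI[of _ "\<lambda>F. c * a F"])
qed

lemma span_dist_add:
  assumes "f \<in> span_dist" "g \<in> span_dist" shows "(\<lambda>x. f x + g x) \<in> span_dist"
proof -
  obtain T a where T: "finite T" "T \<subseteq> dist_funs" "f = (\<lambda>x. \<Sum>F\<in>T. a F * F x)"
    using assms by (auto simp: span_dist_def)
  obtain S b where S: "finite S" "S \<subseteq> dist_funs" "g = (\<lambda>x. \<Sum>F\<in>S. b F * F x)"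
    using assms by (auto simp: span_dist_def)
  \<comment> \<open>\<open>T\<close> and \<open>S\<close> are sets of functions and may overlap, so
    coefficients are extended by 0 to the union before adding.\<close>
  let ?c = "\<lambda>F. (if F \<in> T then a F else 0) + (if F \<in> S then b F else 0)"
  have "f x = (\<Sum>F\<in>T \<union> S. (if F \<in> T then a F else 0) * F x)" for x
    unfolding T(3) using T(1) S(1) by (intro sum.mono_neutral_cong_left) auto
  moreover have "g x = (\<Sum>F\<in>T \<union> S. (if F \<in> S then b F else 0) * F x)" for x
    unfolding S(3) using T(1) S(1) by (intro sum.mono_neutral_cong_left) auto
  ultimately have "(\<lambda>x. f x + g x) = (\<lambda>x. \<Sum>F\<in>T \<union> S. ?c F * F x)"
    by (simp add: sum.distrib[symmetric] distrib_right)
  moreover have "finite (T \<union> S)" "T \<union> S \<subseteq> dist_funs" using T S by auto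
  ultimately show ?thesis unfolding span_dist_def mem_Collect_eq by (intro exI conjI)
qed

lemma span_dist_diff:
  assumes "f \<in> span_dist" "g \<in> span_dist" shows "(\<lambda>x. f x - g x) \<in> span_dist"
  using span_dist_add[OF assms(1) span_dist_cmult[OF assms(2), of "-1"]] by simp

lemma dist_funs_subset_span_dist: "dist_funs \<subseteq> span_dist"
proof
  fix F assume "F \<in> dist_funs"
  then show "F \<in> span_dist" unfolding span_dist_def
    by (auto intro!: exI[of _ "{F}"] exI[of _ "\<lambda>_. 1"])
qed

lemma increasing_df_imp_span_dist:
  assumes "increasing_df U" shows "U \<in> span_dist"
proof (cases "U 1 = 0")
  case True
  then have "U = (\<lambda>x. 0)"
    using increasing_df_nonneg[OF assms] increasing_df_le_top[OF assms] by (auto intro: antisym)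
  then show ?thesis unfolding span_dist_def by (auto intro!: exI[of _ "{}"])
next
  case False
  have "increasing_df (\<lambda>x. \<Sum>i\<in>{()}. inverse (U 1) * U x)"
    using increasing_df_nonneg[OF assms] by (intro increasing_df_sum) (auto simp: assms)
  with False have "(\<lambda>x. inverse (U 1) * U x) \<in> dist_funs" by (simp add: dist_funs_iff)
  then have "(\<lambda>x. inverse (U 1) * U x) \<in> span_dist"
    by (rule subsetD[OF dist_funs_subset_span_dist])
  from span_dist_cmult[OF this, of "U 1"] False show ?thesis by (simp add: mult.assoc[symmetric])
qed

lemma span_dist_has_signed_df:
  assumes "f \<in> span_dist"
  obtains K L where "has_signed_df K L f"
proof -
  obtain T a where T: "finite T" "T \<subseteq> dist_funs" "f = (\<lambda>x. \<Sum>F\<in>T. a F * F x)"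
    using assms by (auto simp: span_dist_def)
  have i: "increasing_df (\<lambda>x. \<Sum>F\<in>T. max (a F) 0 * F x)" "increasing_df (\<lambda>x. \<Sum>F\<in>T. max (- a F) 0 * F x)"
    using T(2) dist_funs_iff by (intro increasing_df_sum[OF T(1)]; auto)+
  have "a F * F x = max (a F) 0 * F x - max (- a F) 0 * F x" for F x
    by (simp add: max_def)
  then have "f = (\<lambda>x. (\<Sum>F\<in>T. max (a F) 0 * F x) - (\<Sum>F\<in>T. max (- a F) 0 * F x))"
    unfolding T(3) by (simp add: sum_subtractf)
  then show ?thesis using has_signed_df_increasing_diff[OF i] that by metis
qed

lemma has_signed_df_increasing:
  assumes "has_signed_df K L f"
  shows "increasing_df (cdf K)" "increasing_df (cdf L)" "f x = cdf K x - cdf L x"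
  using assms unfolding has_signed_df_def by (simp_all add: increasing_df_cdf)

lemma has_signed_df_vanishes:
  assumes "has_signed_df K L f" "x < 0" shows "f x = 0"
  using has_signed_df_increasing[OF assms(1)] assms(2) by (simp add: increasing_dfD(3))

lemma has_signed_df_const:
  assumes "has_signed_df K L f" "1 \<le> x" shows "f x = f 1"
proof -
  have "cdf K x = cdf K 1" "cdf L x = cdf L 1"
    using has_signed_df_increasing(1,2)[OF assms(1)] assms(2) by (simp_all add: increasing_dfD(4)[of _ x])
  then show ?thesis using has_signed_df_increasing(3)[OF assms(1)] by simp
qed

lemma has_signed_df_bounded:
  assumes "has_signed_df K L f" shows "\<bar>f x\<bar> \<le> cdf K 1 + cdf L 1"
  using has_signed_df_increasing(3)[OF assms, of x]
    increasing_df_nonneg[OF has_signed_df_increasing(1)[OF assms], of x]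
    increasing_df_nonneg[OF has_signed_df_increasing(2)[OF assms], of x]
    increasing_df_le_top[OF has_signed_df_increasing(1)[OF assms], of x]
    increasing_df_le_top[OF has_signed_df_increasing(2)[OF assms], of x]
  by linarith

text \<open>Uniform limits keep the behaviour outside \<open>Omega\<close> and boundedness, but not
  bounded variation. The regularity argument starts from these facts.\<close>

lemma closure_span_distD:
  assumes "f \<in> closure_span_dist"
  shows "x < 0 \<Longrightarrow> f x = 0" "1 \<le> x \<Longrightarrow> f x = f 1" "\<exists>C. \<forall>x. \<bar>f x\<bar> \<le> C"
proof -
  obtain fk where fk: "\<And>k. fk k \<in> span_dist" "uniform_limit UNIV fk f sequentially"
    using assms by (auto simp: closure_span_dist_def)
  have sd: "\<exists>K L. has_signed_df K L (fk k)" for k using span_dist_has_signed_df fk(1) by metis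
  have lim: "(\<lambda>k. fk k x) \<longlonglongrightarrow> f x" for x using tendsto_uniform_limitI[OF fk(2)] by simp
  show "f x = 0" if "x < 0"
  proof -
    have "fk k x = 0" for k using sd has_signed_df_vanishes that by metis
    then show ?thesis using lim[of x] by (simp add: LIMSEQ_const_iff)
  qed
  show "f x = f 1" if "1 \<le> x"
  proof -
    have "fk k x = fk k 1" for k using sd has_signed_df_const that by metis
    then show ?thesis using lim[of x] lim[of 1] by (simp add: LIMSEQ_unique)
  qed
  have "\<forall>\<^sub>F k in sequentially. \<forall>x. dist (fk k x) (f x) < 1"
    using uniform_limitD[OF fk(2), of 1] by simp
  then obtain k where k: "\<And>x. dist (fk k x) (f x) < 1" by (auto simp: eventually_sequentially)
  obtain C where C: "\<And>x. \<bar>fk k x\<bar> \<le> C" using sd[of k] has_signed_df_bounded by metis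
  have "\<bar>f x\<bar> \<le> C + 1" for x using k[of x] C[of x] by (simp add: dist_real_def)
  then show "\<exists>C. \<forall>x. \<bar>f x\<bar> \<le> C" by blast
qed

text \<open>\<open>h\<close> is the distribution function of the unit mass at 0 and \<open>m\<close>
  that of the uniform law. Adding \<open>\<bar>f 0\<bar> * h\<close> absorbs the only possible jump,
  at 0, and adding \<open>L * m\<close> absorbs every decrease on the unit interval, so
  \<open>f\<close> is a difference of increasing functions.\<close>

lemma lipschitz_imp_span_dist:
  assumes z: "\<And>x. x < 0 \<Longrightarrow> f x = 0" and o: "\<And>x. 1 \<le> x \<Longrightarrow> f x = f 1"
    and L: "\<And>x y. x \<in> Omega \<Longrightarrow> y \<in> Omega \<Longrightarrow> \<bar>f x - f y\<bar> \<le> L * \<bar>x - y\<bar>"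
  shows "f \<in> span_dist"
proof -
  have L0: "0 \<le> L" using L[of 0 1] by auto
  define h :: "real \<Rightarrow> real" where "h x = indicator {0..} x" for x
  define m :: "real \<Rightarrow> real" where "m x = min (max x 0) 1" for x
  have rch: "continuous (at_right a) h" for a
  proof (cases "0 \<le> a")
    case True
    have "\<forall>\<^sub>F x in at_right a. h x = h a"
      using True by (auto simp: eventually_at_right_field h_def intro!: exI[of _ "a+1"])
    then show ?thesis unfolding continuous_within by (rule tendsto_eventually)
  next
    case False
    have "\<forall>\<^sub>F x in at_right a. h x = h a"
      using False by (auto simp: eventually_at_right_field h_def intro!: exI[of _ 0])
    then show ?thesis unfolding continuous_within by (rule tendsto_eventually)
  qed
  \<comment> \<open>Clamping the argument gives a function Lipschitz on the whole line, and
    \<open>h\<close> restores the zero on the negative axis; right continuity of \<open>f\<close> is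
    read off from these factors.\<close>
  have feq: "f x = h x * f (m x)" for x
    using z[of x] o[of x] by (cases "1 \<le> x") (auto simp: h_def m_def indicator_def)
  have lip: "\<bar>f (m x) - f (m y)\<bar> \<le> L * \<bar>m x - m y\<bar>" for x y
    by (rule L) (auto simp: m_def)
  have "(L)-lipschitz_on UNIV (\<lambda>x. f (m x))"
  proof (rule lipschitz_onI)
    fix x y :: real
    have "L * \<bar>m x - m y\<bar> \<le> L * \<bar>x - y\<bar>" using L0 by (intro mult_left_mono) (auto simp: m_def)
    then show "dist (f (m x)) (f (m y)) \<le> L * dist x y" using lip[of x y] by (simp add: dist_real_def)
  qed (fact L0)
  then have "continuous_on UNIV (\<lambda>x. f (m x))" by (rule lipschitz_on_continuous_on)
  then have cfm: "continuous (at_right a) (\<lambda>x. f (m x))" for a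
    by (simp add: continuous_at_imp_continuous_at_within continuous_on_eq_continuous_at)
  have rcm: "continuous (at_right a) m" for a
    unfolding m_def by (intro continuous_intros)
  have "continuous (at_right a) (\<lambda>x. h x * f (m x))" for a
    by (intro continuous_intros rch cfm)
  then have rcf: "continuous (at_right a) f" for a
    by (simp only: feq[symmetric])
  have monom: "x \<le> y \<Longrightarrow> m x \<le> m y" for x y by (auto simp: m_def)
  have monoh: "x \<le> y \<Longrightarrow> h x \<le> h y" for x y by (auto simp: h_def indicator_def)
  have ih: "increasing_df h" unfolding increasing_df_def mono_def
    using rch monoh by (simp add: h_def)
  have im: "increasing_df m" unfolding increasing_df_def mono_def
    using rcm monom by (simp add: m_def)
  have "f x + \<bar>f 0\<bar> * h x + L * m x \<le> f y + \<bar>f 0\<bar> * h y + L * m y" if xy: "x \<le> y" for x y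
  proof (cases "x < 0 \<and> 0 \<le> y")
    case True
    have "\<bar>f (m y) - f 0\<bar> \<le> L * m y" using lip[of y 0] True by (simp add: m_def)
    then show ?thesis using True feq[of y] z[of x] by (auto simp: h_def m_def)
  next
    case False
    then have "h x = h y" using xy by (auto simp: h_def)
    moreover have "\<bar>f (m x) - f (m y)\<bar> \<le> L * (m y - m x)" using lip[of x y] monom[OF xy] by simp
    moreover have "h x = 0 \<and> m x = 0 \<and> m y = 0 \<or> h x = 1"
      using False xy by (auto simp: h_def m_def indicator_def)
    ultimately show ?thesis unfolding feq[of x] feq[of y] by (auto simp: algebra_simps)
  qed
  moreover have "f x + \<bar>f 0\<bar> * h x + L * m x = f 1 + \<bar>f 0\<bar> * h 1 + L * m 1" if "1 \<le> x" for x
    using that o[OF that] by (simp add: h_def m_def)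
  moreover have "continuous (at_right x) (\<lambda>x. f x + \<bar>f 0\<bar> * h x + L * m x)" for x
    by (intro continuous_intros rcf rch rcm)
  moreover have "f x + \<bar>f 0\<bar> * h x + L * m x = 0" if "x < 0" for x
    using that z by (simp add: h_def m_def)
  ultimately have "increasing_df (\<lambda>x. f x + \<bar>f 0\<bar> * h x + L * m x)"
    unfolding increasing_df_def mono_def by blast
  then have "(\<lambda>x. (f x + \<bar>f 0\<bar> * h x + L * m x) - \<bar>f 0\<bar> * h x - L * m x) \<in> span_dist"
    by (intro span_dist_diff span_dist_cmult increasing_df_imp_span_dist ih im)
  then show ?thesis by simp
qed

section \<open>Total variation\<close>

lemma total_variation_leI:
  assumes "\<And>n p. mono_on {..n} p \<Longrightarrow> (\<And>i. i \<le> n \<Longrightarrow> p i \<in> Omega) \<Longrightarrow>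
    (\<Sum>i<n. \<bar>f (p (Suc i)) - f (p i)\<bar>) \<le> C"
  shows "total_variation f \<le> ereal C"
  unfolding total_variation_def by (rule SUP_least) (use assms in \<open>auto simp: image_subset_iff\<close>)

lemma total_variation_leD:
  assumes "total_variation f \<le> ereal C" "mono_on {..n} p" "\<And>i. i \<le> n \<Longrightarrow> p i \<in> Omega"
  shows "(\<Sum>i<n. \<bar>f (p (Suc i)) - f (p i)\<bar>) \<le> C"
proof -
  have "ereal (\<Sum>i<n. \<bar>f (p (Suc i)) - f (p i)\<bar>) \<le> total_variation f"
    unfolding total_variation_def
    by (rule SUP_upper2[of "(n, p)"]) (use assms in auto)
  also note assms(1)
  finally show ?thesis by simp
qed

lemma total_variation_cong:
  assumes "\<And>u. u \<in> Omega \<Longrightarrow> f u = g u"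
  shows "total_variation f = total_variation g"
  unfolding total_variation_def
proof (rule SUP_cong[OF refl])
  fix x :: "nat \<times> (nat \<Rightarrow> real)" assume "x \<in> {(n, p). mono_on {..n} p \<and> p ` {..n} \<subseteq> Omega}"
  then obtain n p where x: "x = (n, p)" "p ` {..n} \<subseteq> Omega" by blast
  then have "f (p i) = g (p i)" if "i \<le> n" for i using that assms by auto
  then show "(case x of (n, p) \<Rightarrow> ereal (\<Sum>i<n. \<bar>f (p (Suc i)) - f (p i)\<bar>))
    = (case x of (n, p) \<Rightarrow> ereal (\<Sum>i<n. \<bar>g (p (Suc i)) - g (p i)\<bar>))"
    by (simp add: x(1))
qed

lemma total_variation_add:
  assumes "total_variation f \<le> ereal C" "total_variation g \<le> ereal D"
  shows "total_variation (\<lambda>u. f u + g u) \<le> ereal (C + D)"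
proof (rule total_variation_leI)
  fix n and p :: "nat \<Rightarrow> real" assume p: "mono_on {..n} p" "\<And>i. i \<le> n \<Longrightarrow> p i \<in> Omega"
  have "(\<Sum>i<n. \<bar>f (p (Suc i)) + g (p (Suc i)) - (f (p i) + g (p i))\<bar>)
    \<le> (\<Sum>i<n. \<bar>f (p (Suc i)) - f (p i)\<bar> + \<bar>g (p (Suc i)) - g (p i)\<bar>)"
    by (intro sum_mono) linarith
  also have "\<dots> \<le> C + D"
    unfolding sum.distrib by (intro add_mono total_variation_leD assms p)
  finally show "(\<Sum>i<n. \<bar>f (p (Suc i)) + g (p (Suc i)) - (f (p i) + g (p i))\<bar>) \<le> C + D" .
qed

lemma total_variation_uminus: "total_variation (\<lambda>u. - f u) = total_variation f"
  unfolding total_variation_def by (simp add: abs_minus_commute)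

lemma total_variation_mult:
  assumes f: "total_variation f \<le> ereal C" "\<And>u. u \<in> Omega \<Longrightarrow> \<bar>f u\<bar> \<le> K"
    and g: "total_variation g \<le> ereal D" "\<And>u. u \<in> Omega \<Longrightarrow> \<bar>g u\<bar> \<le> L"
  shows "total_variation (\<lambda>u. f u * g u) \<le> ereal (K * D + L * C)"
proof (rule total_variation_leI)
  have K: "0 \<le> K" "0 \<le> L" using f(2)[of 0] g(2)[of 0] by auto
  fix n and p :: "nat \<Rightarrow> real" assume p: "mono_on {..n} p" "\<And>i. i \<le> n \<Longrightarrow> p i \<in> Omega"
  have "(\<Sum>i<n. \<bar>f (p (Suc i)) * g (p (Suc i)) - f (p i) * g (p i)\<bar>)
    \<le> (\<Sum>i<n. K * \<bar>g (p (Suc i)) - g (p i)\<bar> + L * \<bar>f (p (Suc i)) - f (p i)\<bar>)"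
  proof (rule sum_mono)
    fix i assume "i \<in> {..<n}"
    then have b: "\<bar>f (p (Suc i))\<bar> \<le> K" "\<bar>g (p i)\<bar> \<le> L" using p(2) f(2) g(2) by auto
    have "f (p (Suc i)) * g (p (Suc i)) - f (p i) * g (p i)
      = f (p (Suc i)) * (g (p (Suc i)) - g (p i)) + g (p i) * (f (p (Suc i)) - f (p i))"
      by (simp add: algebra_simps)
    also have "\<bar>\<dots>\<bar> \<le> \<bar>f (p (Suc i))\<bar> * \<bar>g (p (Suc i)) - g (p i)\<bar> + \<bar>g (p i)\<bar> * \<bar>f (p (Suc i)) - f (p i)\<bar>"
      unfolding abs_mult[symmetric] by (rule abs_triangle_ineq)
    also have "\<dots> \<le> K * \<bar>g (p (Suc i)) - g (p i)\<bar> + L * \<bar>f (p (Suc i)) - f (p i)\<bar>"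
      by (intro add_mono mult_right_mono b) auto
    finally show "\<bar>f (p (Suc i)) * g (p (Suc i)) - f (p i) * g (p i)\<bar> \<le> \<dots>" .
  qed
  also have "\<dots> \<le> K * D + L * C"
    unfolding sum.distrib sum_distrib_left[symmetric]
    by (intro add_mono mult_left_mono total_variation_leD f g p K)
  finally show "(\<Sum>i<n. \<bar>f (p (Suc i)) * g (p (Suc i)) - f (p i) * g (p i)\<bar>) \<le> K * D + L * C" .
qed

lemma total_variation_mono:
  assumes "\<And>u v. u \<in> Omega \<Longrightarrow> v \<in> Omega \<Longrightarrow> u \<le> v \<Longrightarrow> f u \<le> f v"
  shows "total_variation f \<le> ereal (f 1 - f 0)"
proof (rule total_variation_leI)
  fix n and p :: "nat \<Rightarrow> real" assume p: "mono_on {..n} p" "\<And>i. i \<le> n \<Longrightarrow> p i \<in> Omega"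
  have "(\<Sum>i<n. \<bar>f (p (Suc i)) - f (p i)\<bar>) = (\<Sum>i<n. f (p (Suc i)) - f (p i))"
  proof (rule sum.cong[OF refl])
    fix i assume "i \<in> {..<n}"
    then have "f (p i) \<le> f (p (Suc i))" using p by (intro assms) (auto intro: mono_onD)
    then show "\<bar>f (p (Suc i)) - f (p i)\<bar> = f (p (Suc i)) - f (p i)" by simp
  qed
  also have "\<dots> = f (p n) - f (p 0)" by (rule sum_lessThan_telescope)
  also have "\<dots> \<le> f 1 - f 0" using p(2)[of n] p(2)[of 0] by (intro diff_mono assms) auto
  finally show "(\<Sum>i<n. \<bar>f (p (Suc i)) - f (p i)\<bar>) \<le> f 1 - f 0" .
qed

text \<open>\<open>f u + K * u\<close> is increasing with variation at most
  \<open>f 1 - f 0 + K\<close>; taking the linear term off again costs another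
  \<open>K\<close>.\<close>

lemma total_variation_almost_mono:
  assumes K: "0 \<le> K" and f: "\<And>u v. u \<in> Omega \<Longrightarrow> v \<in> Omega \<Longrightarrow> u \<le> v \<Longrightarrow> - K * (v - u) \<le> f v - f u"
  shows "total_variation f \<le> ereal (f 1 - f 0 + 2 * K)"
proof -
  have "total_variation (\<lambda>u. f u + K * u) \<le> ereal ((f 1 + K * 1) - (f 0 + K * 0))"
    by (rule total_variation_mono) (use f in \<open>force simp: algebra_simps\<close>)
  moreover have "total_variation (\<lambda>u. - (K * u)) \<le> ereal (K * 1 - K * 0)"
    unfolding total_variation_uminus by (rule total_variation_mono) (use K in \<open>auto intro: mult_left_mono\<close>)
  ultimately have "total_variation (\<lambda>u. f u + K * u + - (K * u)) \<le> ereal (((f 1 + K * 1) - (f 0 + K * 0)) + (K * 1 - K * 0))"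
    by (rule total_variation_add)
  then show ?thesis by (simp add: add.commute)
qed

section \<open>Riemann--Stieltjes sums\<close>

text \<open>The Riemann--Stieltjes sum of \<open>g\<close> against \<open>f\<close> on the grid \<open>i / n\<close>, after summation by parts.\<close>

definition RS_sum :: "nat \<Rightarrow> (real \<Rightarrow> real) \<Rightarrow> (real \<Rightarrow> real) \<Rightarrow> real" where
  "RS_sum n g f = g 1 * f 1 - (\<Sum>i<n. (g (real (Suc i) / real n) - g (real i / real n)) * f (real i / real n))"

lemma RS_sum_diff_right: "RS_sum n g (\<lambda>x. f x - h x) = RS_sum n g f - RS_sum n g h"
  unfolding RS_sum_def by (simp add: algebra_simps sum_subtractf sum.distrib)

lemma RS_sum_diff_left: "RS_sum n (\<lambda>x. f x - h x) g = RS_sum n f g - RS_sum n h g"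
  unfolding RS_sum_def by (simp add: algebra_simps sum_subtractf sum.distrib)

lemma RS_sum_cmult_right: "RS_sum n g (\<lambda>x. c * f x) = c * RS_sum n g f"
  unfolding RS_sum_def by (simp add: algebra_simps sum_distrib_left)

text \<open>After summation by parts the increments fall on \<open>g\<close>, so \<open>f\<close>
  enters through its supremum only. This lets integrals pass to uniform limits without any bound on
  the variation of the approximants.\<close>

lemma abs_RS_sum_le:
  assumes V: "total_variation g \<le> ereal V" and f: "\<And>u. u \<in> Omega \<Longrightarrow> \<bar>f u\<bar> \<le> C"
  shows "\<bar>RS_sum n g f\<bar> \<le> C * (\<bar>g 1\<bar> + V)"
proof -
  have C: "0 \<le> C" using f[of 0] by auto
  let ?p = "\<lambda>i. real i / real n"
  have p: "?p i \<in> Omega" if "i \<le> n" for i using that by (auto simp: divide_le_eq)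
  have "(\<Sum>i<n. \<bar>g (?p (Suc i)) - g (?p i)\<bar>) \<le> V"
    by (rule total_variation_leD[OF V]) (use p in \<open>auto intro!: mono_onI divide_right_mono\<close>)
  then have "C * (\<Sum>i<n. \<bar>g (?p (Suc i)) - g (?p i)\<bar>) \<le> C * V" using C by (rule mult_left_mono)
  moreover have "\<bar>\<Sum>i<n. (g (?p (Suc i)) - g (?p i)) * f (?p i)\<bar> \<le> (\<Sum>i<n. C * \<bar>g (?p (Suc i)) - g (?p i)\<bar>)"
  proof (rule order_trans[OF sum_abs sum_mono])
    fix i assume "i \<in> {..<n}"
    then have "\<bar>f (?p i)\<bar> \<le> C" by (intro f p) auto
    then have "\<bar>g (?p (Suc i)) - g (?p i)\<bar> * \<bar>f (?p i)\<bar> \<le> \<bar>g (?p (Suc i)) - g (?p i)\<bar> * C"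
      by (intro mult_left_mono) auto
    then show "\<bar>(g (?p (Suc i)) - g (?p i)) * f (?p i)\<bar> \<le> C * \<bar>g (?p (Suc i)) - g (?p i)\<bar>"
      by (simp add: abs_mult mult.commute)
  qed
  moreover have "\<bar>g 1 * f 1\<bar> \<le> C * \<bar>g 1\<bar>"
    using mult_left_mono[OF f[of 1], of "\<bar>g 1\<bar>"] by (simp add: abs_mult mult.commute)
  ultimately show ?thesis
    unfolding RS_sum_def by (simp add: sum_distrib_left[symmetric] distrib_left)
qed

lemma continuous_on_Omega_bounded:
  fixes g :: "real \<Rightarrow> real"
  assumes "continuous_on Omega g"
  obtains C where "\<And>u. u \<in> Omega \<Longrightarrow> \<bar>g u\<bar> \<le> C"
  using compact_imp_bounded[OF compact_continuous_image[OF assms compact_Icc]]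
  unfolding bounded_iff by (metis imageI real_norm_def)

text \<open>Each value of \<open>cdf K\<close> is the integral of an indicator, so the sum is the
  integral of a step function \<open>s n\<close>. That function evaluates \<open>g\<close> at a grid
  point next to \<open>u\<close>, and dominated convergence applies.\<close>

lemma RS_sum_tendsto_measure:
  assumes K: "finite_borel_measure K" "measure K (- Omega) = 0" and g: "continuous_on Omega g"
  shows "(\<lambda>n. RS_sum (Suc n) g (cdf K)) \<longlonglongrightarrow> (LINT u:Omega|K. g u)"
proof -
  interpret K: finite_borel_measure K by fact
  note [measurable_cong] = K.M_is_borel
  have AE: "AE u in K. u \<in> Omega"
  proof (rule AE_I)
    show "{u \<in> space K. u \<notin> Omega} \<subseteq> - Omega" by auto
    show "- Omega \<in> sets K" by (auto simp: K.M_is_borel)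
    show "emeasure K (- Omega) = 0" using K(2) by (simp add: K.emeasure_eq_measure)
  qed
  define s where "s n u = g 1 * indicator {..1} u
    - (\<Sum>i<n. (g (real (Suc i) / real n) - g (real i / real n)) * indicator {..real i / real n} u)" for n and u :: real
  have int_ind: "integrable K (indicator {..a} :: real \<Rightarrow> real)" for a :: real
    by (rule K.integrable_const_bound[of _ 1]) auto
  have "(LINT u|K. indicator {..a} u) = cdf K a" for a
    by (simp add: cdf_def K.borel_UNIV)
  then have int_s: "(LINT u|K. s n u) = RS_sum n g (cdf K)" for n
    unfolding s_def RS_sum_def
    by (subst Bochner_Integration.integral_diff, simp add: int_ind,
        intro Bochner_Integration.integrable_sum integrable_mult_right int_ind,
        subst Bochner_Integration.integral_sum, intro integrable_mult_right int_ind)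
      (simp only: integral_mult_right_zero)
  have s_eq: "\<exists>k. s n u = g k \<and> k \<in> Omega \<and> \<bar>k - u\<bar> \<le> 1 / real n" if n: "0 < n" and u: "u \<in> Omega" for n u
  proof -
    \<comment> \<open>\<open>k / n\<close> is the first grid point at or above \<open>u\<close>. The
      indicators are 1 exactly from index \<open>k\<close> on, so the sum telescopes to
      \<open>g 1 - g (k / n)\<close>; \<open>u = 0\<close> gives \<open>k = 0\<close>, which
      accounts for an atom at 0.\<close>
    define k where "k = nat \<lceil>real n * u\<rceil>"
    have k0: "real k = of_int \<lceil>real n * u\<rceil>" using u n unfolding k_def by simp
    have "\<lceil>real n * u\<rceil> \<le> int n" using u n by (simp add: ceiling_le_iff mult_left_le)
    then have kn: "k \<le> n" by (simp only: k_def nat_le_iff)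
    have iff: "u \<le> real i / real n \<longleftrightarrow> k \<le> i" for i
      using n unfolding k_def by (simp add: le_divide_eq mult.commute ceiling_le_iff nat_le_iff)
    have "(\<Sum>i<n. (g (real (Suc i) / real n) - g (real i / real n)) * indicator {..real i / real n} u)
      = (\<Sum>i\<in>{k..<n}. g (real (Suc i) / real n) - g (real i / real n))"
      by (rule sum.mono_neutral_cong_right) (auto simp: iff indicator_def)
    also have "\<dots> = g (real n / real n) - g (real k / real n)"
      by (rule sum_Suc_diff'[OF kn, of "\<lambda>i. g (real i / real n)"])
    finally have "s n u = g (real k / real n)" unfolding s_def using u n by simp
    moreover have "real k / real n \<in> Omega" using kn n by (auto simp: divide_le_eq)
    moreover have "\<bar>real k / real n - u\<bar> \<le> 1 / real n"
    proof -
      have "\<bar>real k - real n * u\<bar> \<le> 1" unfolding k0 by linarith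
      moreover have "real k / real n - u = (real k - real n * u) / real n" using n by (simp add: field_simps)
      ultimately show ?thesis using n by (simp add: divide_right_mono)
    qed
    ultimately show ?thesis by blast
  qed
  obtain C where C: "\<And>u. u \<in> Omega \<Longrightarrow> \<bar>g u\<bar> \<le> C"
    using continuous_on_Omega_bounded[OF g] by blast
  have "(\<lambda>n. LINT u|K. s (Suc n) u) \<longlonglongrightarrow> (LINT u|K. indicator Omega u * g u)"
  proof (rule integral_dominated_convergence[where w="\<lambda>_. C"])
    show "(\<lambda>u. indicator Omega u * g u) \<in> borel_measurable K"
      using borel_measurable_continuous_on_indicator[OF _ g] by simp
    show "s (Suc n) \<in> borel_measurable K" for n unfolding s_def[abs_def] by measurable
    show "integrable K (\<lambda>_. C)" by simp
    show "AE u in K. norm (s (Suc n) u) \<le> C" for n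
      using AE by eventually_elim (use s_eq[of "Suc n"] C in force)
    show "AE u in K. (\<lambda>n. s (Suc n) u) \<longlonglongrightarrow> indicator Omega u * g u"
      using AE
    proof eventually_elim
      fix u :: real assume u: "u \<in> Omega"
      have "\<exists>k. s (Suc n) u = g k \<and> k \<in> Omega \<and> \<bar>k - u\<bar> \<le> 1 / real (Suc n)" for n
        using s_eq u by blast
      then obtain k where k: "\<And>n. s (Suc n) u = g (k n)" "\<And>n. k n \<in> Omega" "\<And>n. \<bar>k n - u\<bar> \<le> 1 / real (Suc n)"
        by metis
      have "(\<lambda>n. k n - u) \<longlonglongrightarrow> 0"
        by (rule Lim_null_comparison[OF _ LIMSEQ_Suc[OF lim_1_over_n]]) (use k(3) in auto)
      then have "k \<longlonglongrightarrow> u" by (rule LIM_zero_cancel)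
      then have "(\<lambda>n. g (k n)) \<longlonglongrightarrow> g u"
        by (rule continuous_on_tendsto_compose[OF g]) (use u k(2) in auto)
      then show "(\<lambda>n. s (Suc n) u) \<longlonglongrightarrow> indicator Omega u * g u" using u by (simp add: k(1))
    qed
  qed
  then show ?thesis unfolding int_s set_lebesgue_integral_def by simp
qed

lemma signed_integral_continuous:
  assumes "has_signed_df K L f" "continuous_on Omega g"
  shows "signed_integral g f = (LINT u:Omega|K. g u) - (LINT u:Omega|L. g u)"
proof -
  obtain C where "\<And>u. u \<in> Omega \<Longrightarrow> \<bar>g u\<bar> \<le> C"
    using continuous_on_Omega_bounded[OF assms(2)] by blast
  moreover have "set_borel_measurable borel Omega g"
    unfolding set_borel_measurable_def using borel_measurable_continuous_on_indicator[OF _ assms(2)] by simp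
  ultimately show ?thesis using signed_integral_eq[OF assms(1)] by blast
qed

lemma RS_sum_tendsto:
  assumes "f \<in> span_dist" "continuous_on Omega g"
  shows "(\<lambda>n. RS_sum (Suc n) g f) \<longlonglongrightarrow> signed_integral g f"
proof -
  obtain K L where KL: "has_signed_df K L f" using span_dist_has_signed_df assms(1) by blast
  then have f: "f = (\<lambda>x. cdf K x - cdf L x)" by (simp add: has_signed_df_def)
  have "(\<lambda>n. RS_sum (Suc n) g (cdf K) - RS_sum (Suc n) g (cdf L)) \<longlonglongrightarrow> signed_integral g f"
    unfolding signed_integral_continuous[OF KL assms(2)]
    using KL by (intro tendsto_diff RS_sum_tendsto_measure assms) (auto simp: has_signed_df_def)
  then show ?thesis unfolding f RS_sum_diff_right .
qed

lemma abs_signed_integral_le: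
  assumes "f \<in> span_dist" "continuous_on Omega g" "total_variation g \<le> ereal V" "\<And>u. u \<in> Omega \<Longrightarrow> \<bar>f u\<bar> \<le> C"
  shows "\<bar>signed_integral g f\<bar> \<le> C * (\<bar>g 1\<bar> + V)"
  by (rule Lim_bounded[OF tendsto_rabs[OF RS_sum_tendsto[OF assms(1,2)]]])
    (use abs_RS_sum_le[OF assms(3,4)] in auto)

lemma signed_integral_diff_right:
  assumes "f \<in> span_dist" "h \<in> span_dist" "continuous_on Omega g"
  shows "signed_integral g (\<lambda>x. f x - h x) = signed_integral g f - signed_integral g h"
proof (rule LIMSEQ_unique)
  show "(\<lambda>n. RS_sum (Suc n) g (\<lambda>x. f x - h x)) \<longlonglongrightarrow> signed_integral g (\<lambda>x. f x - h x)"
    by (intro RS_sum_tendsto span_dist_diff assms)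
  show "(\<lambda>n. RS_sum (Suc n) g (\<lambda>x. f x - h x)) \<longlonglongrightarrow> signed_integral g f - signed_integral g h"
    unfolding RS_sum_diff_right by (intro tendsto_diff RS_sum_tendsto assms)
qed

lemma signed_integral_cmult_right:
  assumes "f \<in> span_dist" "continuous_on Omega g"
  shows "signed_integral g (\<lambda>x. c * f x) = c * signed_integral g f"
proof (rule LIMSEQ_unique)
  show "(\<lambda>n. RS_sum (Suc n) g (\<lambda>x. c * f x)) \<longlonglongrightarrow> signed_integral g (\<lambda>x. c * f x)"
    by (intro RS_sum_tendsto span_dist_cmult assms)
  show "(\<lambda>n. RS_sum (Suc n) g (\<lambda>x. c * f x)) \<longlonglongrightarrow> c * signed_integral g f"
    unfolding RS_sum_cmult_right by (intro tendsto_mult_left RS_sum_tendsto assms)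
qed

lemma signed_integral_diff_left:
  assumes "f \<in> span_dist" "continuous_on Omega g" "continuous_on Omega h"
  shows "signed_integral (\<lambda>u. g u - h u) f = signed_integral g f - signed_integral h f"
proof (rule LIMSEQ_unique)
  show "(\<lambda>n. RS_sum (Suc n) (\<lambda>u. g u - h u) f) \<longlonglongrightarrow> signed_integral (\<lambda>u. g u - h u) f"
    by (intro RS_sum_tendsto continuous_intros assms)
  show "(\<lambda>n. RS_sum (Suc n) (\<lambda>u. g u - h u) f) \<longlonglongrightarrow> signed_integral g f - signed_integral h f"
    unfolding RS_sum_diff_left by (intro tendsto_diff RS_sum_tendsto assms)
qed

text \<open>The bound by the supremum makes \<open>signed_integral g\<close> Lipschitz in the
  supremum norm on the span. It therefore extends uniquely to the closure, and both branches of
  \<open>integral_df\<close> are values of one continuous functional.\<close>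

lemma tendsto_integral_df:
  assumes g: "continuous_on Omega g" "total_variation g \<le> ereal V"
    and fk: "\<And>k. fk k \<in> span_dist" and lim: "uniform_limit UNIV fk f sequentially"
  shows "(\<lambda>k. signed_integral g (fk k)) \<longlonglongrightarrow> integral_df g f"
proof -
  define B where "B = \<bar>g 1\<bar> + V + 1"
  have "0 \<le> V" using total_variation_leD[OF g(2), of 0 "\<lambda>_. 0"] by (auto simp: mono_on_def)
  then have B: "0 < B" by (simp add: B_def)
  have diff: "\<bar>signed_integral g a - signed_integral g b\<bar> \<le> C * B"
    if "a \<in> span_dist" "b \<in> span_dist" "\<And>u. \<bar>a u - b u\<bar> \<le> C" for a b C
  proof -
    have "\<bar>signed_integral g (\<lambda>x. a x - b x)\<bar> \<le> C * (\<bar>g 1\<bar> + V)"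
      by (rule abs_signed_integral_le) (use that g in \<open>auto intro: span_dist_diff\<close>)
    also have "\<dots> \<le> C * B" using that(3)[of 0] unfolding B_def by (intro mult_left_mono) auto
    finally show ?thesis using that g by (simp add: signed_integral_diff_right)
  qed
  have close: "\<forall>\<^sub>F k in sequentially. \<forall>u. \<bar>hk k u - f u\<bar> < e"
    if "uniform_limit UNIV hk f sequentially" "0 < e" for hk and e :: real
    using uniform_limitD[OF that] by (simp add: dist_real_def)
  show ?thesis
  proof (cases "f \<in> span_dist")
    case True
    have "(\<lambda>k. signed_integral g (fk k)) \<longlonglongrightarrow> signed_integral g f"
    proof (rule tendstoI)
      fix e :: real assume e: "0 < e"
      then have "0 < e / (2 * B)" using B by simp
      from close[OF lim this]
      show "\<forall>\<^sub>F k in sequentially. dist (signed_integral g (fk k)) (signed_integral g f) < e"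
      proof eventually_elim
        case (elim k)
        have "\<bar>signed_integral g (fk k) - signed_integral g f\<bar> \<le> e / (2 * B) * B"
          using fk True elim by (intro diff) (auto intro: less_imp_le)
        also have "\<dots> < e" using B e by simp
        finally show ?case by (simp add: dist_real_def)
      qed
    qed
    then show ?thesis using True by (simp add: integral_df_def)
  next
    case False
    \<comment> \<open>The definite description needs existence and independence of the sequence: the
      limit exists along \<open>fk\<close>, and any other \<open>hk\<close> shares it because both
      come close to \<open>f\<close>.\<close>
    have "Cauchy (\<lambda>k. signed_integral g (fk k))"
    proof (rule CauchyI)
      fix e :: real assume e: "0 < e"
      obtain N where N: "\<And>k u. N \<le> k \<Longrightarrow> \<bar>fk k u - f u\<bar> < e / (4 * B)"
        using close[OF lim, of "e / (4 * B)"] B e by (auto simp: eventually_sequentially)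
      have "norm (signed_integral g (fk m) - signed_integral g (fk n)) < e" if "N \<le> m" "N \<le> n" for m n
      proof -
        have "\<bar>signed_integral g (fk m) - signed_integral g (fk n)\<bar> \<le> (e / (4 * B) + e / (4 * B)) * B"
        proof (intro diff fk)
          show "\<bar>fk m u - fk n u\<bar> \<le> e / (4 * B) + e / (4 * B)" for u
            using N[OF that(1), of u] N[OF that(2), of u] by linarith
        qed
        also have "\<dots> < e" using B e by (simp add: field_simps)
        finally show ?thesis by simp
      qed
      then show "\<exists>M. \<forall>m\<ge>M. \<forall>n\<ge>M. norm (signed_integral g (fk m) - signed_integral g (fk n)) < e"
        by blast
    qed
    then obtain I where I: "(\<lambda>k. signed_integral g (fk k)) \<longlonglongrightarrow> I"
      using Cauchy_convergent convergent_def by blast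
    have all: "(\<lambda>k. signed_integral g (hk k)) \<longlonglongrightarrow> I"
      if hk: "\<And>k. hk k \<in> span_dist" "uniform_limit UNIV hk f sequentially" for hk
    proof -
      have "(\<lambda>k. signed_integral g (hk k) - signed_integral g (fk k)) \<longlonglongrightarrow> 0"
      proof (rule tendstoI)
        fix e :: real assume e: "0 < e"
        then have "0 < e / (4 * B)" using B by simp
        from close[OF lim this] close[OF hk(2) this]
        show "\<forall>\<^sub>F k in sequentially. dist (signed_integral g (hk k) - signed_integral g (fk k)) 0 < e"
        proof eventually_elim
          case (elim k)
          have "\<bar>signed_integral g (hk k) - signed_integral g (fk k)\<bar> \<le> (e / (4 * B) + e / (4 * B)) * B"
          proof (intro diff fk hk)
            show "\<bar>hk k u - fk k u\<bar> \<le> e / (4 * B) + e / (4 * B)" for u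
              using elim[THEN spec, of u] by linarith
          qed
          also have "\<dots> < e" using B e by (simp add: field_simps)
          finally show ?case by simp
        qed
      qed
      from tendsto_add[OF this I] show ?thesis by simp
    qed
    have "(THE I. \<forall>fk. (\<forall>k. fk k \<in> span_dist) \<and> uniform_limit UNIV fk f sequentially
        \<longrightarrow> (\<lambda>k. signed_integral g (fk k)) \<longlonglongrightarrow> I) = I"
    proof (rule the_equality)
      fix I' assume "\<forall>fk. (\<forall>k. fk k \<in> span_dist) \<and> uniform_limit UNIV fk f sequentially
        \<longrightarrow> (\<lambda>k. signed_integral g (fk k)) \<longlonglongrightarrow> I'"
      then have "(\<lambda>k. signed_integral g (fk k)) \<longlonglongrightarrow> I'" using fk lim by blast
      then show "I' = I" using I by (rule LIMSEQ_unique)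
    qed (use all in blast)
    then have "integral_df g f = I" using False by (simp add: integral_df_def)
    then show ?thesis using I by simp
  qed
qed

section \<open>Markov chains with a Doeblin condition\<close>

definition unit_measure :: "real measure \<Rightarrow> bool" where
  "unit_measure K \<longleftrightarrow> finite_borel_measure K \<and> measure K (- Omega) = 0"

definition bounded_borel :: "(real \<Rightarrow> real) \<Rightarrow> bool" where
  "bounded_borel g \<longleftrightarrow> g \<in> borel_measurable borel \<and> (\<exists>C. \<forall>u\<in>Omega. \<bar>g u\<bar> \<le> C)"

lemma bounded_borelE:
  assumes "bounded_borel g"
  obtains C where "g \<in> borel_measurable borel" "\<And>u. u \<in> Omega \<Longrightarrow> \<bar>g u\<bar> \<le> C"
  using assms unfolding bounded_borel_def by blast

lemma unit_measure_AE:
  assumes "unit_measure K" shows "AE u in K. u \<in> Omega"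
proof (rule AE_I)
  interpret K: finite_borel_measure K using assms by (simp add: unit_measure_def)
  show "{u \<in> space K. u \<notin> Omega} \<subseteq> - Omega" by auto
  show "- Omega \<in> sets K" by (auto simp: K.M_is_borel)
  show "emeasure K (- Omega) = 0" using assms by (simp add: unit_measure_def K.emeasure_eq_measure)
qed

lemma bounded_borel_integrable:
  assumes "unit_measure K" "bounded_borel g"
  shows "integrable K (\<lambda>u. indicator Omega u * g u)"
proof -
  interpret K: finite_borel_measure K using assms by (simp add: unit_measure_def)
  note [measurable_cong] = K.M_is_borel
  obtain C where [measurable]: "g \<in> borel_measurable borel" and C: "\<And>u. u \<in> Omega \<Longrightarrow> \<bar>g u\<bar> \<le> C"
    using bounded_borelE[OF assms(2)] by blast
  show ?thesis
  proof (rule K.integrable_const_bound[of _ C])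
    show "AE u in K. norm (indicator Omega u * g u) \<le> C"
      using unit_measure_AE[OF assms(1)] by eventually_elim (use C in simp)
  qed measurable
qed

lemma set_integral_unit_bounds:
  assumes K: "unit_measure K" and g: "bounded_borel g" and ab: "\<And>u. u \<in> Omega \<Longrightarrow> a \<le> g u \<and> g u \<le> b"
  shows "a * cdf K 1 \<le> (LINT u:Omega|K. g u)" "(LINT u:Omega|K. g u) \<le> b * cdf K 1"
proof -
  interpret K: finite_borel_measure K using K by (simp add: unit_measure_def)
  note [measurable_cong] = K.M_is_borel
  have i: "integrable K (indicator Omega :: real \<Rightarrow> real)"
    by (rule K.integrable_const_bound[of _ 1]) auto
  have "measure K {..1} = measure K Omega"
    by (rule measure_eq_AE, rule eventually_mono[OF unit_measure_AE[OF K]]) (auto simp: K.M_is_borel)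
  then have c: "measure K Omega = cdf K 1"
    by (simp add: cdf_def)
  have "(LINT u|K. a * indicator Omega u) \<le> (LINT u|K. indicator Omega u * g u)"
    by (rule integral_mono[OF integrable_mult_right[OF i] bounded_borel_integrable[OF K g]])
      (use ab in \<open>auto simp: indicator_def\<close>)
  then show "a * cdf K 1 \<le> (LINT u:Omega|K. g u)"
    by (simp add: c[symmetric] set_lebesgue_integral_def K.borel_UNIV)
  have "(LINT u|K. indicator Omega u * g u) \<le> (LINT u|K. b * indicator Omega u)"
    by (rule integral_mono[OF bounded_borel_integrable[OF K g] integrable_mult_right[OF i]])
      (use ab in \<open>auto simp: indicator_def\<close>)
  then show "(LINT u:Omega|K. g u) \<le> b * cdf K 1"
    by (simp add: c[symmetric] set_lebesgue_integral_def K.borel_UNIV)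
qed

lemma cdf_eq_set_integral:
  assumes "unit_measure K"
  shows "cdf K x = (LINT u:Omega|K. indicator {..x} u)"
proof -
  interpret K: finite_borel_measure K using assms by (simp add: unit_measure_def)
  have "(LINT u:Omega|K. indicator {..x} u) = (LINT u|K. indicator (Omega \<inter> {..x}) u)"
    unfolding set_lebesgue_integral_def
    by (intro Bochner_Integration.integral_cong) (auto simp: indicator_def)
  also have "\<dots> = measure K (Omega \<inter> {..x})" by (simp add: K.borel_UNIV)
  also have "\<dots> = measure K {..x}"
    by (rule measure_eq_AE, rule eventually_mono[OF unit_measure_AE[OF assms]]) (auto simp: K.M_is_borel)
  finally show ?thesis by (simp add: cdf_def)
qed

lemma bounded_borel_indicator: "bounded_borel (indicator {..x})"
  by (auto simp: bounded_borel_def intro!: exI[of _ 1])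

text \<open>A chain given by a random map, so that Fubini links its action on functions with that on
  measures. \<open>drift\<close> is the source of the contraction; continuity and bounded variation
  make the integrals meaningful for uniform limits; the two Lipschitz bounds give the regularity of
  solutions.\<close>

locale doeblin_chain = prob_space +
  fixes \<phi> :: "real \<Rightarrow> 'a \<Rightarrow> real" and \<kappa> :: "real \<Rightarrow> real \<Rightarrow> real" and \<delta> \<eta> L V :: real
  assumes step_measurable: "(\<lambda>(u, \<omega>). \<phi> u \<omega>) \<in> borel_measurable (borel \<Otimes>\<^sub>M M)"
    and step_in: "\<phi> u \<omega> \<in> Omega"
    and kernel: "x \<in> Omega \<Longrightarrow> u \<in> Omega \<Longrightarrow> \<kappa> x u = prob {\<omega> \<in> space M. \<phi> u \<omega> \<le> x}"
    and drift: "0 < \<delta>" "0 < \<eta>" "u \<in> Omega \<Longrightarrow> \<eta> \<le> prob {\<omega> \<in> space M. \<phi> u \<omega> \<le> max (u - \<delta>) 0}"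
    and kernel_continuous: "x \<in> Omega \<Longrightarrow> continuous_on Omega (\<kappa> x)"
    and kernel_variation: "x \<in> Omega \<Longrightarrow> total_variation (\<kappa> x) \<le> ereal V"
    and kernel_vdist: "x \<in> Omega \<Longrightarrow> y \<in> Omega \<Longrightarrow> vdist \<kappa> x y \<le> ereal (L * \<bar>x - y\<bar>)"
    and kernel_zeta: "x \<in> Omega \<Longrightarrow> y \<in> Omega \<Longrightarrow> zeta \<kappa> x y \<le> L * \<bar>x - y\<bar>"
begin

definition transition :: "(real \<Rightarrow> real) \<Rightarrow> real \<Rightarrow> real" where
  "transition g u = (LINT \<omega>|M. g (\<phi> u \<omega>))"

text \<open>The adjoint of \<open>transition\<close>: the law after one step from an initial
  measure, whose mass need not be 1.\<close>

definition push :: "real measure \<Rightarrow> real measure" where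
  "push K = distr (K \<Otimes>\<^sub>M M) borel (\<lambda>(u, \<omega>). \<phi> u \<omega>)"

lemma step_measurable_at [measurable]: "\<phi> u \<in> borel_measurable M"
proof -
  have "(\<lambda>\<omega>. case (u, \<omega>) of (u, \<omega>) \<Rightarrow> \<phi> u \<omega>) \<in> borel_measurable M"
    by (rule measurable_compose[OF _ step_measurable]) simp
  then show ?thesis by simp
qed

lemma integrable_step:
  assumes "bounded_borel g" shows "integrable M (\<lambda>\<omega>. g (\<phi> u \<omega>))"
proof -
  obtain C where [measurable]: "g \<in> borel_measurable borel" and C: "\<And>u. u \<in> Omega \<Longrightarrow> \<bar>g u\<bar> \<le> C"
    using bounded_borelE[OF assms] by blast
  show ?thesis by (rule integrable_const_bound[of _ C]) (use C step_in in auto)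
qed

lemma transition_bounds:
  assumes "bounded_borel g" "\<And>u. u \<in> Omega \<Longrightarrow> a \<le> g u \<and> g u \<le> b"
  shows "a \<le> transition g u \<and> transition g u \<le> b"
  unfolding transition_def
  using integral_ge_const[OF integrable_step[OF assms(1)]] integral_le_const[OF integrable_step[OF assms(1)]]
    assms(2) step_in by auto

lemma bounded_borel_transition:
  assumes "bounded_borel g" shows "bounded_borel (transition g)"
proof -
  obtain C where [measurable]: "g \<in> borel_measurable borel" and C: "\<And>u. u \<in> Omega \<Longrightarrow> \<bar>g u\<bar> \<le> C"
    using bounded_borelE[OF assms] by blast
  have "(\<lambda>z. g (case z of (u, \<omega>) \<Rightarrow> \<phi> u \<omega>)) \<in> borel_measurable (borel \<Otimes>\<^sub>M M)"
    by (rule measurable_compose[OF step_measurable]) simp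
  then have "(\<lambda>(u, \<omega>). g (\<phi> u \<omega>)) \<in> borel_measurable (borel \<Otimes>\<^sub>M M)"
    by (simp add: case_prod_beta')
  then have "transition g \<in> borel_measurable borel"
    unfolding transition_def[abs_def] by (rule borel_measurable_lebesgue_integral)
  moreover have "\<bar>transition g u\<bar> \<le> C" for u
    using transition_bounds[OF assms, of "- C" C u] C by (simp add: abs_le_iff minus_le_iff)
  ultimately show ?thesis by (auto simp: bounded_borel_def)
qed

section \<open>Iterates of the transition operator\<close>

lemma bounded_borel_funpow: "bounded_borel g \<Longrightarrow> bounded_borel ((transition ^^ n) g)"
  by (induction n) (auto intro: bounded_borel_transition)

lemma funpow_bounds:
  assumes "bounded_borel g" "\<And>u. u \<in> Omega \<Longrightarrow> a \<le> g u \<and> g u \<le> b" "u \<in> Omega"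
  shows "a \<le> (transition ^^ n) g u \<and> (transition ^^ n) g u \<le> b"
  using assms(3)
proof (induction n arbitrary: u)
  case 0 then show ?case using assms(2) by simp
next
  case (Suc n)
  then show ?case using transition_bounds[OF bounded_borel_funpow[OF assms(1)], of a n b] by simp
qed

lemma transition_affine:
  assumes "bounded_borel g"
  shows "transition (\<lambda>u. c + d * g u) = (\<lambda>u. c + d * transition g u)"
  unfolding transition_def using integrable_step[OF assms] by (simp add: prob_space)

lemma funpow_affine:
  assumes "bounded_borel g"
  shows "(transition ^^ n) (\<lambda>u. c + d * g u) = (\<lambda>u. c + d * (transition ^^ n) g u)"
  by (induction n) (simp_all add: transition_affine bounded_borel_funpow[OF assms])

text \<open>The chain moves down by \<open>\<delta>\<close> with probability at least \<open>\<eta>\<close>, so \<open>k\<close> such moves in a row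
  bring it from \<open>u \<le> k * \<delta>\<close> to \<open>0\<close>.\<close>

lemma funpow_ge_zero_value:
  assumes g: "bounded_borel g" "\<And>u. u \<in> Omega \<Longrightarrow> 0 \<le> g u" and u: "u \<in> Omega" "u \<le> real k * \<delta>"
  shows "\<eta> ^ k * g 0 \<le> (transition ^^ k) g u"
  using u
proof (induction k arbitrary: u)
  case 0 then show ?case by auto
next
  case (Suc k)
  let ?h = "(transition ^^ k) g" and ?A = "{\<omega> \<in> space M. \<phi> u \<omega> \<le> max (u - \<delta>) 0}"
  have h: "bounded_borel ?h" by (rule bounded_borel_funpow[OF g(1)])
  obtain C where C: "\<And>u. u \<in> Omega \<Longrightarrow> \<bar>g u\<bar> \<le> C" using bounded_borelE[OF g(1)] by blast
  have h0: "0 \<le> ?h v" if "v \<in> Omega" for v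
    using funpow_bounds[OF g(1), of 0 C v k] g(2) C that by (auto simp: abs_le_iff)
  have c0: "0 \<le> \<eta> ^ k * g 0" using drift g(2)[of 0] by auto
  have "\<eta> ^ Suc k * g 0 \<le> prob ?A * (\<eta> ^ k * g 0)"
    using mult_right_mono[OF drift(3)[OF Suc.prems(1)] c0] by (simp add: mult.assoc)
  also have "\<dots> = (LINT \<omega>|M. indicator ?A \<omega> * (\<eta> ^ k * g 0))" by simp
  also have "\<dots> \<le> (LINT \<omega>|M. ?h (\<phi> u \<omega>))"
  proof (rule integral_mono)
    show "integrable M (\<lambda>\<omega>. indicator ?A \<omega> * (\<eta> ^ k * g 0))"
      by (rule integrable_const_bound[of _ "\<eta> ^ k * g 0"]) (use c0 in \<open>auto simp: indicator_def\<close>)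
    show "integrable M (\<lambda>\<omega>. ?h (\<phi> u \<omega>))" by (rule integrable_step[OF h])
    fix \<omega>
    show "indicator ?A \<omega> * (\<eta> ^ k * g 0) \<le> ?h (\<phi> u \<omega>)"
    proof (cases "\<omega> \<in> ?A")
      case True
      have "u \<le> real k * \<delta> + \<delta>" "0 \<le> real k * \<delta>"
        using Suc.prems(2) drift(1) by (simp_all add: algebra_simps)
      then have "max (u - \<delta>) 0 \<le> real k * \<delta>" by linarith
      then have "\<phi> u \<omega> \<le> real k * \<delta>" using True by (auto intro: order_trans)
      then show ?thesis using True Suc.IH[OF step_in] by simp
    next
      case False
      then show ?thesis using h0[OF step_in] by simp
    qed
  qed
  also have "\<dots> = (transition ^^ Suc k) g u" by (simp add: transition_def)
  finally show ?case .
qed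

definition hit_time :: nat where
  "hit_time = nat \<lceil>1 / \<delta>\<rceil>"

definition rate :: real where
  "rate = 1 - \<eta> ^ hit_time"

lemma hit_time: "u \<in> Omega \<Longrightarrow> u \<le> real hit_time * \<delta>"
proof -
  assume "u \<in> Omega"
  moreover have "1 / \<delta> \<le> real hit_time" unfolding hit_time_def by (rule real_nat_ceiling_ge)
  ultimately show ?thesis using drift(1) by (simp add: divide_le_eq)
qed

lemma rate: "0 \<le> rate" "rate < 1"
proof -
  have "\<eta> \<le> 1" using drift(3)[of 0] by (auto intro: order_trans)
  then show "0 \<le> rate" "rate < 1" using drift(2) by (auto simp: rate_def power_le_one)
qed

text \<open>Both \<open>g - a\<close> and \<open>b - g\<close> are nonnegative, so after
  \<open>hit_time\<close> steps each is at least \<open>\<eta> ^ hit_time\<close> times its value at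
  0. The two gains add up to \<open>\<eta> ^ hit_time * (b - a)\<close> whatever \<open>g 0\<close>
  is, and the oscillation shrinks by that amount.\<close>

lemma funpow_contraction:
  assumes g: "bounded_borel g" and ab: "\<And>u. u \<in> Omega \<Longrightarrow> a \<le> g u \<and> g u \<le> b"
  obtains a' b' where "b' - a' = rate * (b - a)"
    "\<And>u. u \<in> Omega \<Longrightarrow> a' \<le> (transition ^^ hit_time) g u \<and> (transition ^^ hit_time) g u \<le> b'"
proof -
  let ?e = "\<eta> ^ hit_time"
  show ?thesis
  proof (rule that[of "b - ?e * (b - g 0)" "a + ?e * (g 0 - a)"])
    show "b - ?e * (b - g 0) - (a + ?e * (g 0 - a)) = rate * (b - a)"
      by (simp add: rate_def algebra_simps)
    fix u assume u: "u \<in> Omega"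
    have bb: "bounded_borel (\<lambda>u. c + d * g u)" for c d
    proof -
      obtain C where [measurable]: "g \<in> borel_measurable borel" and C: "\<And>u. u \<in> Omega \<Longrightarrow> \<bar>g u\<bar> \<le> C"
        using bounded_borelE[OF g] by blast
      have "\<bar>c + d * g u\<bar> \<le> \<bar>c\<bar> + \<bar>d\<bar> * C" if "u \<in> Omega" for u
        using abs_triangle_ineq[of c "d * g u"] mult_left_mono[OF C[OF that], of "\<bar>d\<bar>"] by (simp add: abs_mult)
      moreover have "(\<lambda>u. c + d * g u) \<in> borel_measurable borel" by measurable
      ultimately show ?thesis unfolding bounded_borel_def by blast
    qed
    have "?e * (- a + 1 * g 0) \<le> (transition ^^ hit_time) (\<lambda>u. - a + 1 * g u) u"
      by (rule funpow_ge_zero_value[OF bb]) (use ab u hit_time in auto)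
    moreover have "?e * (b + (-1) * g 0) \<le> (transition ^^ hit_time) (\<lambda>u. b + (-1) * g u) u"
      by (rule funpow_ge_zero_value[OF bb]) (use ab u hit_time in auto)
    ultimately show "a + ?e * (g 0 - a) \<le> (transition ^^ hit_time) g u \<and>
        (transition ^^ hit_time) g u \<le> b - ?e * (b - g 0)"
      unfolding funpow_affine[OF g] by (simp add: algebra_simps)
  qed
qed

text \<open>Averaging never leaves a band once entered, so one \<open>a\<close> serves all later
  \<open>n\<close>. The width depends on \<open>k\<close> and not on \<open>g\<close>; this becomes
  uniformity over the threshold \<open>x\<close> when \<open>g\<close> is an indicator.\<close>

lemma funpow_oscillation:
  assumes g: "bounded_borel g" and ab: "\<And>u. u \<in> Omega \<Longrightarrow> 0 \<le> g u \<and> g u \<le> 1"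
  shows "\<exists>a. \<forall>n\<ge>k * hit_time. \<forall>u\<in>Omega. a \<le> (transition ^^ n) g u \<and> (transition ^^ n) g u \<le> a + rate ^ k"
proof -
  have "\<exists>a. \<forall>u\<in>Omega. a \<le> (transition ^^ (k * hit_time)) g u \<and> (transition ^^ (k * hit_time)) g u \<le> a + rate ^ k"
  proof (induction k)
    case 0 then show ?case using ab by (intro exI[of _ 0]) auto
  next
    case (Suc k)
    let ?h = "(transition ^^ (k * hit_time)) g"
    obtain a where a: "\<And>u. u \<in> Omega \<Longrightarrow> a \<le> ?h u \<and> ?h u \<le> a + rate ^ k" using Suc by blast
    obtain a' b' where ab': "b' - a' = rate * (a + rate ^ k - a)"
      "\<And>u. u \<in> Omega \<Longrightarrow> a' \<le> (transition ^^ hit_time) ?h u \<and> (transition ^^ hit_time) ?h u \<le> b'"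
      using funpow_contraction[OF bounded_borel_funpow[OF g] a] by blast
    have "(transition ^^ hit_time) ?h = (transition ^^ (Suc k * hit_time)) g"
      by (simp add: funpow_add)
    moreover have "b' = a' + rate ^ Suc k" using ab'(1) by simp
    ultimately show ?case using ab'(2) by metis
  qed
  then obtain a where a: "\<And>u. u \<in> Omega \<Longrightarrow> a \<le> (transition ^^ (k * hit_time)) g u \<and>
      (transition ^^ (k * hit_time)) g u \<le> a + rate ^ k" by blast
  have "a \<le> (transition ^^ n) g u \<and> (transition ^^ n) g u \<le> a + rate ^ k"
    if "k * hit_time \<le> n" "u \<in> Omega" for n u
  proof -
    have "(transition ^^ n) g = (transition ^^ (n - k * hit_time)) ((transition ^^ (k * hit_time)) g)"
      using funpow_add[of "n - k * hit_time" "k * hit_time" transition] that(1) by simp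
    then show ?thesis using funpow_bounds[OF bounded_borel_funpow[OF g] a that(2)] by simp
  qed
  then show ?thesis by blast
qed

text \<open>Duality of \<open>push\<close> and \<open>transition\<close>, by Fubini. The indicator
  of \<open>Omega\<close> is dropped where the step lands there for every outcome and put back
  because \<open>K\<close> is concentrated there.\<close>

lemma push_integral:
  assumes K: "unit_measure K" and g: "bounded_borel g"
  shows "(LINT u:Omega|push K. g u) = (LINT u:Omega|K. transition g u)"
proof -
  interpret K: finite_borel_measure K using K by (simp add: unit_measure_def)
  note [measurable_cong] = K.M_is_borel
  interpret P: pair_sigma_finite K M ..
  interpret PF: finite_measure "K \<Otimes>\<^sub>M M" by (rule finite_measure_pair_measure) unfold_locales
  have m [measurable]: "(\<lambda>(u, \<omega>). \<phi> u \<omega>) \<in> borel_measurable (K \<Otimes>\<^sub>M M)"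
    using step_measurable by (simp cong: measurable_cong_sets)
  obtain C where [measurable]: "g \<in> borel_measurable borel" and C: "\<And>u. u \<in> Omega \<Longrightarrow> \<bar>g u\<bar> \<le> C"
    using bounded_borelE[OF g] by blast
  have gm: "(\<lambda>z. g (case z of (u, \<omega>) \<Rightarrow> \<phi> u \<omega>)) \<in> borel_measurable (K \<Otimes>\<^sub>M M)"
    by (rule measurable_compose[OF m]) simp
  have int: "integrable (K \<Otimes>\<^sub>M M) (\<lambda>z. g (case z of (u, \<omega>) \<Rightarrow> \<phi> u \<omega>))"
    by (rule PF.integrable_const_bound[of _ C]) (use C step_in gm in \<open>auto simp: case_prod_beta'\<close>)
  have "(LINT u:Omega|push K. g u) = integral\<^sup>L (K \<Otimes>\<^sub>M M)
      (\<lambda>z. indicator Omega (case z of (u, \<omega>) \<Rightarrow> \<phi> u \<omega>) * g (case z of (u, \<omega>) \<Rightarrow> \<phi> u \<omega>))"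
    unfolding set_lebesgue_integral_def push_def by (subst integral_distr[OF m]) simp_all
  also have "\<dots> = integral\<^sup>L (K \<Otimes>\<^sub>M M) (\<lambda>z. g (case z of (u, \<omega>) \<Rightarrow> \<phi> u \<omega>))"
    using step_in by (intro Bochner_Integration.integral_cong) (auto simp: indicator_def)
  also have "\<dots> = (LINT u|K. transition g u)"
    unfolding transition_def by (subst P.integral_fst'[OF int, symmetric]) simp
  also have "\<dots> = (LINT u|K. indicator Omega u * transition g u)"
  proof (rule integral_cong_AE)
    have [measurable]: "transition g \<in> borel_measurable borel"
      using bounded_borel_transition[OF g] by (simp add: bounded_borel_def)
    show "transition g \<in> borel_measurable K" "(\<lambda>u. indicator Omega u * transition g u) \<in> borel_measurable K"
      by measurable
    show "AE u in K. transition g u = indicator Omega u * transition g u"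
      using unit_measure_AE[OF K] by eventually_elim simp
  qed
  finally show ?thesis by (simp add: set_lebesgue_integral_def)
qed

lemma unit_measure_push:
  assumes K: "unit_measure K" shows "unit_measure (push K)"
proof -
  interpret K: finite_borel_measure K using K by (simp add: unit_measure_def)
  note [measurable_cong] = K.M_is_borel
  interpret PF: finite_measure "K \<Otimes>\<^sub>M M" by (rule finite_measure_pair_measure) unfold_locales
  have m [measurable]: "(\<lambda>(u, \<omega>). \<phi> u \<omega>) \<in> borel_measurable (K \<Otimes>\<^sub>M M)"
    using step_measurable by (simp cong: measurable_cong_sets)
  interpret D: finite_measure "push K" unfolding push_def by (rule PF.finite_measure_distr[OF m])
  have "finite_borel_measure (push K)" by unfold_locales (simp add: push_def)
  moreover have "(\<lambda>(u, \<omega>). \<phi> u \<omega>) -` (- Omega) \<inter> space (K \<Otimes>\<^sub>M M) = {}"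
    using step_in by fastforce
  then have "measure (push K) (- Omega) = 0"
    unfolding push_def by (subst measure_distr[OF m]) auto
  ultimately show ?thesis by (simp add: unit_measure_def)
qed

lemma transition_indicator:
  assumes "x \<in> Omega" "u \<in> Omega"
  shows "transition (indicator {..x}) u = \<kappa> x u"
proof -
  have "transition (indicator {..x}) u = (LINT \<omega>|M. indicator {\<omega> \<in> space M. \<phi> u \<omega> \<le> x} \<omega>)"
    unfolding transition_def by (intro Bochner_Integration.integral_cong) (auto simp: indicator_def)
  then show ?thesis using kernel[OF assms] by simp
qed

text \<open>Turns the integral of the stationarity equation into a distribution function, so that
  the equation says that one step leaves the signed measure unchanged.\<close>

lemma cdf_push:
  assumes "unit_measure K" "x \<in> Omega"
  shows "cdf (push K) x = (LINT u:Omega|K. \<kappa> x u)"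
  unfolding cdf_eq_set_integral[OF unit_measure_push[OF assms(1)]] push_integral[OF assms(1) bounded_borel_indicator]
  unfolding set_lebesgue_integral_def
  using transition_indicator[OF assms(2)] by (intro Bochner_Integration.integral_cong) (auto simp: indicator_def)

end

lemma increasing_df_cdf_unit: "unit_measure K \<Longrightarrow> increasing_df (cdf K)"
  by (simp add: unit_measure_def increasing_df_cdf)

lemma has_signed_df_unit: "has_signed_df K L f \<Longrightarrow> unit_measure K \<and> unit_measure L"
  by (simp add: has_signed_df_def unit_measure_def)

lemma unit_measure_signed_df: "unit_measure K \<Longrightarrow> unit_measure L \<Longrightarrow> has_signed_df K L (\<lambda>x. cdf K x - cdf L x)"
  by (simp add: has_signed_df_def unit_measure_def)

lemma signed_integral_bounded_borel:
  assumes "has_signed_df K L f" "bounded_borel g"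
  shows "signed_integral g f = (LINT u:Omega|K. g u) - (LINT u:Omega|L. g u)"
proof -
  obtain C where [measurable]: "g \<in> borel_measurable borel" and C: "\<And>u. u \<in> Omega \<Longrightarrow> \<bar>g u\<bar> \<le> C"
    using bounded_borelE[OF assms(2)] by blast
  have "set_borel_measurable borel Omega g"
    unfolding set_borel_measurable_def by measurable
  then show ?thesis using signed_integral_eq[OF assms(1)] C by blast
qed

lemma signed_integral_cdf:
  assumes "unit_measure K" "continuous_on Omega g"
  shows "signed_integral g (cdf K) = (LINT u:Omega|K. g u)"
proof (rule LIMSEQ_unique)
  show "(\<lambda>n. RS_sum (Suc n) g (cdf K)) \<longlonglongrightarrow> signed_integral g (cdf K)"
    using assms by (intro RS_sum_tendsto increasing_df_imp_span_dist increasing_df_cdf_unit)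
  show "(\<lambda>n. RS_sum (Suc n) g (cdf K)) \<longlonglongrightarrow> (LINT u:Omega|K. g u)"
    using assms by (intro RS_sum_tendsto_measure) (auto simp: unit_measure_def)
qed

text \<open>Uniformity serves right continuity, where the limit in \<open>n\<close> is exchanged
  with the limit from the right; the other conditions pass pointwise.\<close>

lemma increasing_df_uniform_limit:
  assumes F: "\<And>n. increasing_df (F n)" and lim: "uniform_limit UNIV F p sequentially"
  shows "increasing_df p"
proof -
  have ptw: "(\<lambda>n. F n x) \<longlonglongrightarrow> p x" for x using tendsto_uniform_limitI[OF lim] by simp
  show ?thesis unfolding increasing_df_def
  proof (intro conjI allI impI)
    show "mono p"
      by (rule monoI, rule LIMSEQ_le[OF ptw ptw]) (use increasing_dfD(1)[OF F] in blast)
    show "continuous (at_right x) p" for x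
      unfolding continuous_within
    proof (rule swap_uniform_limit)
      show "\<forall>\<^sub>F n in sequentially. (F n \<longlongrightarrow> F n x) (at_right x)"
        using increasing_dfD(2)[OF F] by (simp add: continuous_within)
      show "uniform_limit {x<..} F p sequentially" using lim by (rule uniform_limit_on_subset) simp
    qed (use ptw in auto)
    show "p x = 0" if "x < 0" for x
      using ptw[of x] increasing_dfD(3)[OF F that] by (simp add: LIMSEQ_const_iff)
    show "p x = p 1" if "1 \<le> x" for x
    proof (rule LIMSEQ_unique[OF ptw])
      show "(\<lambda>n. F n x) \<longlonglongrightarrow> p 1"
        unfolding increasing_dfD(4)[OF F that] by (rule ptw)
    qed
  qed
qed

lemma tendsto_mult_power_zero:
  fixes c :: real assumes "0 \<le> r" "r < 1"
  shows "(\<lambda>k. r ^ k * c) \<longlonglongrightarrow> 0"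
  using tendsto_mult_left_zero[OF LIMSEQ_realpow_zero[OF assms]] .

section \<open>Uniqueness and existence of the stationary solution\<close>

context doeblin_chain begin

text \<open>The pushed pair is another representation of the same signed measure; neither
  \<open>K\<close> nor \<open>N\<close> need be invariant by itself. The equation is given on
  \<open>Omega\<close>; outside, both sides are 0 or equal to their values at 1.\<close>

lemma solution_push:
  assumes df: "has_signed_df K N f" and sol: "solves_stationarity \<kappa> f" and f: "f \<in> span_dist"
  shows "has_signed_df (push K) (push N) f"
proof -
  have KL: "unit_measure K" "unit_measure N" using has_signed_df_unit[OF df] by auto
  note df' = unit_measure_signed_df[OF unit_measure_push[OF KL(1)] unit_measure_push[OF KL(2)]]
  have in_Omega: "f x = cdf (push K) x - cdf (push N) x" if x: "x \<in> Omega" for x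
  proof -
    have "f x = signed_integral (\<kappa> x) f"
      using sol x f by (simp add: solves_stationarity_def integral_df_def)
    then show ?thesis
      by (simp add: signed_integral_continuous[OF df kernel_continuous[OF x]] cdf_push[OF KL(1) x] cdf_push[OF KL(2) x])
  qed
  have "f x = cdf (push K) x - cdf (push N) x" for x
  proof -
    consider "x < 0" | "x \<in> Omega" | "1 \<le> x" by force
    then show ?thesis
    proof cases
      case 1
      then show ?thesis using has_signed_df_vanishes[OF df] has_signed_df_vanishes[OF df'] by simp
    next
      case 3
      then show ?thesis
        using has_signed_df_const[OF df 3] has_signed_df_const[OF df' 3] in_Omega[of 1] by simp
    qed (rule in_Omega)
  qed
  then show ?thesis using df' by (simp add: has_signed_df_def fun_eq_iff)
qed

text \<open>\<open>signed_integral\<close> does not depend on the representing pair, so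
  \<open>K\<close>, \<open>N\<close> may be exchanged for their pushes, and duality moves the step
  onto \<open>g\<close>.\<close>

lemma solution_funpow:
  assumes df: "has_signed_df K N f" and sol: "solves_stationarity \<kappa> f" and f: "f \<in> span_dist"
    and g: "bounded_borel g"
  shows "signed_integral ((transition ^^ n) g) f = signed_integral g f"
proof (induction n)
  case (Suc n)
  have KL: "unit_measure K" "unit_measure N" using has_signed_df_unit[OF df] by auto
  let ?h = "(transition ^^ n) g"
  have h: "bounded_borel ?h" by (rule bounded_borel_funpow[OF g])
  have "signed_integral ?h f = (LINT u:Omega|push K. ?h u) - (LINT u:Omega|push N. ?h u)"
    by (rule signed_integral_bounded_borel[OF solution_push[OF df sol f] h])
  also have "\<dots> = signed_integral (transition ?h) f"
    unfolding push_integral[OF KL(1) h] push_integral[OF KL(2) h]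
    by (rule signed_integral_bounded_borel[OF df bounded_borel_transition[OF h], symmetric])
  finally show ?case using Suc by simp
qed simp

text \<open>By invariance the iterate \<open>h\<close> may replace the indicator, whose integral is
  \<open>f x\<close>. The constant \<open>a\<close> integrates to \<open>a * f 1\<close>, and the
  excess of \<open>h\<close> over it costs at most \<open>w\<close> times the combined mass of
  \<open>K\<close> and \<open>N\<close>.\<close>

lemma solution_oscillation:
  assumes f: "f \<in> span_dist" and sol: "solves_stationarity \<kappa> f"
    and h: "(transition ^^ n) (indicator {..x}) = h" "\<And>u. u \<in> Omega \<Longrightarrow> a \<le> h u \<and> h u \<le> a + w"
    and df: "has_signed_df K N f"
  shows "\<bar>f x - a * f 1\<bar> \<le> w * (cdf K 1 + cdf N 1)"
proof -
  have KL: "unit_measure K" "unit_measure N" using has_signed_df_unit[OF df] by auto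
  have hb: "bounded_borel h" using bounded_borel_funpow[OF bounded_borel_indicator] h(1) by metis
  have "f x = signed_integral (indicator {..x}) f"
    unfolding signed_integral_bounded_borel[OF df bounded_borel_indicator]
      cdf_eq_set_integral[OF KL(1), symmetric] cdf_eq_set_integral[OF KL(2), symmetric]
    by (rule has_signed_df_increasing(3)[OF df])
  also have "\<dots> = signed_integral h f"
    using solution_funpow[OF df sol f bounded_borel_indicator] h(1) by metis
  also have "\<dots> = (LINT u:Omega|K. h u) - (LINT u:Omega|N. h u)"
    by (rule signed_integral_bounded_borel[OF df hb])
  finally have fx: "f x = (LINT u:Omega|K. h u) - (LINT u:Omega|N. h u)" .
  have f1: "a * f 1 = a * cdf K 1 - a * cdf N 1"
    unfolding has_signed_df_increasing(3)[OF df, of 1] by (rule right_diff_distrib)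
  have "0 \<le> w" using h(2)[of 0] by auto
  then have "0 \<le> w * cdf K 1" "0 \<le> w * cdf N 1"
    using increasing_df_nonneg[OF increasing_df_cdf_unit] KL by auto
  then show ?thesis
    using set_integral_unit_bounds[OF KL(1) hb h(2)] set_integral_unit_bounds[OF KL(2) hb h(2)]
    unfolding fx f1 abs_le_iff distrib_left distrib_right by linarith
qed

text \<open>The band of the iterated indicator belongs to the chain and not to the solution: the
  same \<open>a\<close> approximates \<open>p x\<close>, and \<open>a * f 1\<close> approximates
  \<open>f x\<close>. Eliminating \<open>a\<close> leaves an error of order
  \<open>rate ^ k\<close>.\<close>

lemma solutions_proportional:
  assumes f: "f \<in> span_dist" "solves_stationarity \<kappa> f"
    and p: "p \<in> span_dist" "solves_stationarity \<kappa> p" "p 1 = 1"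
  shows "f x = f 1 * p x"
proof -
  obtain K N where KL: "has_signed_df K N f" using span_dist_has_signed_df[OF f(1)] by blast
  obtain K' N' where KL': "has_signed_df K' N' p" using span_dist_has_signed_df[OF p(1)] by blast
  define C where "C = cdf K 1 + cdf N 1 + \<bar>f 1\<bar> * (cdf K' 1 + cdf N' 1)"
  have "\<bar>f x - f 1 * p x\<bar> \<le> rate ^ k * C" for k
  proof -
    have "\<exists>a. \<forall>n\<ge>k * hit_time. \<forall>u\<in>Omega. a \<le> (transition ^^ n) (indicator {..x}) u \<and>
        (transition ^^ n) (indicator {..x}) u \<le> a + rate ^ k"
      by (rule funpow_oscillation[OF bounded_borel_indicator]) (auto simp: indicator_def)
    then obtain a where a: "\<And>u. u \<in> Omega \<Longrightarrow> a \<le> (transition ^^ (k * hit_time)) (indicator {..x}) u \<and>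
        (transition ^^ (k * hit_time)) (indicator {..x}) u \<le> a + rate ^ k" by blast
    have 1: "\<bar>f x - a * f 1\<bar> \<le> rate ^ k * (cdf K 1 + cdf N 1)"
      by (rule solution_oscillation[OF f refl a KL])
    have "\<bar>p x - a * p 1\<bar> \<le> rate ^ k * (cdf K' 1 + cdf N' 1)"
      by (rule solution_oscillation[OF p(1,2) refl a KL'])
    then have "\<bar>f 1\<bar> * \<bar>p x - a\<bar> \<le> \<bar>f 1\<bar> * (rate ^ k * (cdf K' 1 + cdf N' 1))"
      using p(3) by (intro mult_left_mono) auto
    moreover have "f x - f 1 * p x = (f x - a * f 1) - f 1 * (p x - a)" by (simp add: algebra_simps)
    then have "\<bar>f x - f 1 * p x\<bar> \<le> \<bar>f x - a * f 1\<bar> + \<bar>f 1\<bar> * \<bar>p x - a\<bar>"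
      using abs_triangle_ineq4[of "f x - a * f 1" "f 1 * (p x - a)"] by (simp add: abs_mult)
    ultimately show ?thesis using 1 unfolding C_def by (simp add: algebra_simps)
  qed
  then have "\<bar>f x - f 1 * p x\<bar> \<le> 0"
    by (intro LIMSEQ_le_const[OF tendsto_mult_power_zero[OF rate, of C]]) blast
  then show ?thesis by simp
qed

definition law :: "nat \<Rightarrow> real measure" where
  "law n = (push ^^ n) (return borel 0)"

lemma unit_measure_law: "unit_measure (law n)"
proof (induction n)
  case 0
  interpret R: prob_space "return borel (0::real)" by (rule prob_space_return) simp
  have "finite_borel_measure (return borel (0::real))" by unfold_locales simp
  moreover have "measure (return borel (0::real)) (- Omega) = 0" by (simp add: measure_return)
  ultimately show ?case by (simp add: law_def unit_measure_def)
next
  case (Suc n) then show ?case using unit_measure_push by (simp add: law_def)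
qed

lemma integral_law:
  assumes "bounded_borel g"
  shows "(LINT u:Omega|law n. g u) = (transition ^^ n) g 0"
  using assms
proof (induction n arbitrary: g)
  case 0
  then have [measurable]: "g \<in> borel_measurable borel" by (simp add: bounded_borel_def)
  show ?case unfolding law_def set_lebesgue_integral_def by (simp add: integral_return)
next
  case (Suc n)
  have "(LINT u:Omega|law (Suc n). g u) = (LINT u:Omega|law n. transition g u)"
    using push_integral[OF unit_measure_law Suc.prems] by (simp add: law_def)
  \<comment> \<open>The last \<open>push\<close> on the measure pairs with the innermost
    \<open>transition\<close> on the function, which is why the induction runs over all
    \<open>g\<close>.\<close>
  also have "\<dots> = (transition ^^ Suc n) g 0"
    using Suc.IH[OF bounded_borel_transition[OF Suc.prems]] by (simp only: funpow_Suc_right o_apply)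
  finally show ?case .
qed

text \<open>The laws started at 0 are uniformly Cauchy since the bands for all \<open>x\<close> have
  the same width. Uniform convergence keeps the limit a distribution function and allows the limit
  in the identity between \<open>F (Suc n) x\<close> and the integral of \<open>\<kappa> x\<close>
  against \<open>F n\<close>.\<close>

lemma stationary_exists: "\<exists>p. stationary_dist \<kappa> p"
proof -
  define F where "F n = cdf (law n)" for n
  have Feq: "F n x = (transition ^^ n) (indicator {..x}) 0" for n x
    unfolding F_def cdf_eq_set_integral[OF unit_measure_law] by (rule integral_law[OF bounded_borel_indicator])
  have iF: "increasing_df (F n)" for n
    unfolding F_def by (rule increasing_df_cdf_unit[OF unit_measure_law])
  have "uniformly_Cauchy_on UNIV F"
  proof (rule uniformly_Cauchy_onI)
    fix e :: real assume e: "0 < e"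
    obtain k where k: "rate ^ k < e" using real_arch_pow_inv[OF e rate(2)] by blast
    have "dist (F m x) (F n x) < e" if mn: "k * hit_time \<le> m" "k * hit_time \<le> n" for m n x
    proof -
      have "\<exists>a. \<forall>n\<ge>k * hit_time. \<forall>u\<in>Omega. a \<le> (transition ^^ n) (indicator {..x}) u \<and>
          (transition ^^ n) (indicator {..x}) u \<le> a + rate ^ k"
        by (rule funpow_oscillation[OF bounded_borel_indicator]) (auto simp: indicator_def)
      then obtain a where a: "\<And>n. k * hit_time \<le> n \<Longrightarrow> a \<le> F n x \<and> F n x \<le> a + rate ^ k"
        unfolding Feq by (metis atLeastAtMost_iff order_refl zero_le_one)
      show ?thesis using a[OF mn(1)] a[OF mn(2)] k by (auto simp: dist_real_def abs_less_iff)
    qed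
    then show "\<exists>M. \<forall>x\<in>UNIV. \<forall>m\<ge>M. \<forall>n\<ge>M. dist (F m x) (F n x) < e" by blast
  qed
  then obtain p where lim: "uniform_limit UNIV F p sequentially"
    using Cauchy_uniformly_convergent unfolding uniformly_convergent_on_def by blast
  have ptw: "(\<lambda>n. F n x) \<longlonglongrightarrow> p x" for x using tendsto_uniform_limitI[OF lim] by simp
  \<comment> \<open>\<open>indicator {..1}\<close> is 1 throughout \<open>Omega\<close>, hence so
    are its iterates, and no mass is lost in the limit.\<close>
  have "F n 1 = 1" for n
    using funpow_bounds[OF bounded_borel_indicator[of 1], of 1 1 0 n] by (simp add: Feq)
  then have "p 1 = 1" using ptw[of 1] by (simp add: LIMSEQ_const_iff)
  with increasing_df_uniform_limit[OF iF lim] have "p \<in> dist_funs" by (simp add: dist_funs_iff)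
  moreover have "p x = integral_df (\<kappa> x) p" if x: "x \<in> Omega" for x
  proof (rule LIMSEQ_unique)
    have "(\<lambda>n. signed_integral (\<kappa> x) (F n)) \<longlonglongrightarrow> integral_df (\<kappa> x) p"
      by (rule tendsto_integral_df[OF kernel_continuous[OF x] kernel_variation[OF x] _ lim])
        (rule increasing_df_imp_span_dist[OF iF])
    moreover have "signed_integral (\<kappa> x) (F n) = F (Suc n) x" for n
      unfolding F_def signed_integral_cdf[OF unit_measure_law kernel_continuous[OF x]]
      using cdf_push[OF unit_measure_law x] by (simp add: law_def)
    ultimately show "(\<lambda>n. F (Suc n) x) \<longlonglongrightarrow> integral_df (\<kappa> x) p" by simp
    show "(\<lambda>n. F (Suc n) x) \<longlonglongrightarrow> p x" by (rule LIMSEQ_Suc[OF ptw])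
  qed
  ultimately show ?thesis by (auto simp: stationary_dist_def solves_stationarity_def)
qed

text \<open>A solution inherits the regularity of \<open>\<kappa>\<close> in \<open>x\<close>, which brings it back into the span.\<close>

lemma closure_solution_in_span_dist:
  assumes f: "f \<in> closure_span_dist" and sol: "solves_stationarity \<kappa> f"
  shows "f \<in> span_dist"
proof -
  obtain fk where fk: "\<And>k. fk k \<in> span_dist" and lim: "uniform_limit UNIV fk f sequentially"
    using f by (auto simp: closure_span_dist_def)
  obtain C where C: "\<And>x. \<bar>f x\<bar> \<le> C" using closure_span_distD(3)[OF f] by blast
  have C0: "0 \<le> C" using C[of 0] by linarith
  have ev: "\<forall>\<^sub>F k in sequentially. \<forall>x. \<bar>fk k x\<bar> \<le> C + 1"
    using uniform_limitD[OF lim zero_less_one]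
  proof eventually_elim
    case (elim k)
    show ?case
    proof
      fix x
      have "dist (fk k x) (f x) < 1" using elim by simp
      then show "\<bar>fk k x\<bar> \<le> C + 1" using C[of x] by (simp add: dist_real_def)
    qed
  qed
  \<comment> \<open>\<open>C + 1\<close> eventually bounds the approximants; the value at 1 and the
    variation of the difference of kernels each contribute
    \<open>L * \<bar>x - y\<bar>\<close>.\<close>
  have lip: "\<bar>f x - f y\<bar> \<le> ((C + 1) * (2 * L)) * \<bar>x - y\<bar>" if xy: "x \<in> Omega" "y \<in> Omega" for x y
  proof -
    let ?g = "\<lambda>u. \<kappa> x u - \<kappa> y u"
    have cont: "continuous_on Omega ?g" by (intro continuous_intros kernel_continuous xy)
    have lim': "(\<lambda>k. signed_integral (\<kappa> z) (fk k)) \<longlonglongrightarrow> f z" if z: "z \<in> Omega" for z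
      using tendsto_integral_df[OF kernel_continuous[OF z] kernel_variation[OF z] fk lim] sol z
      by (simp add: solves_stationarity_def)
    have "(\<lambda>k. signed_integral ?g (fk k)) \<longlonglongrightarrow> f x - f y"
      using tendsto_diff[OF lim'[OF xy(1)] lim'[OF xy(2)]]
      by (simp add: signed_integral_diff_left[OF fk kernel_continuous[OF xy(1)] kernel_continuous[OF xy(2)]])
    then have "(\<lambda>k. \<bar>signed_integral ?g (fk k)\<bar>) \<longlonglongrightarrow> \<bar>f x - f y\<bar>" by (rule tendsto_rabs)
    moreover have "\<forall>\<^sub>F k in sequentially. \<bar>signed_integral ?g (fk k)\<bar> \<le> ((C + 1) * (2 * L)) * \<bar>x - y\<bar>"
      using ev
    proof eventually_elim
      case (elim k)
      have tv: "total_variation ?g \<le> ereal (L * \<bar>x - y\<bar>)"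
        using kernel_vdist[OF xy(2) xy(1)] by (simp add: vdist_def abs_minus_commute)
      have "\<bar>signed_integral ?g (fk k)\<bar> \<le> (C + 1) * (\<bar>?g 1\<bar> + L * \<bar>x - y\<bar>)"
        by (rule abs_signed_integral_le[OF fk cont tv]) (use elim in blast)
      also have "\<dots> \<le> (C + 1) * (L * \<bar>x - y\<bar> + L * \<bar>x - y\<bar>)"
        using C0 kernel_zeta[OF xy(2) xy(1)]
        by (intro mult_left_mono add_right_mono) (auto simp: zeta_def abs_minus_commute)
      finally show ?case by (simp add: algebra_simps)
    qed
    ultimately show ?thesis by (rule tendsto_upperbound) simp
  qed
  show ?thesis
    by (rule lipschitz_imp_span_dist[OF closure_span_distD(1,2)[OF f] lip])
qed

theorem unique_stationary_distribution_kernel: "unique_stationary_distribution \<kappa>"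
proof -
  obtain p where p: "stationary_dist \<kappa> p" using stationary_exists by blast
  then have p': "p \<in> span_dist" "solves_stationarity \<kappa> p" "p 1 = 1"
    using dist_funs_subset_span_dist by (auto simp: stationary_dist_def dist_funs_iff)
  have scale: "(\<lambda>x. \<alpha> * p x) \<in> closure_span_dist \<and> solves_stationarity \<kappa> (\<lambda>x. \<alpha> * p x)" for \<alpha>
  proof
    have s: "(\<lambda>x. \<alpha> * p x) \<in> span_dist" by (rule span_dist_cmult[OF p'(1)])
    then show "(\<lambda>x. \<alpha> * p x) \<in> closure_span_dist"
      unfolding closure_span_dist_def
      by (auto intro!: exI[of _ "\<lambda>_ x. \<alpha> * p x"] uniform_limit_const)
    show "solves_stationarity \<kappa> (\<lambda>x. \<alpha> * p x)"
      using p'(2) s p'(1) unfolding solves_stationarity_def integral_df_def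
      by (simp add: signed_integral_cmult_right[OF p'(1) kernel_continuous])
  qed
  have "{p'. stationary_dist \<kappa> p'} = {p}"
  proof (intro equalityI subsetI)
    fix q assume "q \<in> {p'. stationary_dist \<kappa> p'}"
    then have q: "q \<in> span_dist" "solves_stationarity \<kappa> q" "q 1 = 1"
      using dist_funs_subset_span_dist by (auto simp: stationary_dist_def dist_funs_iff)
    have "q x = p x" for x using solutions_proportional[OF q(1,2) p', of x] q(3) by simp
    then show "q \<in> {p}" by auto
  qed (use p in simp)
  moreover have "{f \<in> closure_span_dist. solves_stationarity \<kappa> f} = {\<lambda>x. \<alpha> * p x | \<alpha>. True}"
  proof (intro equalityI subsetI)
    fix f assume "f \<in> {f \<in> closure_span_dist. solves_stationarity \<kappa> f}"
    then have f: "f \<in> span_dist" "solves_stationarity \<kappa> f"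
      by (auto intro: closure_solution_in_span_dist)
    have "f = (\<lambda>x. f 1 * p x)"
      by (rule ext) (rule solutions_proportional[OF f p'])
    then show "f \<in> {\<lambda>x. \<alpha> * p x | \<alpha>. True}" by blast
  qed (use scale in auto)
  ultimately show ?thesis unfolding unique_stationary_distribution_def by blast
qed

end

section \<open>Kernels that are Lipschitz in the first argument\<close>

text \<open>On a cell of length \<open>l\<close> both distances are at most \<open>C * l\<close>, so
  this one property serves the partition conditions of \<open>cadlag_countable_jumps\<close> and of
  \<open>proper_truncation\<close>.\<close>

definition lipschitz_kernel :: "real \<Rightarrow> (real \<Rightarrow> real \<Rightarrow> real) \<Rightarrow> bool" where
  "lipschitz_kernel C \<kappa> \<longleftrightarrow> 0 \<le> C \<and> (\<forall>x\<in>Omega. \<forall>y\<in>Omega.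
     zeta \<kappa> x y \<le> C * \<bar>x - y\<bar> \<and> vdist \<kappa> x y \<le> ereal (C * \<bar>x - y\<bar>))"

lemma lipschitz_kernel_less:
  assumes "lipschitz_kernel C \<kappa>" "x \<in> Omega" "y \<in> Omega" "C * \<bar>x - y\<bar> < e"
  shows "zeta \<kappa> x y < e \<and> vdist \<kappa> x y < ereal e"
proof -
  have "zeta \<kappa> x y \<le> C * \<bar>x - y\<bar>" "vdist \<kappa> x y \<le> ereal (C * \<bar>x - y\<bar>)"
    using assms(1-3) unfolding lipschitz_kernel_def by blast+
  moreover have "ereal (C * \<bar>x - y\<bar>) < ereal e" using assms(4) by simp
  ultimately show ?thesis using assms(4) by (auto elim: le_less_trans)
qed

text \<open>\<open>zeta\<close> controls the difference at 1, and the two-point partition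
  \<open>u\<close>, 1 carries the bound to \<open>u\<close>; each contributes once, hence the
  2.\<close>

lemma lipschitz_kernel_pointwise:
  assumes "lipschitz_kernel C \<kappa>" "x \<in> Omega" "y \<in> Omega" "u \<in> Omega"
  shows "\<bar>\<kappa> x u - \<kappa> y u\<bar> \<le> 2 * C * \<bar>x - y\<bar>"
proof -
  let ?g = "\<lambda>u. \<kappa> y u - \<kappa> x u"
  have z: "zeta \<kappa> x y \<le> C * \<bar>x - y\<bar>" and v: "vdist \<kappa> x y \<le> ereal (C * \<bar>x - y\<bar>)"
    using assms(1-3) unfolding lipschitz_kernel_def by blast+
  let ?p = "\<lambda>i::nat. if i = 0 then u else 1"
  have "(\<Sum>i<1. \<bar>?g (?p (Suc i)) - ?g (?p i)\<bar>) \<le> C * \<bar>x - y\<bar>"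
    by (rule total_variation_leD[OF v[unfolded vdist_def]]) (use assms(4) in \<open>auto simp: mono_on_def\<close>)
  then show ?thesis using z by (simp add: zeta_def)
qed

lemma cadlag_countable_jumps_lipschitz:
  assumes "lipschitz_kernel C \<kappa>"
  shows "cadlag_countable_jumps \<kappa>"
  unfolding cadlag_countable_jumps_def
proof (intro allI impI)
  fix e :: real assume e: "0 < e"
  have C: "0 \<le> C" using assms by (simp add: lipschitz_kernel_def)
  \<comment> \<open>The successor makes the number of cells exceed \<open>C / e\<close>
    strictly.\<close>
  define m where "m = Suc (nat \<lceil>C / e\<rceil>)"
  have m: "0 < real m" by (simp add: m_def)
  have "C / e < real m" unfolding m_def using real_nat_ceiling_ge[of "C / e"] by linarith
  then have Cm: "C / real m < e" using e m by (simp add: field_simps)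
  define s where "s i = (real i - 1) / real m" for i
  have "strict_mono_on {1..m + 1} s"
    using m by (auto simp: strict_mono_on_def s_def divide_strict_right_mono)
  moreover have "zeta \<kappa> x1 x2 < e \<and> vdist \<kappa> x1 x2 < ereal e"
    if i: "i \<in> {1..m + 1}" and x: "x1 \<in> (if i < m + 1 then {s i..<s (Suc i)} else {1})"
      "x2 \<in> (if i < m + 1 then {s i..<s (Suc i)} else {1})" for i x1 x2
  proof (cases "i < m + 1")
    case True
    have si: "0 \<le> s i" "s (Suc i) \<le> 1" "s (Suc i) = s i + 1 / real m"
      using True i m by (auto simp: s_def divide_le_eq add_divide_distrib diff_divide_distrib)
    have b: "s i \<le> x1" "x1 < s (Suc i)" "s i \<le> x2" "x2 < s (Suc i)" using x True by auto
    then have "x1 \<in> Omega" "x2 \<in> Omega" using si by auto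
    moreover have "C * \<bar>x1 - x2\<bar> \<le> C * (1 / real m)" using b si C by (intro mult_left_mono) auto
    then have "C * \<bar>x1 - x2\<bar> < e" using Cm by simp
    ultimately show ?thesis by (rule lipschitz_kernel_less[OF assms])
  next
    case False
    then show ?thesis using x e by (intro lipschitz_kernel_less[OF assms]) auto
  qed
  ultimately show "\<exists>N s. 1 \<le> N \<and> s 1 = 0 \<and> s N = 1 \<and> strict_mono_on {1..N} s \<and>
      (\<forall>i\<in>{1..N}. let E = (if i < N then {s i..<s (Suc i)} else {1}) in
        \<forall>x1\<in>E. \<forall>x2\<in>E. zeta \<kappa> x1 x2 < e \<and> vdist \<kappa> x1 x2 < ereal e)"
    using m unfolding Let_def by (intro exI[of _ "m + 1"] exI[of _ s]) (auto simp: s_def)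
qed

section \<open>Dyadic truncations\<close>

lemma dyadic_state_in:
  assumes "i \<in> {1..dyadic_size r}" shows "dyadic_state r i \<in> Omega"
proof -
  have "i \<le> 2 ^ r + 1" "1 \<le> real i" using assms by (auto simp: dyadic_size_def)
  then have "real i \<le> real (2 ^ r + 1)" "1 \<le> real i" by (simp_all only: of_nat_le_iff)
  then show ?thesis by (simp add: dyadic_state_def divide_le_eq)
qed

lemma dyadic_state_mono: "strict_mono_on A (dyadic_state r)"
  by (auto simp: strict_mono_on_def dyadic_state_def divide_strict_right_mono)

text \<open>Past \<open>J\<close> the knot is infinite and \<open>real_of_ereal\<close> returns 0
  there, which explains the default \<open>\<kappa> 0 u\<close>.\<close>

lemma kernel_ext_knot:
  "kernel_ext \<kappa> (knot J c j) u = (if j = 0 then 0 else if j \<le> J then \<kappa> (c j) u else \<kappa> 0 u)"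
  by (simp add: kernel_ext_def knot_def)

lemma dyadic_matrix_sum:
  assumes "m \<le> dyadic_size r" "1 \<le> m"
  shows "(\<Sum>j=1..m. dyadic_matrix \<kappa> r i j) = \<kappa> (dyadic_state r m) (dyadic_state r i)"
proof -
  let ?K = "\<lambda>j. kernel_ext \<kappa> (knot (dyadic_size r) (dyadic_state r) j) (dyadic_state r i)"
  have "(\<Sum>j=1..m. dyadic_matrix \<kappa> r i j) = (\<Sum>j\<in>{0<..m}. ?K j - ?K (j - 1))"
    by (rule sum.cong) (auto simp: dyadic_matrix_def)
  also have "\<dots> = ?K m - ?K 0"
    by (induction m) (simp_all add: atLeastSucAtMost_greaterThanAtMost[symmetric])
  finally show ?thesis using assms by (simp add: kernel_ext_knot)
qed

text \<open>Entries are increments of the kernel along the grid, and a row telescopes to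
  \<open>\<kappa> 1 u\<close>. The first column has minus infinity to its left and carries the whole
  value \<open>\<kappa> 0 u\<close>, the mass at 0.\<close>

lemma finite_markov_chain_dyadic:
  assumes mono: "\<And>x y u. x \<in> Omega \<Longrightarrow> y \<in> Omega \<Longrightarrow> u \<in> Omega \<Longrightarrow> x \<le> y \<Longrightarrow> \<kappa> x u \<le> \<kappa> y u"
    and nonneg: "\<And>u. u \<in> Omega \<Longrightarrow> 0 \<le> \<kappa> 0 u" and one: "\<And>u. u \<in> Omega \<Longrightarrow> \<kappa> 1 u = 1"
  shows "finite_markov_chain (dyadic_size r) (dyadic_state r) (dyadic_matrix \<kappa> r)"
  unfolding finite_markov_chain_def
proof (intro conjI ballI)
  show "strict_mono_on {1..dyadic_size r} (dyadic_state r)" by (rule dyadic_state_mono)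
  show "dyadic_state r ` {1..dyadic_size r} \<subseteq> Omega" using dyadic_state_in by blast
  fix i assume i: "i \<in> {1..dyadic_size r}"
  have u: "dyadic_state r i \<in> Omega" by (rule dyadic_state_in[OF i])
  have "(\<Sum>j=1..dyadic_size r. dyadic_matrix \<kappa> r i j) = \<kappa> (dyadic_state r (dyadic_size r)) (dyadic_state r i)"
    by (rule dyadic_matrix_sum) (auto simp: dyadic_size_def)
  then show "(\<Sum>j=1..dyadic_size r. dyadic_matrix \<kappa> r i j) = 1"
    using one[OF u] by (simp add: dyadic_state_def dyadic_size_def)
  fix j assume j: "j \<in> {1..dyadic_size r}"
  show "0 \<le> dyadic_matrix \<kappa> r i j"
  proof (cases "j = 1")
    case True
    then show ?thesis using nonneg[OF u] j
      by (simp add: dyadic_matrix_def kernel_ext_knot dyadic_state_def)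
  next
    case False
    then have j': "j - 1 \<in> {1..dyadic_size r}" using j by auto
    have "\<kappa> (dyadic_state r (j - 1)) (dyadic_state r i) \<le> \<kappa> (dyadic_state r j) (dyadic_state r i)"
      by (rule mono[OF dyadic_state_in[OF j'] dyadic_state_in[OF j] u])
        (auto simp: dyadic_state_def divide_right_mono)
    then show ?thesis using j j' False by (simp add: dyadic_matrix_def kernel_ext_knot)
  qed
qed

text \<open>The sum over the states up to \<open>x\<close> telescopes, which evaluates the kernel at
  the last grid point not above \<open>x\<close>.\<close>

lemma trunc_row_dyadic:
  assumes x: "x \<in> Omega"
  shows "trunc_row (dyadic_size r) (dyadic_state r) (dyadic_matrix \<kappa> r) i x
    = \<kappa> (of_int \<lfloor>2 ^ r * x\<rfloor> / 2 ^ r) (dyadic_state r i)"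
proof -
  define m where "m = Suc (nat \<lfloor>2 ^ r * x\<rfloor>)"
  have f0: "0 \<le> \<lfloor>2 ^ r * x\<rfloor>" using x by simp
  have rm: "real m = of_int \<lfloor>2 ^ r * x\<rfloor> + 1" unfolding m_def using f0 by simp
  have "2 ^ r * x \<le> 2 ^ r" using x by (simp add: mult_left_le)
  then have "real m \<le> 2 ^ r + 1" unfolding rm using of_int_floor_le[of "2 ^ r * x"] by linarith
  then have "real m \<le> real (2 ^ r + 1)" by simp
  then have m: "m \<le> dyadic_size r" unfolding dyadic_size_def by (simp only: of_nat_le_iff)
  have iff: "dyadic_state r j \<le> x \<longleftrightarrow> j \<le> m" for j
  proof -
    have "dyadic_state r j \<le> x \<longleftrightarrow> of_int (int j - 1) \<le> 2 ^ r * x"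
      by (simp add: dyadic_state_def divide_le_eq mult.commute)
    also have "\<dots> \<longleftrightarrow> int j - 1 \<le> \<lfloor>2 ^ r * x\<rfloor>" by (rule le_floor_iff[symmetric])
    also have "\<dots> \<longleftrightarrow> j \<le> m" unfolding m_def using f0 by linarith
    finally show ?thesis .
  qed
  have "trunc_row (dyadic_size r) (dyadic_state r) (dyadic_matrix \<kappa> r) i x = (\<Sum>j=1..m. dyadic_matrix \<kappa> r i j)"
    unfolding trunc_row_def by (rule sum.mono_neutral_cong_right) (use m iff in auto)
  also have "\<dots> = \<kappa> (dyadic_state r m) (dyadic_state r i)"
    by (rule dyadic_matrix_sum[OF m]) (simp add: m_def)
  finally show ?thesis by (simp add: dyadic_state_def rm)
qed

text \<open>Cells in \<open>u\<close> are open on the left, so \<open>u\<close> is rounded up while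
  \<open>x\<close> is rounded down.\<close>

lemma trunc_kernel_dyadic:
  assumes x: "x \<in> Omega" and u: "u \<in> Omega"
  shows "trunc_kernel (dyadic_size r) (dyadic_state r) (dyadic_matrix \<kappa> r) x u
    = \<kappa> (of_int \<lfloor>2 ^ r * x\<rfloor> / 2 ^ r) (of_int \<lceil>2 ^ r * u\<rceil> / 2 ^ r)"
proof -
  \<comment> \<open>Index of the only cell containing \<open>u\<close>; for \<open>u = 0\<close> it
    is 1, the cell whose left end is minus infinity.\<close>
  define k where "k = Suc (nat \<lceil>2 ^ r * u\<rceil>)"
  have c0: "0 \<le> \<lceil>2 ^ r * u\<rceil>"
  proof -
    have "0 \<le> 2 ^ r * u" using u by simp
    then show ?thesis by linarith
  qed
  have rk: "real k = of_int \<lceil>2 ^ r * u\<rceil> + 1" unfolding k_def using c0 by simp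
  have "2 ^ r * u \<le> of_int (2 ^ r)" using u by (simp add: mult_left_le)
  then have "\<lceil>2 ^ r * u\<rceil> \<le> 2 ^ r" by (simp only: ceiling_le_iff)
  then have k: "k \<in> {1..dyadic_size r}" unfolding k_def dyadic_size_def by (simp add: nat_le_iff)
  have le: "u \<le> dyadic_state r j \<longleftrightarrow> k \<le> j" for j
  proof -
    have "u \<le> dyadic_state r j \<longleftrightarrow> 2 ^ r * u \<le> of_int (int j - 1)"
      by (simp add: dyadic_state_def le_divide_eq mult.commute)
    also have "\<dots> \<longleftrightarrow> \<lceil>2 ^ r * u\<rceil> \<le> int j - 1" by (rule ceiling_le_iff[symmetric])
    also have "\<dots> \<longleftrightarrow> k \<le> j" unfolding k_def using c0 by linarith
    finally show ?thesis .
  qed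
  have iff: "knot (dyadic_size r) (dyadic_state r) (i - 1) < ereal u \<and> ereal u \<le> knot (dyadic_size r) (dyadic_state r) i
      \<longleftrightarrow> i = k" if i: "i \<in> {1..dyadic_size r}" for i
  proof -
    have "knot (dyadic_size r) (dyadic_state r) (i - 1) < ereal u \<longleftrightarrow> i - 1 < k"
      using i le[of "i - 1"] k by (auto simp: knot_def)
    moreover have "ereal u \<le> knot (dyadic_size r) (dyadic_state r) i \<longleftrightarrow> k \<le> i"
      using i le[of i] by (auto simp: knot_def)
    ultimately show ?thesis using i by auto
  qed
  have "trunc_kernel (dyadic_size r) (dyadic_state r) (dyadic_matrix \<kappa> r) x u
    = (\<Sum>i\<in>{1..dyadic_size r}. if i = k then trunc_row (dyadic_size r) (dyadic_state r) (dyadic_matrix \<kappa> r) i x else 0)"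
    unfolding trunc_kernel_def by (rule sum.cong[OF refl]) (simp only: iff, simp)
  also have "\<dots> = trunc_row (dyadic_size r) (dyadic_state r) (dyadic_matrix \<kappa> r) k x"
    using k by simp
  finally show ?thesis unfolding trunc_row_dyadic[OF x] by (simp add: dyadic_state_def rk)
qed

lemma proper_truncation_dyadic:
  assumes lip: "lipschitz_kernel C \<kappa>" and cont: "\<And>x. x \<in> Omega \<Longrightarrow> continuous_on Omega (\<kappa> x)"
  shows "proper_truncation \<kappa> dyadic_size dyadic_state (dyadic_matrix \<kappa>)"
  unfolding proper_truncation_def
proof (intro conjI)
  have C: "0 \<le> C" using lip by (simp add: lipschitz_kernel_def)
  have inv: "(\<lambda>r. c / 2 ^ r) \<longlonglongrightarrow> 0" for c :: real
  proof -
    have "(\<lambda>r. c * (1 / 2) ^ r) \<longlonglongrightarrow> c * 0" by (intro tendsto_intros LIMSEQ_power_zero) simp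
    then show ?thesis by (simp add: power_divide)
  qed
  show "\<exists>\<epsilon>. (\<forall>r. 0 \<le> \<epsilon> r) \<and> \<epsilon> \<longlonglongrightarrow> 0 \<and>
      (\<forall>r. \<forall>i\<in>{1..dyadic_size r}.
         let E = {x \<in> Omega. knot (dyadic_size r) (dyadic_state r) i \<le> ereal x \<and>
               ereal x < knot (dyadic_size r) (dyadic_state r) (Suc i)} in
         \<forall>x1\<in>E. \<forall>x2\<in>E. zeta \<kappa> x1 x2 < \<epsilon> r \<and> vdist \<kappa> x1 x2 < ereal (\<epsilon> r))"
    unfolding Let_def
  \<comment> \<open>Cells have length at most \<open>1 / 2 ^ r\<close>; \<open>C + 1\<close> in
    place of \<open>C\<close> makes the inequalities strict even if \<open>C = 0\<close>.\<close>
  proof (intro exI[of _ "\<lambda>r. (C + 1) / 2 ^ r"] conjI allI ballI inv)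
    show "0 \<le> (C + 1) / 2 ^ r" for r using C by simp
    fix r i x1 x2
    assume i: "i \<in> {1..dyadic_size r}"
      and x1: "x1 \<in> {x \<in> Omega. knot (dyadic_size r) (dyadic_state r) i \<le> ereal x \<and>
               ereal x < knot (dyadic_size r) (dyadic_state r) (Suc i)}"
      and x2: "x2 \<in> {x \<in> Omega. knot (dyadic_size r) (dyadic_state r) i \<le> ereal x \<and>
               ereal x < knot (dyadic_size r) (dyadic_state r) (Suc i)}"
    have top: "x \<le> dyadic_state r i + 1 / 2 ^ r \<and> dyadic_state r i \<le> x"
      if "x \<in> {x \<in> Omega. knot (dyadic_size r) (dyadic_state r) i \<le> ereal x \<and>
               ereal x < knot (dyadic_size r) (dyadic_state r) (Suc i)}" for x
    proof (cases "Suc i \<le> dyadic_size r")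
      case True
      then show ?thesis using that i
        by (auto simp: knot_def dyadic_state_def add_divide_distrib[symmetric])
    next
      case False
      then have "i = 2 ^ r + 1" using i by (auto simp: dyadic_size_def)
      then show ?thesis using that i by (auto simp: knot_def dyadic_state_def dyadic_size_def)
    qed
    have "\<bar>x1 - x2\<bar> \<le> 1 / 2 ^ r" using top[OF x1] top[OF x2] by linarith
    then have "C * \<bar>x1 - x2\<bar> \<le> C * (1 / 2 ^ r)" using C by (rule mult_left_mono)
    also have "\<dots> < (C + 1) / 2 ^ r" by (simp add: divide_strict_right_mono)
    finally have d: "C * \<bar>x1 - x2\<bar> < (C + 1) / 2 ^ r" .
    have "zeta \<kappa> x1 x2 < (C + 1) / 2 ^ r \<and> vdist \<kappa> x1 x2 < ereal ((C + 1) / 2 ^ r)"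
      by (rule lipschitz_kernel_less[OF lip _ _ d]) (use x1 x2 in auto)
    then show "zeta \<kappa> x1 x2 < (C + 1) / 2 ^ r" "vdist \<kappa> x1 x2 < ereal ((C + 1) / 2 ^ r)" by auto
  qed
  show "\<forall>r1 r2. r1 < r2 \<longrightarrow> dyadic_state r1 ` {1..dyadic_size r1} \<subseteq> dyadic_state r2 ` {1..dyadic_size r2}"
  proof (intro allI impI subsetI)
    fix r1 r2 :: nat and z
    assume r: "r1 < r2" and z: "z \<in> dyadic_state r1 ` {1..dyadic_size r1}"
    then obtain i where i: "1 \<le> i" "i \<le> 2 ^ r1 + 1" "z = dyadic_state r1 i" by (auto simp: dyadic_size_def)
    \<comment> \<open>The zero-based numerator \<open>i - 1\<close> is rescaled to the finer
      denominator; the final 1 restores the numbering.\<close>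
    define j where "j = (i - 1) * 2 ^ (r2 - r1) + 1"
    have p: "(2::nat) ^ r2 = 2 ^ r1 * 2 ^ (r2 - r1)" using r by (simp add: power_add[symmetric])
    have "(i - 1) * 2 ^ (r2 - r1) \<le> 2 ^ r1 * 2 ^ (r2 - r1)" using i by (intro mult_right_mono) auto
    then have "j \<in> {1..dyadic_size r2}" unfolding j_def dyadic_size_def p by simp
    moreover have "z = dyadic_state r2 j"
    proof -
      have "(2::real) ^ r2 = 2 ^ r1 * 2 ^ (r2 - r1)" using r by (simp add: power_add[symmetric])
      then show ?thesis using i(1) by (simp add: i(3) dyadic_state_def j_def of_nat_diff)
    qed
    ultimately show "z \<in> dyadic_state r2 ` {1..dyadic_size r2}" by blast
  qed
  show "\<forall>r. \<forall>i\<in>{1..dyadic_size r}. \<forall>j\<in>{1..dyadic_size r}. dyadic_matrix \<kappa> r i j =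
      kernel_ext \<kappa> (knot (dyadic_size r) (dyadic_state r) j) (dyadic_state r i) -
      kernel_ext \<kappa> (knot (dyadic_size r) (dyadic_state r) (j - 1)) (dyadic_state r i)"
    by (simp add: dyadic_matrix_def)
  show "\<forall>x\<in>Omega. \<forall>u\<in>Omega.
      (\<lambda>r. trunc_kernel (dyadic_size r) (dyadic_state r) (dyadic_matrix \<kappa> r) x u) \<longlonglongrightarrow> \<kappa> x u"
  proof (intro ballI)
    fix x u :: real assume x: "x \<in> Omega" and u: "u \<in> Omega"
    define X where "X r = of_int \<lfloor>2 ^ r * x\<rfloor> / (2::real) ^ r" for r :: nat
    define U where "U r = of_int \<lceil>2 ^ r * u\<rceil> / (2::real) ^ r" for r :: nat
    have Xb: "X r \<le> x" "x \<le> X r + 1 / 2 ^ r" for r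
    proof -
      have "of_int \<lfloor>2 ^ r * x\<rfloor> \<le> 2 ^ r * x" "2 ^ r * x \<le> of_int \<lfloor>2 ^ r * x\<rfloor> + 1" by linarith+
      then show "X r \<le> x" "x \<le> X r + 1 / 2 ^ r"
        by (simp_all add: X_def divide_le_eq le_divide_eq mult.commute add_divide_distrib[symmetric])
    qed
    have Ub: "u \<le> U r" "U r \<le> u + 1 / 2 ^ r" for r
    proof -
      have "2 ^ r * u \<le> of_int \<lceil>2 ^ r * u\<rceil>" "of_int \<lceil>2 ^ r * u\<rceil> \<le> 2 ^ r * u + 1" by linarith+
      moreover have "u + 1 / 2 ^ r = (2 ^ r * u + 1) / 2 ^ r" by (simp add: field_simps)
      ultimately show "u \<le> U r" "U r \<le> u + 1 / 2 ^ r"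
        by (simp_all add: U_def divide_le_eq le_divide_eq mult.commute divide_right_mono)
    qed
    have X0: "0 \<le> X r" for r using x by (simp add: X_def)
    have U1: "U r \<le> 1" for r
    proof -
      have "2 ^ r * u \<le> of_int (2 ^ r)" using u by (simp add: mult_left_le)
      then have "\<lceil>2 ^ r * u\<rceil> \<le> 2 ^ r" by (simp only: ceiling_le_iff)
      then have "of_int \<lceil>2 ^ r * u\<rceil> \<le> (of_int (2 ^ r) :: real)" by (simp only: of_int_le_iff)
      then show ?thesis by (simp add: U_def)
    qed
    have XO: "X r \<in> Omega" for r using X0[of r] Xb(1)[of r] x by auto
    have UO: "U r \<in> Omega" for r using U1[of r] Ub(1)[of r] u by auto
    have "U \<longlonglongrightarrow> u"
      by (rule tendsto_sandwich[of "\<lambda>_. u" _ _ "\<lambda>r. u + 1 / 2 ^ r"])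
        (use Ub tendsto_add[OF tendsto_const inv[of 1], of u] in auto)
    then have 1: "(\<lambda>r. \<kappa> x (U r)) \<longlonglongrightarrow> \<kappa> x u"
      by (rule continuous_on_tendsto_compose[OF cont[OF x]]) (use u UO in auto)
    \<comment> \<open>The Lipschitz bound in the first argument is uniform in the second, so the
      moving \<open>U r\<close> does no harm here; the rest is continuity at
      \<open>u\<close>.\<close>
    have "(\<lambda>r. \<kappa> (X r) (U r) - \<kappa> x (U r)) \<longlonglongrightarrow> 0"
    proof (rule Lim_null_comparison[OF always_eventually inv[of "2 * C"]], intro allI)
      fix r
      have "\<bar>\<kappa> (X r) (U r) - \<kappa> x (U r)\<bar> \<le> 2 * C * \<bar>X r - x\<bar>"
        by (rule lipschitz_kernel_pointwise[OF lip XO x UO])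
      also have "\<dots> \<le> 2 * C * (1 / 2 ^ r)"
        using Xb(1)[of r] Xb(2)[of r] C by (intro mult_left_mono) auto
      finally show "norm (\<kappa> (X r) (U r) - \<kappa> x (U r)) \<le> 2 * C / 2 ^ r" by simp
    qed
    from tendsto_add[OF this 1] have "(\<lambda>r. \<kappa> (X r) (U r)) \<longlonglongrightarrow> \<kappa> x u" by simp
    then show "(\<lambda>r. trunc_kernel (dyadic_size r) (dyadic_state r) (dyadic_matrix \<kappa> r) x u) \<longlonglongrightarrow> \<kappa> x u"
      unfolding trunc_kernel_dyadic[OF x u] X_def U_def .
  qed
qed

section \<open>Distribution functions with bounded second derivative\<close>

text \<open>A difference version of \<open>0 \<le> F' \<le> a\<close> and \<open>F'' \<ge> - b\<close> on \<open>{..c}\<close> that tolerates an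
  upward jump of the derivative (at \<open>0\<close>, for the distribution function of a nonnegative variable)
  and is stable under averaging over translates.\<close>

definition smooth_df :: "real \<Rightarrow> real \<Rightarrow> real \<Rightarrow> (real \<Rightarrow> real) \<Rightarrow> bool" where
  "smooth_df a b c F \<longleftrightarrow>
     (\<forall>x y. x \<le> y \<longrightarrow> y \<le> c \<longrightarrow> F x \<le> F y \<and> F y - F x \<le> a * (y - x)) \<and>
     (\<forall>d x y. 0 \<le> d \<longrightarrow> x \<le> y \<longrightarrow> y \<le> c \<longrightarrow> - (b * d) * (y - x) \<le> (F y - F (y - d)) - (F x - F (x - d))) \<and>
     (\<forall>x\<le>c. 0 \<le> F x \<and> F x \<le> 1)"

lemma smooth_dfD:
  assumes "smooth_df a b c F"
  shows "x \<le> y \<Longrightarrow> y \<le> c \<Longrightarrow> F x \<le> F y"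
    and "x \<le> y \<Longrightarrow> y \<le> c \<Longrightarrow> F y - F x \<le> a * (y - x)"
    and "0 \<le> d \<Longrightarrow> x \<le> y \<Longrightarrow> y \<le> c \<Longrightarrow> - (b * d) * (y - x) \<le> (F y - F (y - d)) - (F x - F (x - d))"
    and "x \<le> c \<Longrightarrow> 0 \<le> F x" "x \<le> c \<Longrightarrow> F x \<le> 1"
  using assms unfolding smooth_df_def by blast+

lemma smooth_df_nonneg: "smooth_df a b c F \<Longrightarrow> 0 \<le> a"
  using smooth_dfD(1)[of a b c F "c - 1" c] smooth_dfD(2)[of a b c F "c - 1" c] by simp

lemma smooth_df_continuous:
  assumes F: "smooth_df a b c F"
  shows "continuous_on {..c} F"
proof (rule lipschitz_on_continuous_on[of a])
  show "a-lipschitz_on {..c} F"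
  proof (rule lipschitz_onI)
    fix x y assume "x \<in> {..c}" "y \<in> {..c}"
    then show "dist (F x) (F y) \<le> a * dist x y"
      using smooth_dfD(1,2)[OF F, of x y] smooth_dfD(1,2)[OF F, of y x]
      by (cases "x \<le> y") (auto simp: dist_real_def abs_minus_commute)
  qed (rule smooth_df_nonneg[OF F])
qed

text \<open>\<open>W u\<close> is \<open>F z - F (z - d)\<close> with \<open>z = min u c - x\<close>
  and \<open>d = y - x\<close>. The second-difference condition makes it increasing up to a slope
  \<open>b * d\<close>, and its range is at most \<open>a * d\<close>; the bound for almost
  increasing functions then gives \<open>a * d + 2 * b * d\<close>.\<close>

lemma smooth_df_window:
  assumes F: "smooth_df a b c F" and b: "0 \<le> b" and x: "0 \<le> x" "x \<le> y"
  defines "W \<equiv> \<lambda>u. F (min u c - x) - F (min u c - y)"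
  shows "total_variation W \<le> ereal ((a + 2 * b) * (y - x))" "0 \<le> W u" "W u \<le> a * (y - x)"
proof -
  have W0: "0 \<le> W u" and W1: "W u \<le> a * (y - x)" for u
    using smooth_dfD(1,2)[OF F, of "min u c - y" "min u c - x"] x by (auto simp: W_def)
  show "0 \<le> W u" "W u \<le> a * (y - x)" by (rule W0 W1)+
  have "- (b * (y - x)) * (v - u) \<le> W v - W u" if "u \<le> v" for u v
  proof -
    have "- (b * (y - x)) * ((min v c - x) - (min u c - x)) \<le> W v - W u"
      using smooth_dfD(3)[OF F, of "y - x" "min u c - x" "min v c - x"] x that by (simp add: W_def)
    moreover have "(b * (y - x)) * ((min v c - x) - (min u c - x)) \<le> (b * (y - x)) * (v - u)"
      using b x that by (intro mult_left_mono) auto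
    ultimately show ?thesis by simp
  qed
  then have "total_variation W \<le> ereal (W 1 - W 0 + 2 * (b * (y - x)))"
    using b x by (intro total_variation_almost_mono) auto
  also have "\<dots> \<le> ereal ((a + 2 * b) * (y - x))"
    using W1[of 1] W0[of 0] by (simp add: algebra_simps)
  finally show "total_variation W \<le> ereal ((a + 2 * b) * (y - x))" .
qed

lemma total_variation_const_diff: "total_variation (\<lambda>u. c - f u) = total_variation f"
  unfolding total_variation_def by (simp add: abs_minus_commute)

lemma smooth_df_tail:
  assumes F: "smooth_df a b c F" and x: "0 \<le> x"
  shows "total_variation (\<lambda>u. 1 - F (min u c - x)) \<le> ereal 1"
    "\<bar>1 - F (min u c - x)\<bar> \<le> 1" "continuous_on A (\<lambda>u. 1 - F (min u c - x))"
proof -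
  have F01: "0 \<le> F (min u c - x)" "F (min u c - x) \<le> 1" for u
    using smooth_dfD(4,5)[OF F, of "min u c - x"] x by auto
  show "\<bar>1 - F (min u c - x)\<bar> \<le> 1" using F01[of u] by auto
  have "total_variation (\<lambda>u. F (min u c - x)) \<le> ereal (F (min 1 c - x) - F (min 0 c - x))"
    by (rule total_variation_mono) (rule smooth_dfD(1)[OF F], use x in auto)
  also have "\<dots> \<le> ereal 1" using F01[of 1] F01[of 0] by simp
  finally show "total_variation (\<lambda>u. 1 - F (min u c - x)) \<le> ereal 1"
    by (simp add: total_variation_const_diff)
  show "continuous_on A (\<lambda>u. 1 - F (min u c - x))"
    by (intro continuous_intros continuous_on_compose2[OF smooth_df_continuous[OF F]]) (use x in auto)
qed

text \<open>The queue kernel has this form with \<open>c' = 1\<close> and with \<open>c\<close> the bound on the patience time: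
  truncating \<open>u\<close> at \<open>c\<close> is harmless because \<open>G u = 1\<close> beyond it.\<close>

lemma
  assumes F: "smooth_df a b c F" and H: "smooth_df a b c' H" and b: "0 \<le> b"
    and G: "mono G" "\<And>u. 0 \<le> G u" "\<And>u. G u \<le> 1"
    and \<kappa>: "\<And>x u. x \<in> Omega \<Longrightarrow> u \<in> Omega \<Longrightarrow>
      \<kappa> x u = (1 - G u) * (1 - F (min u c - x)) + G u * (1 - H (min u c' - x))"
  shows mixture_kernel_lipschitz: "lipschitz_kernel (4 * a + 4 * b) \<kappa>"
    and mixture_kernel_variation: "x \<in> Omega \<Longrightarrow> total_variation (\<kappa> x) \<le> ereal 4"
    and mixture_kernel_continuous: "continuous_on Omega G \<Longrightarrow> x \<in> Omega \<Longrightarrow> continuous_on Omega (\<kappa> x)"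
proof -
  have a: "0 \<le> a" by (rule smooth_df_nonneg[OF F])
  have "total_variation G \<le> ereal (G 1 - G 0)"
    by (rule total_variation_mono) (use G(1) in \<open>auto simp: mono_def\<close>)
  also have "\<dots> \<le> ereal 1" using G(2)[of 0] G(3)[of 1] by simp
  finally have TG: "total_variation G \<le> ereal 1" "total_variation (\<lambda>u. 1 - G u) \<le> ereal 1"
    by (simp_all add: total_variation_const_diff)
  have BG: "\<bar>G u\<bar> \<le> 1" "\<bar>1 - G u\<bar> \<le> 1" for u using G(2)[of u] G(3)[of u] by auto
  show "total_variation (\<kappa> x) \<le> ereal 4" if x: "x \<in> Omega"
  proof -
    have "total_variation (\<lambda>u. (1 - G u) * (1 - F (min u c - x)) + G u * (1 - H (min u c' - x)))
      \<le> ereal ((1 * 1 + 1 * 1) + (1 * 1 + 1 * 1))"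
      using x by (intro total_variation_add total_variation_mult TG BG smooth_df_tail[OF F] smooth_df_tail[OF H]) auto
    moreover have "total_variation (\<kappa> x) = total_variation (\<lambda>u. (1 - G u) * (1 - F (min u c - x)) + G u * (1 - H (min u c' - x)))"
      by (rule total_variation_cong) (rule \<kappa>[OF x])
    ultimately show ?thesis by simp
  qed
  show "continuous_on Omega (\<kappa> x)" if "continuous_on Omega G" and x: "x \<in> Omega"
  proof -
    have "continuous_on Omega (\<lambda>u. (1 - G u) * (1 - F (min u c - x)) + G u * (1 - H (min u c' - x)))"
      using that by (intro continuous_intros smooth_df_tail(3)[OF F] smooth_df_tail(3)[OF H]) auto
    then show ?thesis by (rule continuous_on_eq) (simp add: \<kappa>[OF x])
  qed
  have "zeta \<kappa> x y \<le> (4 * a + 4 * b) * (y - x) \<and> vdist \<kappa> x y \<le> ereal ((4 * a + 4 * b) * (y - x))"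
    if x: "x \<in> Omega" and y: "y \<in> Omega" and xy: "x \<le> y" for x y
  proof
    define W where "W u = F (min u c - x) - F (min u c - y)" for u
    define W' where "W' u = H (min u c' - x) - H (min u c' - y)" for u
    have x0: "0 \<le> x" using x by simp
    note w = smooth_df_window[OF F b x0 xy, folded W_def] smooth_df_window[OF H b x0 xy, folded W'_def]
    have diff: "\<kappa> y u - \<kappa> x u = (1 - G u) * W u + G u * W' u" if "u \<in> Omega" for u
      unfolding \<kappa>[OF x that] \<kappa>[OF y that] W_def W'_def by (simp add: algebra_simps)
    have Wa: "\<bar>W u\<bar> \<le> a * (y - x)" "\<bar>W' u\<bar> \<le> a * (y - x)" for u
      using w(2,3)[of u] w(5,6)[of u] by auto
    \<comment> \<open>With \<open>d = y - x\<close>, each product contributes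
      \<open>(a + 2 * b) * d\<close> from the variation of its window and \<open>a * d\<close> from
      the size of the window; two products give \<open>4 * a + 4 * b\<close>.\<close>
    have "total_variation (\<lambda>u. (1 - G u) * W u + G u * W' u)
      \<le> ereal ((1 * ((a + 2 * b) * (y - x)) + (a * (y - x)) * 1) + (1 * ((a + 2 * b) * (y - x)) + (a * (y - x)) * 1))"
      by (intro total_variation_add total_variation_mult TG BG w(1,4) Wa)
    moreover have "vdist \<kappa> x y = total_variation (\<lambda>u. (1 - G u) * W u + G u * W' u)"
      unfolding vdist_def by (rule total_variation_cong) (rule diff)
    ultimately show "vdist \<kappa> x y \<le> ereal ((4 * a + 4 * b) * (y - x))"
      by (simp add: algebra_simps)
    have "\<bar>(1 - G 1) * W 1 + G 1 * W' 1\<bar> \<le> 1 * (a * (y - x)) + 1 * (a * (y - x))"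
      by (rule order_trans[OF abs_triangle_ineq], unfold abs_mult, intro add_mono mult_mono BG Wa) auto
    then have "zeta \<kappa> x y \<le> (2 * a) * (y - x)"
      unfolding zeta_def diff[of 1, simplified] by simp
    also have "\<dots> \<le> (4 * a + 4 * b) * (y - x)" using a b xy by (intro mult_right_mono) auto
    finally show "zeta \<kappa> x y \<le> (4 * a + 4 * b) * (y - x)" .
  qed
  note le = this
  have sym: "zeta \<kappa> x y = zeta \<kappa> y x" "vdist \<kappa> x y = vdist \<kappa> y x" for x y
  proof -
    show "zeta \<kappa> x y = zeta \<kappa> y x" by (simp add: zeta_def abs_minus_commute)
    have "vdist \<kappa> x y = total_variation (\<lambda>u. - (\<kappa> x u - \<kappa> y u))" by (simp add: vdist_def)
    then show "vdist \<kappa> x y = vdist \<kappa> y x" unfolding total_variation_uminus by (simp add: vdist_def)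
  qed
  show "lipschitz_kernel (4 * a + 4 * b) \<kappa>"
    unfolding lipschitz_kernel_def
  proof (intro conjI ballI)
    fix x y assume xy: "x \<in> Omega" "y \<in> Omega"
    have "zeta \<kappa> x y \<le> (4 * a + 4 * b) * \<bar>x - y\<bar> \<and> vdist \<kappa> x y \<le> ereal ((4 * a + 4 * b) * \<bar>x - y\<bar>)"
      using le[OF xy] le[OF xy(2) xy(1)] sym[of x y] by (cases "x \<le> y") (auto simp: abs_real_def)
    then show "zeta \<kappa> x y \<le> (4 * a + 4 * b) * \<bar>x - y\<bar>" "vdist \<kappa> x y \<le> ereal ((4 * a + 4 * b) * \<bar>x - y\<bar>)"
      by auto
  qed (use a b in simp)
qed

text \<open>The derivative can jump at 0 only upwards, from 0 to \<open>A' 0 \<ge> 0\<close>, which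
  is harmless because second differences are bounded from below only.\<close>

lemma smooth_df_differentiable:
  assumes mono: "mono A" and neg: "\<And>x. x \<le> 0 \<Longrightarrow> A x = 0" and le1: "\<And>x. A x \<le> 1"
    and a2: "0 \<le> a2"
    and A': "\<And>x. x \<in> Omega \<Longrightarrow> (A has_real_derivative A' x) (at x within Omega)" "\<And>x. x \<in> Omega \<Longrightarrow> A' x \<le> a1"
    and A'': "\<And>x. x \<in> Omega \<Longrightarrow> (A' has_real_derivative A'' x) (at x within Omega)" "\<And>x. x \<in> Omega \<Longrightarrow> \<bar>A'' x\<bar> \<le> a2"
  shows "smooth_df a1 a2 1 A"
proof -
  have cA: "continuous_on Omega A" and cA': "continuous_on Omega A'"
    by (rule DERIV_continuous_on[OF A'(1)], assumption, rule DERIV_continuous_on[OF A''(1)])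
  have dA: "(A has_real_derivative A' x) (at x)" and dA': "(A' has_real_derivative A'' x) (at x)"
    if "0 < x" "x < 1" for x
    using A'(1)[of x] A''(1)[of x] that by (simp_all add: at_within_Icc_at)
  have m: "A x \<le> A y" if "x \<le> y" for x y using mono that by (simp add: mono_def)
  have lipO: "A y - A x \<le> a1 * (y - x)" if "0 \<le> x" "x \<le> y" "y \<le> 1" for x y
  proof -
    have "a1 * x - A x \<le> a1 * y - A y"
    proof (rule DERIV_nonneg_imp_increasing_open[OF that(2)])
      fix z assume "x < z" "z < y"
      then have z: "0 < z" "z < 1" using that by auto
      have "((\<lambda>z. a1 * z - A z) has_real_derivative a1 - A' z) (at z)"
        by (auto intro!: derivative_eq_intros dA[OF z])
      then show "\<exists>D. ((\<lambda>z. a1 * z - A z) has_real_derivative D) (at z) \<and> 0 \<le> D"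
        using A'(2)[of z] z by auto
    qed (use that in \<open>intro continuous_intros continuous_on_subset[OF cA]; auto\<close>)
    then show ?thesis by (simp add: algebra_simps)
  qed
  have a1: "0 \<le> a1" using lipO[of 0 1] m[of 0 1] by simp
  have pos: "A x = A (max x 0)" for x using neg[of x] neg[of 0] by (cases "x \<le> 0") (auto simp: max_def)
  have lip: "A y - A x \<le> a1 * (y - x)" if "x \<le> y" "y \<le> 1" for x y
  proof -
    have "A y - A x \<le> a1 * (max y 0 - max x 0)"
      unfolding pos[of x] pos[of y] using that by (intro lipO) auto
    also have "\<dots> \<le> a1 * (y - x)" using a1 that by (intro mult_left_mono) auto
    finally show ?thesis .
  qed
  have lipA': "A' x - A' y \<le> a2 * (y - x)" if "0 \<le> x" "x \<le> y" "y \<le> 1" for x y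
  proof -
    have "a2 * x + A' x \<le> a2 * y + A' y"
    proof (rule DERIV_nonneg_imp_increasing_open[OF that(2)])
      fix z assume "x < z" "z < y"
      then have z: "0 < z" "z < 1" using that by auto
      have "((\<lambda>z. a2 * z + A' z) has_real_derivative a2 + A'' z) (at z)"
        by (auto intro!: derivative_eq_intros dA'[OF z])
      then show "\<exists>D. ((\<lambda>z. a2 * z + A' z) has_real_derivative D) (at z) \<and> 0 \<le> D"
        using A''(2)[of z] z by (auto simp: abs_le_iff)
    qed (use that in \<open>intro continuous_intros continuous_on_subset[OF cA']; auto\<close>)
    then show ?thesis by (simp add: algebra_simps)
  qed
  have second: "- (a2 * d) * (y - x) \<le> (A y - A (y - d)) - (A x - A (x - d))"
    if d: "0 \<le> d" and xy: "x \<le> y" "y \<le> 1" for d x y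
  proof -
    \<comment> \<open>Monotonicity of \<open>\<psi>\<close> is the claim. Up to \<open>d\<close> the
      shifted term vanishes and \<open>A\<close> itself increases; beyond \<open>d\<close> the
      derivative \<open>A' z - A' (z - d) + a2 * d\<close> is nonnegative by the bound on
      \<open>A''\<close>.\<close>
    define \<psi> where "\<psi> z = A z - A (z - d) + a2 * d * z" for z
    have ad: "0 \<le> a2 * d" using a2 d by simp
    have 1: "\<psi> x \<le> \<psi> y" if "x \<le> y" "y \<le> 0" for x y
      using that d neg[of x] neg[of y] neg[of "x - d"] neg[of "y - d"] mult_left_mono[OF that(1) ad] by (simp add: \<psi>_def)
    have 2: "\<psi> x \<le> \<psi> y" if "x \<le> y" "y \<le> d" for x y
      using that neg[of "x - d"] neg[of "y - d"] m[OF that(1)] mult_left_mono[OF that(1) ad] by (simp add: \<psi>_def)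
    have 3: "\<psi> x \<le> \<psi> y" if xy: "d \<le> x" "x \<le> y" "y \<le> 1" for x y
    proof (rule DERIV_nonneg_imp_increasing_open[OF xy(2)])
      fix z assume z: "x < z" "z < y"
      have z1: "0 < z" "z < 1" "0 < z - d" "z - d < 1" using z xy d by auto
      have "(A has_real_derivative A' (z - d)) (at (z - d))" by (rule dA[OF z1(3,4)])
      then have "((\<lambda>z. A (z - d)) has_real_derivative A' (z - d)) (at z)"
        using DERIV_shift[of A "A' (z - d)" z "- d"] by simp
      then have "(\<psi> has_real_derivative A' z - A' (z - d) + a2 * d) (at z)"
        unfolding \<psi>_def[abs_def] by (auto intro!: derivative_eq_intros dA[OF z1(1,2)])
      moreover have "A' (z - d) - A' z \<le> a2 * d" using lipA'[of "z - d" z] z1 d by simp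
      ultimately show "\<exists>D. (\<psi> has_real_derivative D) (at z) \<and> 0 \<le> D" by force
    next
      show "continuous_on {x..y} \<psi>"
        unfolding \<psi>_def using xy d
        by (intro continuous_intros continuous_on_subset[OF cA] continuous_on_compose2[OF cA]) auto
    qed
    have "\<psi> x \<le> \<psi> y"
    proof (cases "y \<le> d")
      case True
      then show ?thesis using 2 xy by blast
    next
      case False
      have "\<psi> x \<le> \<psi> (max x d)" by (cases "x \<le> d") (auto intro: 2)
      also have "\<dots> \<le> \<psi> y" using False xy by (intro 3) auto
      finally show ?thesis .
    qed
    then show ?thesis by (simp add: \<psi>_def algebra_simps)
  qed
  show ?thesis
    unfolding smooth_df_def
    using m lip second le1 m neg by (metis linear order_refl)
qed

section \<open>The virtual waiting time\<close>

lemma sets_half_plane: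
  "{p::real \<times> real. fst p - snd p \<le> c} \<in> sets (borel \<Otimes>\<^sub>M borel)"
  "{p::real \<times> real. c \<le> snd p} \<in> sets (borel \<Otimes>\<^sub>M borel)"
proof -
  have "{p \<in> space (borel \<Otimes>\<^sub>M borel). fst p - snd p \<le> c} \<in> sets (borel \<Otimes>\<^sub>M (borel :: real measure))"
    "{p \<in> space (borel \<Otimes>\<^sub>M borel). c \<le> snd p} \<in> sets ((borel :: real measure) \<Otimes>\<^sub>M borel)"
    by measurable
  then show "{p::real \<times> real. fst p - snd p \<le> c} \<in> sets (borel \<Otimes>\<^sub>M borel)"
    "{p::real \<times> real. c \<le> snd p} \<in> sets (borel \<Otimes>\<^sub>M borel)"
    by (simp_all add: space_pair_measure)
qed

lemma (in prob_space) cdf_distr_eq: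
  assumes [measurable]: "X \<in> borel_measurable M"
  shows "cdf (distr M borel X) x = prob {\<omega> \<in> space M. X \<omega> \<le> x}"
  unfolding cdf_def by (subst measure_distr) (auto intro!: arg_cong[where f=prob])

text \<open>One arrival in isolation, with \<open>t\<close> the time to the next one. Independence
  of \<open>y\<close> from the pair of \<open>s\<close> and \<open>t\<close> is kept as a product
  formula for events, the form in which the kernel is computed.\<close>

locale abandonment_queue = prob_space +
  fixes t s y :: "'a \<Rightarrow> real" and A G D :: "real \<Rightarrow> real" and ybar sbar a1 a2 :: real
  assumes rv_y [measurable]: "y \<in> borel_measurable M"
    and indep_y: "S \<in> sets borel \<Longrightarrow> T \<in> sets (borel \<Otimes>\<^sub>M borel) \<Longrightarrow>
      prob {\<omega> \<in> space M. y \<omega> \<in> S \<and> (s \<omega>, t \<omega>) \<in> T}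
      = prob {\<omega> \<in> space M. y \<omega> \<in> S} * prob {\<omega> \<in> space M. (s \<omega>, t \<omega>) \<in> T}"
    and indep_st: "indep_var borel s borel t"
    and cdf_t: "cdf (distr M borel t) = A"
    and cdf_y: "cdf (distr M borel y) = G"
    and cdf_diff: "cdf (distr M borel (\<lambda>\<omega>. s \<omega> - t \<omega>)) = D"
    and nonneg: "AE \<omega> in M. 0 \<le> t \<omega> \<and> 0 \<le> s \<omega> \<and> 0 \<le> y \<omega>"
    and bounded: "AE \<omega> in M. s \<omega> \<le> sbar \<and> y \<omega> \<le> ybar" "0 \<le> ybar" "0 \<le> sbar" "ybar + sbar \<le> 1"
    and A_smooth: "smooth_df a1 a2 1 A" "0 \<le> a2"
    and G_continuous: "continuous_on Omega G"
    and negative_drift: "0 < prob {\<omega> \<in> space M. s \<omega> - t \<omega> < 0}"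
begin

lemma rv_t [measurable]: "t \<in> borel_measurable M" and rv_s [measurable]: "s \<in> borel_measurable M"
  using indep_var_rv1[OF indep_st] indep_var_rv2[OF indep_st] by simp_all

lemma A_eq: "A x = prob {\<omega> \<in> space M. t \<omega> \<le> x}" and G_eq: "G x = prob {\<omega> \<in> space M. y \<omega> \<le> x}"
  and D_eq: "D x = prob {\<omega> \<in> space M. s \<omega> - t \<omega> \<le> x}"
  unfolding cdf_t[symmetric] cdf_y[symmetric] cdf_diff[symmetric] by (auto intro!: cdf_distr_eq)

lemma mono_A: "mono A" and mono_G: "mono G"
  unfolding mono_def A_eq G_eq by (auto intro!: finite_measure_mono)

lemma left_tail_eq_prob: "left_tail A c = prob {\<omega> \<in> space M. c \<le> t \<omega>}"
proof -
  interpret T: prob_space "distr M borel t" by (rule prob_space_distr) simp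
  have "finite_borel_measure (distr M borel t)" by unfold_locales simp
  then have "(A \<longlongrightarrow> measure (distr M borel t) {..<c}) (at_left c)"
    unfolding cdf_t[symmetric] by (rule finite_borel_measure.cdf_at_left)
  then have "Lim (at_left c) A = measure (distr M borel t) {..<c}"
    by (intro tendsto_Lim) auto
  also have "\<dots> = prob {\<omega> \<in> space M. t \<omega> < c}"
    by (subst measure_distr) (auto intro!: arg_cong[where f=prob])
  also have "\<dots> = 1 - prob {\<omega> \<in> space M. \<not> t \<omega> < c}"
    by (subst prob_neg) auto
  finally show ?thesis by (simp add: left_tail_def not_less)
qed

lemma left_tail_measurable [measurable]: "left_tail A \<in> borel_measurable borel"
proof -
  have "mono (\<lambda>x. - left_tail A x)"
    unfolding mono_def left_tail_eq_prob by (auto intro!: finite_measure_mono)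
  then have "(\<lambda>x. - (- left_tail A x)) \<in> borel_measurable borel"
    by (intro borel_measurable_uminus borel_measurable_mono)
  then show ?thesis by simp
qed

lemma left_tail_eq:
  assumes "c \<le> 1" shows "left_tail A c = 1 - A c"
proof -
  have "(A \<longlongrightarrow> A c) (at c within {..1})"
    using smooth_df_continuous[OF A_smooth(1)] assms by (auto simp: continuous_on_def)
  then have "(A \<longlongrightarrow> A c) (at_left c)"
    by (rule tendsto_within_subset) (use assms in auto)
  then have "Lim (at_left c) A = A c" by (intro tendsto_Lim) auto
  then show ?thesis by (simp add: left_tail_def)
qed

text \<open>A customer who stays has \<open>u < y \<le> ybar\<close>, so the next wait is at most
  \<open>ybar + sbar \<le> 1\<close>; otherwise the wait can only fall.\<close>

lemma wait_step_in_Omega: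
  assumes "u \<in> Omega" shows "AE \<omega> in M. wait_step u (s \<omega>) (t \<omega>) (y \<omega>) \<in> Omega"
  using nonneg bounded(1)
proof eventually_elim
  case (elim \<omega>)
  then show ?case using assms bounded(2-4) by (auto simp: wait_step_def)
qed

text \<open>Splitting by patience separates \<open>y\<close> from \<open>s\<close> and
  \<open>t\<close>. For \<open>x \<ge> 0\<close> the truncation at 0 does not change whether the
  next wait is at most \<open>x\<close>.\<close>

lemma prob_wait_step:
  assumes "0 \<le> x"
  shows "prob {\<omega> \<in> space M. wait_step u (s \<omega>) (t \<omega>) (y \<omega>) \<le> x} = queue_kernel G D A x u"
proof -
  have split: "{\<omega> \<in> space M. wait_step u (s \<omega>) (t \<omega>) (y \<omega>) \<le> x}
    = {\<omega> \<in> space M. u < y \<omega> \<and> s \<omega> - t \<omega> \<le> x - u} \<union> {\<omega> \<in> space M. y \<omega> \<le> u \<and> u - x \<le> t \<omega>}"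
    using assms by (auto simp: wait_step_def)
  have "prob {\<omega> \<in> space M. u < y \<omega> \<and> s \<omega> - t \<omega> \<le> x - u} = prob {\<omega> \<in> space M. u < y \<omega>} * D (x - u)"
    using indep_y[of "{u<..}" "{p. fst p - snd p \<le> x - u}"] by (simp add: D_eq sets_half_plane)
  moreover have "prob {\<omega> \<in> space M. u < y \<omega>} = 1 - G u"
    unfolding G_eq by (subst prob_neg[symmetric]) (auto simp: not_le)
  moreover have "prob {\<omega> \<in> space M. y \<omega> \<le> u \<and> u - x \<le> t \<omega>} = G u * left_tail A (u - x)"
    using indep_y[of "{..u}" "{p. u - x \<le> snd p}"] by (simp add: sets_half_plane G_eq left_tail_eq_prob)
  ultimately show ?thesis
    unfolding split queue_kernel_def by (subst finite_measure_Union) auto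
qed

text \<open>This is the probability of \<open>t \<le> s + c\<close>. Smoothness is assumed for
  \<open>A\<close> and not for \<open>D\<close>, so \<open>D\<close> is expressed through averages
  of translates of \<open>A\<close>.\<close>

definition mean_A :: "real \<Rightarrow> real" where
  "mean_A c = (LINT \<omega>|M. A (s \<omega> + c))"

lemma A_measurable [measurable]: "A \<in> borel_measurable borel"
  by (rule borel_measurable_mono[OF mono_A])

lemma integrable_A: "integrable M (\<lambda>\<omega>. A (s \<omega> + c))"
  by (rule integrable_const_bound[of _ 1]) (auto simp: A_eq)

text \<open>Fubini fixes the service time first. The bound on \<open>c\<close> gives
  \<open>s + c \<le> 1\<close> almost surely, where \<open>A\<close> is continuous and its left tail
  is \<open>1 - A\<close>.\<close>

lemma D_eq_mean:
  assumes "c \<le> ybar" shows "D (- c) = 1 - mean_A c"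
proof -
  interpret S: prob_space "distr M borel s" by (rule prob_space_distr) simp
  interpret T: prob_space "distr M borel t" by (rule prob_space_distr) simp
  interpret ST: pair_prob_space "distr M borel s" "distr M borel t" ..
  let ?P = "distr M borel s \<Otimes>\<^sub>M distr M borel t"
  let ?B = "{p::real \<times> real. fst p - snd p \<le> - c}"
  have B [measurable]: "?B \<in> sets (borel \<Otimes>\<^sub>M borel)" by (rule sets_half_plane)
  have joint: "?P = distr M (borel \<Otimes>\<^sub>M borel) (\<lambda>\<omega>. (s \<omega>, t \<omega>))"
    using indep_st by (simp add: indep_var_distribution_eq)
  have "D (- c) = measure ?P ?B"
    unfolding joint D_eq by (subst measure_distr) (auto intro!: arg_cong[where f=prob])
  also have "\<dots> = (LINT p|?P. indicator ?B p)"
    by (simp add: space_pair_measure)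
  also have "\<dots> = (LINT \<sigma>|distr M borel s. LINT \<tau>|distr M borel t. indicator ?B (\<sigma>, \<tau>))"
    by (rule ST.integral_fst'[symmetric]) (rule ST.P.integrable_const_bound[of _ 1], auto)
  also have "\<dots> = (LINT \<sigma>|distr M borel s. left_tail A (\<sigma> + c))"
  proof (rule Bochner_Integration.integral_cong[OF refl])
    fix \<sigma>
    have "(LINT \<tau>|distr M borel t. indicator ?B (\<sigma>, \<tau>)) = (LINT \<tau>|distr M borel t. indicator {\<sigma> + c..} \<tau>)"
      by (rule Bochner_Integration.integral_cong) (auto simp: indicator_def)
    also have "\<dots> = prob {\<omega> \<in> space M. \<sigma> + c \<le> t \<omega>}"
      by (simp add: measure_distr) (auto intro!: arg_cong[where f=prob])
    finally show "(LINT \<tau>|distr M borel t. indicator ?B (\<sigma>, \<tau>)) = left_tail A (\<sigma> + c)"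
      by (simp add: left_tail_eq_prob)
  qed
  also have "\<dots> = (LINT \<omega>|M. left_tail A (s \<omega> + c))"
  proof (rule integral_distr)
    show "(\<lambda>\<sigma>. left_tail A (\<sigma> + c)) \<in> borel_measurable borel" by measurable
  qed simp
  also have "\<dots> = (LINT \<omega>|M. 1 - A (s \<omega> + c))"
  proof (rule integral_cong_AE)
    show "(\<lambda>\<omega>. left_tail A (s \<omega> + c)) \<in> borel_measurable M" by measurable
    show "AE \<omega> in M. left_tail A (s \<omega> + c) = 1 - A (s \<omega> + c)"
      using bounded(1) by eventually_elim (use assms bounded(4) in \<open>auto intro!: left_tail_eq\<close>)
  qed measurable
  also have "\<dots> = 1 - mean_A c"
    unfolding mean_A_def using integrable_A by (simp add: prob_space)
  finally show ?thesis .
qed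

text \<open>The conditions are linear inequalities in the function, so they integrate;
  \<open>c' \<le> ybar\<close> keeps \<open>s + c'\<close> at most 1, within reach of the bounds on
  \<open>A\<close>.\<close>

lemma mean_A_smooth: "smooth_df a1 a2 ybar mean_A"
  unfolding smooth_df_def
proof (intro conjI allI impI)
  fix c c' :: real assume c: "c \<le> c'" "c' \<le> ybar"
  show "mean_A c \<le> mean_A c'"
    unfolding mean_A_def using mono_A c by (intro integral_mono integrable_A) (auto simp: mono_def)
  have "mean_A c' - mean_A c = (LINT \<omega>|M. A (s \<omega> + c') - A (s \<omega> + c))"
    unfolding mean_A_def using integrable_A by simp
  also have "\<dots> \<le> a1 * (c' - c)"
  proof (rule integral_le_const)
    show "AE \<omega> in M. A (s \<omega> + c') - A (s \<omega> + c) \<le> a1 * (c' - c)"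
      using bounded(1)
    proof eventually_elim
      case (elim \<omega>)
      then show ?case using smooth_dfD(2)[OF A_smooth(1), of "s \<omega> + c" "s \<omega> + c'"] c bounded(4) by simp
    qed
  qed (intro Bochner_Integration.integrable_diff integrable_A)
  finally show "mean_A c' - mean_A c \<le> a1 * (c' - c)" .
next
  fix d c c' :: real assume d: "0 \<le> d" and c: "c \<le> c'" "c' \<le> ybar"
  have "- (a2 * d) * (c' - c) \<le> (LINT \<omega>|M. (A (s \<omega> + c') - A (s \<omega> + (c' - d))) - (A (s \<omega> + c) - A (s \<omega> + (c - d))))"
  proof (rule integral_ge_const)
    show "AE \<omega> in M. - (a2 * d) * (c' - c) \<le> (A (s \<omega> + c') - A (s \<omega> + (c' - d))) - (A (s \<omega> + c) - A (s \<omega> + (c - d)))"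
      using bounded(1)
    proof eventually_elim
      case (elim \<omega>)
      then show ?case using smooth_dfD(3)[OF A_smooth(1) d, of "s \<omega> + c" "s \<omega> + c'"] c bounded(4)
        by (simp add: add_diff_eq)
    qed
  qed (intro Bochner_Integration.integrable_diff integrable_A)
  also have "\<dots> = (mean_A c' - mean_A (c' - d)) - (mean_A c - mean_A (c - d))"
    unfolding mean_A_def by (simp add: integrable_A)
  finally show "- (a2 * d) * (c' - c) \<le> (mean_A c' - mean_A (c' - d)) - (mean_A c - mean_A (c - d))" .
next
  fix c
  show "0 \<le> mean_A c" "mean_A c \<le> 1"
    unfolding mean_A_def
    by (rule integral_ge_const[OF integrable_A], simp add: A_eq)
      (rule integral_le_const[OF integrable_A], simp add: A_eq)
qed

lemma queue_kernel_eq: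
  assumes "x \<in> Omega" "u \<in> Omega"
  shows "queue_kernel G D A x u = (1 - G u) * (1 - mean_A (min u ybar - x)) + G u * (1 - A (min u 1 - x))"
proof -
  have 1: "left_tail A (u - x) = 1 - A (min u 1 - x)" using assms by (simp add: left_tail_eq min_def)
  have 2: "(1 - G u) * D (x - u) = (1 - G u) * (1 - mean_A (min u ybar - x))"
  proof (cases "u \<le> ybar")
    case True
    then show ?thesis using D_eq_mean[of "u - x"] assms by (simp add: min_def)
  next
    case False
    have "prob {\<omega> \<in> space M. y \<omega> \<le> u} = 1"
      by (subst prob_Collect_eq_1, measurable, rule eventually_mono[OF bounded(1)]) (use False in auto)
    then have "G u = 1" by (simp add: G_eq)
    then show ?thesis by simp
  qed
  show ?thesis unfolding queue_kernel_def 1 2 ..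
qed

lemma queue_kernel_regular:
  shows "lipschitz_kernel (4 * a1 + 4 * a2) (queue_kernel G D A)"
    and "x \<in> Omega \<Longrightarrow> total_variation (queue_kernel G D A x) \<le> ereal 4"
    and "x \<in> Omega \<Longrightarrow> continuous_on Omega (queue_kernel G D A x)"
proof -
  have G: "0 \<le> G u" "G u \<le> 1" for u by (simp_all add: G_eq)
  note k = mean_A_smooth A_smooth mono_G G queue_kernel_eq
  show "lipschitz_kernel (4 * a1 + 4 * a2) (queue_kernel G D A)"
    by (rule mixture_kernel_lipschitz[OF k])
  show "x \<in> Omega \<Longrightarrow> total_variation (queue_kernel G D A x) \<le> ereal 4"
    by (rule mixture_kernel_variation[OF k])
  show "x \<in> Omega \<Longrightarrow> continuous_on Omega (queue_kernel G D A x)"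
    by (rule mixture_kernel_continuous[OF k G_continuous])
qed

section \<open>The conditions for the queue kernel\<close>

lemma uniformly_bounded_variation_queue: "uniformly_bounded_variation (queue_kernel G D A)"
  unfolding uniformly_bounded_variation_def
  using queue_kernel_regular(2) by (intro le_less_trans[OF SUP_least[of Omega _ "ereal 4"]]) auto

lemma finite_markov_chain_queue:
  "finite_markov_chain (dyadic_size r) (dyadic_state r) (dyadic_matrix (queue_kernel G D A) r)"
proof (rule finite_markov_chain_dyadic)
  have [measurable]: "(\<lambda>\<omega>. wait_step u (s \<omega>) (t \<omega>) (y \<omega>)) \<in> borel_measurable M" for u
    unfolding wait_step_def by measurable
  show "queue_kernel G D A x u \<le> queue_kernel G D A z u"
    if "x \<in> Omega" "z \<in> Omega" "u \<in> Omega" "x \<le> z" for x z u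
    using that by (simp add: prob_wait_step[symmetric]) (auto intro!: finite_measure_mono)
  show "0 \<le> queue_kernel G D A 0 u" for u by (simp add: prob_wait_step[symmetric])
  show "queue_kernel G D A 1 u = 1" if "u \<in> Omega" for u
    unfolding prob_wait_step[OF zero_le_one, symmetric]
    by (subst prob_Collect_eq_1) (use wait_step_in_Omega[OF that] in auto)
qed

text \<open>The event \<open>s - t < 0\<close> is the countable union of the events
  \<open>s - t \<le> - (1 / (n + 1))\<close>; if all of these were null, so would be the
  union.\<close>

lemma drift_bound:
  obtains \<delta> where "0 < \<delta>" "0 < prob {\<omega> \<in> space M. s \<omega> - t \<omega> \<le> - \<delta>}"
proof (rule ccontr)
  assume "\<not> thesis"
  then have z: "prob {\<omega> \<in> space M. s \<omega> - t \<omega> \<le> - (1 / real (Suc n))} = 0" for n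
    using that[of "1 / real (Suc n)"] by (auto simp: zero_less_measure_iff)
  have "AE \<omega> in M. \<not> s \<omega> - t \<omega> \<le> - (1 / real (Suc n))" for n
    using z[of n] by (subst (asm) prob_eq_0) auto
  then have "AE \<omega> in M. \<forall>n. \<not> s \<omega> - t \<omega> \<le> - (1 / real (Suc n))"
    by (simp add: AE_all_countable)
  then have "AE \<omega> in M. \<not> s \<omega> - t \<omega> < 0"
  proof eventually_elim
    case (elim \<omega>)
    show ?case
    proof
      assume "s \<omega> - t \<omega> < 0"
      then obtain n where "inverse (real (Suc n)) < t \<omega> - s \<omega>" using reals_Archimedean[of "t \<omega> - s \<omega>"] by auto
      then have "s \<omega> - t \<omega> \<le> - (1 / real (Suc n))" by (simp add: inverse_eq_divide)
      then show False using elim by blast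
    qed
  qed
  then have "prob {\<omega> \<in> space M. s \<omega> - t \<omega> < 0} = 0" by (subst prob_eq_0) auto
  then show False using negative_drift by simp
qed

text \<open>Clamping to the unit interval changes the step only on a null set, and removes all
  almost-everywhere qualifications from the chain.\<close>

lemma unique_stationary_distribution_queue: "unique_stationary_distribution (queue_kernel G D A)"
proof -
  obtain \<delta> where \<delta>: "0 < \<delta>" "0 < prob {\<omega> \<in> space M. s \<omega> - t \<omega> \<le> - \<delta>}" by (rule drift_bound)
  define clamp :: "real \<Rightarrow> real" where "clamp x = max 0 (min 1 x)" for x
  define \<phi> where "\<phi> u \<omega> = clamp (wait_step (clamp u) (s \<omega>) (t \<omega>) (y \<omega>))" for u \<omega>
  have clamp_id: "clamp x = x" if "x \<in> Omega" for x using that by (simp add: clamp_def)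
  have [measurable]: "clamp \<in> borel_measurable borel" unfolding clamp_def[abs_def] by measurable
  have \<phi>_meas: "(\<lambda>(u, \<omega>). \<phi> u \<omega>) \<in> borel_measurable (borel \<Otimes>\<^sub>M M)"
    unfolding \<phi>_def wait_step_def by measurable
  then have [measurable]: "\<phi> u \<in> borel_measurable M" for u
    unfolding \<phi>_def[abs_def] wait_step_def by measurable
  have [measurable]: "(\<lambda>\<omega>. wait_step u (s \<omega>) (t \<omega>) (y \<omega>)) \<in> borel_measurable M" for u
    unfolding wait_step_def by measurable
  have \<phi>_AE: "AE \<omega> in M. \<phi> u \<omega> = wait_step u (s \<omega>) (t \<omega>) (y \<omega>)" if "u \<in> Omega" for u
    using wait_step_in_Omega[OF that] by eventually_elim (simp only: \<phi>_def clamp_id[OF that] clamp_id)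
  have "doeblin_chain M \<phi> (queue_kernel G D A) \<delta> (prob {\<omega> \<in> space M. s \<omega> - t \<omega> \<le> - \<delta>}) (4 * a1 + 4 * a2) 4"
  proof unfold_locales
    show "(\<lambda>(u, \<omega>). \<phi> u \<omega>) \<in> borel_measurable (borel \<Otimes>\<^sub>M M)" by (fact \<phi>_meas)
    show "\<phi> u \<omega> \<in> Omega" for u \<omega> by (simp add: \<phi>_def clamp_def)
    show "queue_kernel G D A x u = prob {\<omega> \<in> space M. \<phi> u \<omega> \<le> x}" if "x \<in> Omega" "u \<in> Omega" for x u
    proof -
      have "prob {\<omega> \<in> space M. wait_step u (s \<omega>) (t \<omega>) (y \<omega>) \<le> x} = prob {\<omega> \<in> space M. \<phi> u \<omega> \<le> x}"
        by (rule measure_eq_AE) (use \<phi>_AE[OF that(2)] in \<open>auto elim!: eventually_mono\<close>)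
      then show ?thesis using that(1) by (simp add: prob_wait_step)
    qed
    show "prob {\<omega> \<in> space M. s \<omega> - t \<omega> \<le> - \<delta>} \<le> prob {\<omega> \<in> space M. \<phi> u \<omega> \<le> max (u - \<delta>) 0}"
      if "u \<in> Omega" for u
    proof (rule finite_measure_mono_AE)
      \<comment> \<open>If the customer stays, the event itself gives the bound; otherwise
        \<open>t \<ge> s + \<delta> \<ge> \<delta>\<close>, since service times are
        nonnegative.\<close>
      show "AE \<omega> in M. \<omega> \<in> {\<omega> \<in> space M. s \<omega> - t \<omega> \<le> - \<delta>} \<longrightarrow> \<omega> \<in> {\<omega> \<in> space M. \<phi> u \<omega> \<le> max (u - \<delta>) 0}"
        using \<phi>_AE[OF that] nonneg by eventually_elim (auto simp: wait_step_def max_def)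
    qed measurable
    fix x z assume x: "x \<in> Omega" and z: "z \<in> Omega"
    show "vdist (queue_kernel G D A) x z \<le> ereal ((4 * a1 + 4 * a2) * \<bar>x - z\<bar>)"
      "zeta (queue_kernel G D A) x z \<le> (4 * a1 + 4 * a2) * \<bar>x - z\<bar>"
      using queue_kernel_regular(1) x z unfolding lipschitz_kernel_def by blast+
  qed (use \<delta> queue_kernel_regular(2,3) in auto)
  then show ?thesis by (rule doeblin_chain.unique_stationary_distribution_kernel)
qed

end

text \<open>In the disjoint sum of indices, \<open>Inl\<close> marks \<open>t\<close>,
  \<open>Inr (Inl _)\<close> marks \<open>s\<close> and \<open>Inr (Inr _)\<close> marks
  \<open>y\<close>. Functions of disjoint blocks of an independent family are independent.\<close>

lemma (in prob_space)
  fixes t s y :: "nat \<Rightarrow> 'a \<Rightarrow> real"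
  assumes "indep_vars (\<lambda>_. borel) (case_sum t (case_sum s y)) UNIV"
  shows indep_service_arrival: "indep_var borel (s n) borel (t m)"
    and rv_patience: "y n \<in> borel_measurable M"
    and indep_patience: "S \<in> sets borel \<Longrightarrow> T \<in> sets (borel \<Otimes>\<^sub>M borel) \<Longrightarrow>
      prob {\<omega> \<in> space M. y n \<omega> \<in> S \<and> (s n \<omega>, t m \<omega>) \<in> T}
      = prob {\<omega> \<in> space M. y n \<omega> \<in> S} * prob {\<omega> \<in> space M. (s n \<omega>, t m \<omega>) \<in> T}"
proof -
  let ?X = "case_sum t (case_sum s y)"
  have "indep_var borel ((\<lambda>f. f (Inr (Inl n))) \<circ> (\<lambda>\<omega>. restrict (\<lambda>i. ?X i \<omega>) {Inr (Inl n)}))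
    borel ((\<lambda>f. f (Inl m)) \<circ> (\<lambda>\<omega>. restrict (\<lambda>i. ?X i \<omega>) {Inl m}))"
    by (rule indep_var_compose[OF indep_var_restrict[OF assms]]) auto
  then show "indep_var borel (s n) borel (t m)" by (simp add: comp_def)
  have "random_variable borel (?X (Inr (Inr n)))"
    using assms unfolding indep_vars_def2 by blast
  then show "y n \<in> borel_measurable M" by simp
  assume S [measurable]: "S \<in> sets borel" and T [measurable]: "T \<in> sets (borel \<Otimes>\<^sub>M borel)"
  let ?Y = "\<lambda>\<omega>. indicator S (y n \<omega>) :: real" and ?Z = "\<lambda>\<omega>. indicator T (s n \<omega>, t m \<omega>) :: real"
  \<comment> \<open>Both events become real indicators of disjoint blocks; independence evaluated at
    the value 1 is the product formula.\<close>
  have "indep_var borel ((\<lambda>f. indicator S (f (Inr (Inr n))) :: real) \<circ> (\<lambda>\<omega>. restrict (\<lambda>i. ?X i \<omega>) {Inr (Inr n)}))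
    borel ((\<lambda>f. indicator T (f (Inr (Inl n)), f (Inl m)) :: real) \<circ> (\<lambda>\<omega>. restrict (\<lambda>i. ?X i \<omega>) {Inr (Inl n), Inl m}))"
  proof (rule indep_var_compose[OF indep_var_restrict[OF assms]])
    show "(\<lambda>f. indicator S (f (Inr (Inr n))) :: real) \<in> borel_measurable (Pi\<^sub>M {Inr (Inr n)} (\<lambda>_. borel))"
      by (rule measurable_compose[OF _ borel_measurable_indicator[OF S]]) auto
    show "(\<lambda>f. indicator T (f (Inr (Inl n)), f (Inl m)) :: real) \<in> borel_measurable (Pi\<^sub>M {Inr (Inl n), Inl m} (\<lambda>_. borel))"
      by (rule measurable_compose[OF _ borel_measurable_indicator[OF T]]) auto
  qed auto
  then have "indep_var borel ?Y borel ?Z" by (simp add: comp_def)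
  from indep_varD[OF this, of "{1}" "{1}"]
  show "prob {\<omega> \<in> space M. y n \<omega> \<in> S \<and> (s n \<omega>, t m \<omega>) \<in> T}
      = prob {\<omega> \<in> space M. y n \<omega> \<in> S} * prob {\<omega> \<in> space M. (s n \<omega>, t m \<omega>) \<in> T}"
    by (simp add: vimage_def Int_def conj_commute indicator_def)
qed

theorem theorem6:
  fixes M :: "'a measure"
    and t s y :: "nat \<Rightarrow> 'a \<Rightarrow> real"
    and A B G D A' A'' G' :: "real \<Rightarrow> real"
    and ybar sbar g1 a1 a2 :: real
  assumes "prob_space M"
    and indep: "prob_space.indep_vars M (\<lambda>_. borel) (case_sum t (case_sum s y)) UNIV"
    and dist_t: "\<And>n. cdf (distr M borel (t n)) = A"
    and dist_s: "\<And>n. cdf (distr M borel (s n)) = B"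
    and dist_y: "\<And>n. cdf (distr M borel (y n)) = G"
    and dist_diff: "\<And>n. cdf (distr M borel (\<lambda>\<omega>. s n \<omega> - t (Suc n) \<omega>)) = D"
    and nonneg: "\<And>n. AE \<omega> in M. 0 \<le> t n \<omega> \<and> 0 \<le> s n \<omega> \<and> 0 \<le> y n \<omega>"
    and bounds: "0 \<le> ybar" "0 \<le> sbar" "G ybar = 1" "B sbar = 1" "ybar + sbar \<le> 1"
    and const_nonneg: "0 \<le> g1" "0 \<le> a1" "0 \<le> a2"
    and deriv_G: "\<And>x. x \<in> Omega \<Longrightarrow> (G has_real_derivative G' x) (at x within Omega) \<and> G' x \<le> g1"
    and deriv_A: "\<And>x. x \<in> Omega \<Longrightarrow> (A has_real_derivative A' x) (at x within Omega) \<and> A' x \<le> a1"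
    and deriv2_A: "\<And>x. x \<in> Omega \<Longrightarrow> (A' has_real_derivative A'' x) (at x within Omega) \<and> \<bar>A'' x\<bar> \<le> a2"
    and cont_A: "isCont A 0"
    and drift: "\<And>n. measure M {\<omega> \<in> space M. s n \<omega> - t (Suc n) \<omega> < 0} > 0"
  shows
    "(\<forall>n. \<forall>u\<in>Omega.
        (AE \<omega> in M. wait_step u (s n \<omega>) (t (Suc n) \<omega>) (y n \<omega>) \<in> Omega) \<and>
        (\<forall>x\<in>Omega. measure M {\<omega> \<in> space M. wait_step u (s n \<omega>) (t (Suc n) \<omega>) (y n \<omega>) \<le> x}
           = queue_kernel G D A x u)) \<and>
     uniformly_bounded_variation (queue_kernel G D A) \<and>
     cadlag_countable_jumps (queue_kernel G D A) \<and>
     unique_stationary_distribution (queue_kernel G D A) \<and>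
     (\<forall>r. finite_markov_chain (dyadic_size r) (dyadic_state r) (dyadic_matrix (queue_kernel G D A) r)) \<and>
     proper_truncation (queue_kernel G D A) dyadic_size dyadic_state (dyadic_matrix (queue_kernel G D A))"
proof -
  interpret prob_space M by fact
  have rv [measurable]: "t n \<in> borel_measurable M" "s n \<in> borel_measurable M" "y n \<in> borel_measurable M" for n
    using indep_var_rv2[OF indep_service_arrival[OF indep]] indep_var_rv1[OF indep_service_arrival[OF indep]]
      rv_patience[OF indep] by simp_all
  have A_eq: "A x = prob {\<omega> \<in> space M. t 0 \<omega> \<le> x}" for x unfolding dist_t[of 0, symmetric] by (rule cdf_distr_eq) simp
  have bd: "AE \<omega> in M. s n \<omega> \<le> sbar \<and> y n \<omega> \<le> ybar" for n
  proof -
    have "prob {\<omega> \<in> space M. s n \<omega> \<le> sbar} = 1" "prob {\<omega> \<in> space M. y n \<omega> \<le> ybar} = 1"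
      using cdf_distr_eq[of "s n" sbar] cdf_distr_eq[of "y n" ybar] bounds dist_s dist_y by simp_all
    then show ?thesis by (simp add: prob_Collect_eq_1)
  qed
  have A_neg: "A x = 0" if "x < 0" for x
    unfolding A_eq by (subst prob_eq_0) (use nonneg[of 0] that in \<open>auto elim!: eventually_mono\<close>)
  \<comment> \<open>Continuity at 0 rules out an atom there, so \<open>A\<close> vanishes at 0 too,
    as the passage to \<open>smooth_df\<close> requires.\<close>
  have "(A \<longlongrightarrow> A 0) (at_left 0)" using cont_A by (simp add: isCont_def filterlim_at_split)
  moreover have "(A \<longlongrightarrow> 0) (at_left 0)"
    by (rule tendsto_eventually) (auto simp: eventually_at_left_field A_neg intro!: exI[of _ "-1"])
  ultimately have "A 0 = 0" by (meson tendsto_unique trivial_limit_at_left_real)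
  with A_neg have A_nonpos: "A x = 0" if "x \<le> 0" for x using that by (cases "x = 0") auto
  have smooth: "smooth_df a1 a2 1 A"
    by (rule smooth_df_differentiable[where A' = A' and A'' = A''])
      (use A_nonpos deriv_A deriv2_A const_nonneg in \<open>auto simp: mono_def A_eq intro!: finite_measure_mono\<close>)
  have "abandonment_queue M (t (Suc n)) (s n) (y n) A G D ybar sbar a1 a2" for n
  proof unfold_locales
    show "AE \<omega> in M. 0 \<le> t (Suc n) \<omega> \<and> 0 \<le> s n \<omega> \<and> 0 \<le> y n \<omega>"
      using nonneg[of n] nonneg[of "Suc n"] by eventually_elim auto
    show "continuous_on Omega G" using deriv_G by (intro DERIV_continuous_on) blast
    show "indep_var borel (s n) borel (t (Suc n))" by (rule indep_service_arrival[OF indep])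
  qed (use indep_patience[OF indep] dist_t dist_y dist_diff bd bounds smooth const_nonneg drift in auto)
  \<comment> \<open>\<open>n\<close> stays a parameter: the one-step statements are wanted for every
    arrival, while the kernel does not depend on it.\<close>
  then interpret Q: abandonment_queue M "t (Suc n)" "s n" "y n" A G D ybar sbar a1 a2 for n .
  show ?thesis
    using Q.wait_step_in_Omega Q.prob_wait_step Q.uniformly_bounded_variation_queue
      cadlag_countable_jumps_lipschitz[OF Q.queue_kernel_regular(1)] Q.unique_stationary_distribution_queue
      Q.finite_markov_chain_queue proper_truncation_dyadic[OF Q.queue_kernel_regular(1) Q.queue_kernel_regular(3)]
    by auto
qed

end
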